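(* Let $\mu$ be an in-homogeneous self-similar measure in Case I or Case II (as defined in the context). Set \[ d_0=\frac{\sum_{i=1}^N t_i\log t_i}{\sum_{i=1}^N t_i\log s_i}\ \text{ in Case I},\qquad d_0=\frac{\sum_{i=1}^M t_i\log t_i}{\sum_{i=1}^M t_i\log c_i}\ \text{ in Case II}. \] Then $0<\underline{Q}_0^{d_0}(\mu)\leq\overline{Q}_0^{d_0}(\mu)<\infty$. In particular, $D_0(\mu)$ exists and equals $d_0$.
   Context: Let $d$ be the metric on $\mathbb{R}^q$ induced by a norm. A contractive similitude with contraction ratio $s\in(0,1)$ is a map $f:\mathbb{R}^q\to\mathbb{R}^q$ with $d(f(x),f(y))=s\,d(x,y)$ for all $x,y$. For $n\ge1$ let $\mathcal{D}_n=\{\alpha\subset\mathbb{R}^q:1\le\mathrm{card}(\alpha)\le n\}$ and, for a Borel probability measure $P$ on $\mathbb{R}^q$, let \[ e_{n,0}(P)=\inf_{\alpha\in\mathcal{D}_n}\exp\int\log d(x,\alpha)\,dP(x) \] be the $n$th geometric mean error. For $s>0$ put $\overline{Q}_0^s(P)=\limsup_{n\to\infty}n^{1/s}e_{n,0}(P)$ and $\underline{Q}_0^s(P)=\liminf_{n\to\infty}n^{1/s}e_{n,0}(P)$. Put $\overline{D}_0(P)=\limsup_{n\to\infty}\frac{\log n}{-\log e_{n,0}(P)}$ and $\underline{D}_0(P)=\liminf_{n\to\infty}\frac{\log n}{-\log e_{n,0}(P)}$; if they coincide the common value is denoted $D_0(P)$ (quantization dimension of order zero). A finite family $(h_i)_{i=1}^m$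 of contractive similitudes satisfies the open set condition (OSC) if there is a non-empty bounded open set $U$ with $h_i(U)\cap h_j(U)=\emptyset$ for $i\ne j$ and $\bigcup_i h_i(U)\subset U$. The self-similar measure associated with $(h_i)_{i=1}^m$ and a probability vector $(q_i)_{i=1}^m$ is the unique Borel probability measure $\nu$ with $\nu=\sum_{i=1}^m q_i\,\nu\circ h_i^{-1}$. Let $(f_i)_{i=1}^N$ be contractive similitudes on $\mathbb{R}^q$ with contraction ratios $(s_i)_{i=1}^N$, $E$ the unique non-empty compact set with $E=\bigcup_{i=1}^N f_i(E)$, $(p_i)_{i=0}^N$ a probability vector with $p_i>0$ for all $0\le i\le N$, and $\nu$ a Borel probability measure with compact support $C$. The in-homogeneous self-similar measure (ISM) $\mu$ is the unique Borel probability measure with $\mu=p_0\nu+\sum_{i=1}^N p_i\,\mu\circ f_i^{-1}$. Case I: $N\ge2$, $(f_i)_{i=1}^N$ satisfies the OSC, and $\nu$ is the self-similar measure associated with $(f_i)_{i=1}^N$ and a probability vector $(t_i)_{i=1}^N$ with $t_i>0$ for all $1\le i\le N$. Case II: $\nu$ is the self-similar measure associated with $(g_i)_{i=1}^M$, $M\ge2$, and a probability vector $(t_i)_{i=1}^M$ with $t_i>0$ for all $1\le i\le M$, where $(g_i)_{i=1}^M$ are contractive similitudes on $\mathbb{R}^q$ with contraction ratios $(c_i)_{i=1}^M$ satisfying the OSC; and there exists a bounded non-empty open set $U$ such that (1) $f_i(U)\subset U$ for all $1\le i\le N$; (2) $f_i(U)$, $1\le i\le N$, are pairwise disjoint; (3)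 $E\cap U\ne\emptyset$ and $C\subset U$; (4) $\nu(\partial U)=0$ and $C\cap f_i(\mathrm{cl}(U))=\emptyset$ for all $1\le i\le N$. *)

theory Defs
  imports "HOL-Probability.Probability"
begin

definition is_norm :: "('a::real_vector \<Rightarrow> real) \<Rightarrow> bool" where
  "is_norm nrm \<longleftrightarrow>
     (\<forall>x. 0 \<le> nrm x) \<and> (\<forall>x. nrm x = 0 \<longleftrightarrow> x = 0) \<and>
     (\<forall>a x. nrm (a *\<^sub>R x) = \<bar>a\<bar> * nrm x) \<and>
     (\<forall>x y. nrm (x + y) \<le> nrm x + nrm y)"

text \<open>The metric on \<open>\<real>\<^sup>q\<close> comes from an arbitrary norm, not necessarily the Euclidean
  one carried by the type. All norms on a finite-dimensional space induce the same topology,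
  so open, compact and Borel sets are the library's.\<close>

definition norm_induced_metric :: "('a::real_vector \<Rightarrow> 'a \<Rightarrow> real) \<Rightarrow> bool" where
  "norm_induced_metric d \<longleftrightarrow> (\<exists>nrm. is_norm nrm \<and> d = (\<lambda>x y. nrm (x - y)))"

definition contractive_similitude :: "('a \<Rightarrow> 'a \<Rightarrow> real) \<Rightarrow> real \<Rightarrow> ('a \<Rightarrow> 'a) \<Rightarrow> bool" where
  "contractive_similitude d r h \<longleftrightarrow>
     0 < r \<and> r < 1 \<and> (\<forall>x y. d (h x) (h y) = r * d x y)"

definition borel_probability :: "'a::topological_space measure \<Rightarrow> bool" where
  "borel_probability P \<longleftrightarrow> prob_space P \<and> sets P = sets borel"

definition topological_support :: "'a::topological_space measure \<Rightarrow> 'a set" where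
  "topological_support P = \<Inter>{F. closed F \<and> emeasure P (- F) = 0}"

definition probability_vector :: "nat set \<Rightarrow> (nat \<Rightarrow> real) \<Rightarrow> bool" where
  "probability_vector I w \<longleftrightarrow> (\<forall>i\<in>I. 0 \<le> w i) \<and> (\<Sum>i\<in>I. w i) = 1"


text \<open>The logarithm and exponential on the extended reals, with \<open>log 0 = -\<infinity>\<close>,
  \<open>log \<infinity> = \<infinity>\<close>, \<open>exp (-\<infinity>) = 0\<close> and \<open>exp \<infinity> = \<infinity>\<close>; the library's \<^term>\<open>ln (0::real)\<close>
  is \<open>0\<close>.\<close>

definition elog :: "ereal \<Rightarrow> ereal" where
  "elog x = (if x \<le> 0 then - \<infinity> else if x = \<infinity> then \<infinity> else ereal (ln (real_of_ereal x)))"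

definition eexp :: "ereal \<Rightarrow> ereal" where
  "eexp x = (if x = - \<infinity> then 0 else if x = \<infinity> then \<infinity> else ereal (exp (real_of_ereal x)))"

text \<open>The Lebesgue integral with values in the extended reals, as positive part minus negative
  part: \<^const>\<open>e2ennreal\<close> sends negative numbers to \<open>0\<close>. The Bochner integral would be \<open>0\<close>
  where the value here is infinite. If both parts are infinite then the value is
  \<open>\<infinity> - \<infinity> = \<infinity>\<close>; for the integrands below this cannot happen when the measure has
  compact support.\<close>

definition ereal_integral :: "'a measure \<Rightarrow> ('a \<Rightarrow> ereal) \<Rightarrow> ereal" where
  "ereal_integral P f =
     enn2ereal (\<integral>\<^sup>+ x. e2ennreal (f x) \<partial>P) - enn2ereal (\<integral>\<^sup>+ x. e2ennreal (- f x) \<partial>P)"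

definition dist_to_set :: "('a \<Rightarrow> 'a \<Rightarrow> real) \<Rightarrow> 'a \<Rightarrow> 'a set \<Rightarrow> real" where
  "dist_to_set d x \<alpha> = (INF a\<in>\<alpha>. d x a)"

definition quantizer_sets :: "nat \<Rightarrow> 'a set set" where
  "quantizer_sets n = {\<alpha>. finite \<alpha> \<and> 1 \<le> card \<alpha> \<and> card \<alpha> \<le> n}"

definition geometric_mean_error :: "('a \<Rightarrow> 'a \<Rightarrow> real) \<Rightarrow> 'a measure \<Rightarrow> nat \<Rightarrow> ereal" where
  "geometric_mean_error d P n =
     (INF \<alpha>\<in>quantizer_sets n. eexp (ereal_integral P (\<lambda>x. elog (ereal (dist_to_set d x \<alpha>)))))"

definition upper_quantization_coefficient ::
    "('a \<Rightarrow> 'a \<Rightarrow> real) \<Rightarrow> 'a measure \<Rightarrow> real \<Rightarrow> ereal" where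
  "upper_quantization_coefficient d P s =
     limsup (\<lambda>n. ereal (real n powr (1 / s)) * geometric_mean_error d P n)"

definition lower_quantization_coefficient ::
    "('a \<Rightarrow> 'a \<Rightarrow> real) \<Rightarrow> 'a measure \<Rightarrow> real \<Rightarrow> ereal" where
  "lower_quantization_coefficient d P s =
     liminf (\<lambda>n. ereal (real n powr (1 / s)) * geometric_mean_error d P n)"

definition upper_quantization_dimension :: "('a \<Rightarrow> 'a \<Rightarrow> real) \<Rightarrow> 'a measure \<Rightarrow> ereal" where
  "upper_quantization_dimension d P =
     limsup (\<lambda>n. ereal (ln (real n)) / (- elog (geometric_mean_error d P n)))"

definition lower_quantization_dimension :: "('a \<Rightarrow> 'a \<Rightarrow> real) \<Rightarrow> 'a measure \<Rightarrow> ereal" where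
  "lower_quantization_dimension d P =
     liminf (\<lambda>n. ereal (ln (real n)) / (- elog (geometric_mean_error d P n)))"

definition has_quantization_dimension ::
    "('a \<Rightarrow> 'a \<Rightarrow> real) \<Rightarrow> 'a measure \<Rightarrow> real \<Rightarrow> bool" where
  "has_quantization_dimension d P D \<longleftrightarrow>
     lower_quantization_dimension d P = upper_quantization_dimension d P \<and>
     upper_quantization_dimension d P = ereal D"


definition open_set_condition :: "nat \<Rightarrow> (nat \<Rightarrow> 'a::metric_space \<Rightarrow> 'a) \<Rightarrow> bool" where
  "open_set_condition m h \<longleftrightarrow>
     (\<exists>U. U \<noteq> {} \<and> bounded U \<and> open U \<and>
          disjoint_family_on (\<lambda>i. h i ` U) {1..m} \<and> (\<Union>i\<in>{1..m}. h i ` U) \<subseteq> U)"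

text \<open>For a non-empty family of contractive similitudes and a probability vector of weights, the
  objects in the next three definitions exist and are unique (Hutchinson), so each predicate
  identifies the one set or measure which satisfies it. The set \<open>h i -` A\<close> is the
  preimage of \<open>A\<close>, so \<open>measure P (h i -` A)\<close> is the image measure of \<open>P\<close> under \<open>h i\<close>.\<close>

definition attractor :: "nat \<Rightarrow> (nat \<Rightarrow> 'a::metric_space \<Rightarrow> 'a) \<Rightarrow> 'a set \<Rightarrow> bool" where
  "attractor m h K \<longleftrightarrow> K \<noteq> {} \<and> compact K \<and> K = (\<Union>i\<in>{1..m}. h i ` K)"

definition self_similar_measure ::
    "nat \<Rightarrow> (nat \<Rightarrow> 'a::topological_space \<Rightarrow> 'a) \<Rightarrow> (nat \<Rightarrow> real) \<Rightarrow> 'a measure \<Rightarrow> bool" where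
  "self_similar_measure m h w P \<longleftrightarrow>
     borel_probability P \<and>
     (\<forall>A\<in>sets borel. measure P A = (\<Sum>i=1..m. w i * measure P (h i -` A)))"

definition inhomogeneous_self_similar_measure ::
    "nat \<Rightarrow> (nat \<Rightarrow> 'a::topological_space \<Rightarrow> 'a) \<Rightarrow> (nat \<Rightarrow> real) \<Rightarrow> 'a measure \<Rightarrow> 'a measure \<Rightarrow> bool"
  where
  "inhomogeneous_self_similar_measure m h w Q P \<longleftrightarrow>
     borel_probability P \<and>
     (\<forall>A\<in>sets borel.
        measure P A = w 0 * measure Q A + (\<Sum>i=1..m. w i * measure P (h i -` A)))"


definition case_I ::
    "nat \<Rightarrow> (nat \<Rightarrow> 'a::metric_space \<Rightarrow> 'a) \<Rightarrow> 'a measure \<Rightarrow> (nat \<Rightarrow> real) \<Rightarrow> bool" where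
  "case_I N f \<nu> t \<longleftrightarrow>
     2 \<le> N \<and> open_set_condition N f \<and>
     probability_vector {1..N} t \<and> (\<forall>i\<in>{1..N}. 0 < t i) \<and>
     self_similar_measure N f t \<nu>"

definition case_II ::
    "('a::metric_space \<Rightarrow> 'a \<Rightarrow> real) \<Rightarrow> nat \<Rightarrow> (nat \<Rightarrow> 'a \<Rightarrow> 'a) \<Rightarrow> 'a set \<Rightarrow> 'a measure \<Rightarrow> 'a set \<Rightarrow>
     nat \<Rightarrow> (nat \<Rightarrow> 'a \<Rightarrow> 'a) \<Rightarrow> (nat \<Rightarrow> real) \<Rightarrow> (nat \<Rightarrow> real) \<Rightarrow> bool" where
  "case_II d N f E \<nu> C M g c t \<longleftrightarrow>
     2 \<le> M \<and> (\<forall>i\<in>{1..M}. contractive_similitude d (c i) (g i)) \<and> open_set_condition M g \<and>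
     probability_vector {1..M} t \<and> (\<forall>i\<in>{1..M}. 0 < t i) \<and>
     self_similar_measure M g t \<nu> \<and>
     (\<exists>U. bounded U \<and> U \<noteq> {} \<and> open U \<and>
          (\<forall>i\<in>{1..N}. f i ` U \<subseteq> U) \<and>
          disjoint_family_on (\<lambda>i. f i ` U) {1..N} \<and>
          E \<inter> U \<noteq> {} \<and> C \<subseteq> U \<and>
          measure \<nu> (frontier U) = 0 \<and> (\<forall>i\<in>{1..N}. C \<inter> f i ` closure U = {}))"

end

theory Submission
  imports Defs "HOL-Library.Sublist"
begin

text \<open>
  Write \<open>V\<^sub>n(P)\<close> for the infimum over \<open>n\<close>-point sets \<open>\<alpha>\<close> of \<open>\<integral> log d(x,\<alpha>) dP(x)\<close>, the logarithm
  of the geometric mean error, and \<open>e = 1/D\<close> for the claimed dimension \<open>D\<close>. The assertion is that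
  \<open>V\<^sub>n(\<mu>) + e log n\<close> stays bounded. In both cases \<open>\<nu>\<close> is the self-similar measure of a system
  \<open>(h\<^sub>i)\<close> with ratios \<open>r\<^sub>i\<close>, weights \<open>t\<^sub>i\<close> and the open set condition, and \<open>D\<close> is chosen such
  that \<open>\<Sum> t\<^sub>i (log r\<^sub>i - e log t\<^sub>i) = 0\<close>.

  Upper bound. Let \<open>P = \<Sum> w\<^sub>i P\<^sub>i \<circ> F\<^sub>i\<^sup>-\<^sup>1\<close> with similitudes \<open>F\<^sub>i\<close> of ratio \<open>s\<^sub>i\<close>. If
  \<open>P\<^sub>i\<close> is quantized by \<open>A w\<^sub>i x\<close> points with error \<open>K\<^sub>i - e log (w\<^sub>i x)\<close>, then the union of
  the images of these sets quantizes \<open>P\<close> by \<open>A x\<close> points with error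
  \<open>\<Sum> w\<^sub>i (log s\<^sub>i - e log w\<^sub>i + K\<^sub>i) - e log x\<close> (\<open>quantizable_mixture\<close>). The budget \<open>x\<close> is a
  real number, so that nothing is lost by rounding. For \<open>\<nu>\<close> the constant reproduces itself exactly,
  by the choice of \<open>D\<close>. For \<open>\<mu>\<close> it is multiplied by \<open>1 - p\<^sub>0 < 1\<close> and so remains bounded
  (\<open>quantizable_self\<close>).

  Lower bound for \<open>\<mu>\<close>. A similitude permutes the \<open>n\<close>-point sets, so the defining equation gives
  \<open>V\<^sub>n(\<mu>) \<ge> p\<^sub>0 V\<^sub>n(\<nu>) + \<Sum> p\<^sub>i log s\<^sub>i + (1 - p\<^sub>0) V\<^sub>n(\<mu>)\<close>, where the sum runs over
  \<open>i \<ge> 1\<close>. Once \<open>V\<^sub>n(\<mu>)\<close> is known to be finite, this can be solved for it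
  (\<open>log_error_inhomogeneous\<close>). Finiteness is bought by truncating the logarithm
  at \<open>log \<delta>\<close>; the resulting bounds do not depend on \<open>\<delta>\<close>.

  Lower bound for \<open>\<nu>\<close>. By Schief's theorem (\<open>strong_open_set_condition\<close>) the open set \<open>V\<close> of the
  open set condition can be chosen to meet the support. Points outside \<open>V\<close> are made harmless by
  adding the whole complement of \<open>V\<close> to the quantizing set. This costs only a constant, because
  \<open>log d(x, -V)\<close> is \<open>\<nu>\<close>-integrable. For \<open>\<alpha> \<subseteq> V\<close> the bound
  \<open>\<integral> log d(x, \<alpha> \<union> -V) d\<nu> \<ge> - e log x - L - k card \<alpha> / x\<close> then follows by the same scaling
  induction: the sets \<open>h\<^sub>i(V)\<close> are disjoint, so every point of \<open>\<alpha>\<close> is passed on to at most one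
  piece. It starts at bounded \<open>x\<close>, where \<open>log d(x,\<alpha>)\<close> is bounded below by the sum over the points
  of \<open>\<alpha>\<close> (\<open>log_error_lower_bound\<close>).\<close>

section \<open>Metrics from norms and their similitudes\<close>

locale norm_metric =
  fixes d :: "'a::euclidean_space \<Rightarrow> 'a \<Rightarrow> real"
  assumes norm_induced: "norm_induced_metric d"
begin

lemma d_nonneg: "0 \<le> d x y"
  and d_eq_0_iff: "d x y = 0 \<longleftrightarrow> x = y"
  and d_commute: "d x y = d y x"
  and d_triangle: "d x z \<le> d x y + d y z"
proof -
  obtain nrm where n: "is_norm nrm" and d: "d = (\<lambda>x y. nrm (x - y))"
    using norm_induced unfolding norm_induced_metric_def by blast
  show "0 \<le> d x y" using n by (simp add: d is_norm_def)
  show "d x y = 0 \<longleftrightarrow> x = y" using n by (simp add: d is_norm_def)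
  have "nrm ((-1) *\<^sub>R (x - y)) = \<bar>-1\<bar> * nrm (x - y)" using n unfolding is_norm_def by blast
  moreover have "(-1) *\<^sub>R (x - y) = y - x" by simp
  ultimately show "d x y = d y x" by (simp add: d)
  have "nrm ((x - y) + (y - z)) \<le> nrm (x - y) + nrm (y - z)" using n unfolding is_norm_def by blast
  then show "d x z \<le> d x y + d y z" by (simp add: d)
qed

lemma d_self [simp]: "d x x = 0"
  by (simp add: d_eq_0_iff)

lemma d_le_dist: "\<exists>B>0. \<forall>x y. d x y \<le> B * dist x y"
proof -
  obtain nrm where n: "is_norm nrm" and d: "d = (\<lambda>x y. nrm (x - y))"
    using norm_induced unfolding norm_induced_metric_def by blast
  define B where "B = (\<Sum>b\<in>Basis. nrm b)"
  have n0: "nrm 0 = 0" and scale: "\<And>a x. nrm (a *\<^sub>R x) = \<bar>a\<bar> * nrm x"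
    and add: "\<And>x y. nrm (x + y) \<le> nrm x + nrm y" and pos: "\<And>x. 0 \<le> nrm x"
    using n unfolding is_norm_def by auto
  have sum: "nrm (\<Sum>b\<in>F. g b) \<le> (\<Sum>b\<in>F. nrm (g b))" if "finite F" for F and g :: "'a \<Rightarrow> 'a"
    using that
  proof (induction F rule: finite_induct)
    case (insert x F)
    then show ?case using add[of "g x" "sum g F"] by simp
  qed (simp add: n0)
  have "nrm x \<le> B * norm x" for x
  proof -
    have "nrm x = nrm (\<Sum>b\<in>Basis. (x \<bullet> b) *\<^sub>R b)" by (simp add: euclidean_representation)
    also have "\<dots> \<le> (\<Sum>b\<in>Basis. nrm ((x \<bullet> b) *\<^sub>R b))" by (rule sum) simp
    also have "\<dots> \<le> (\<Sum>b\<in>Basis. norm x * nrm b)"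
      by (intro sum_mono) (auto simp: scale intro!: mult_right_mono Basis_le_norm pos)
    also have "\<dots> = B * norm x" by (simp add: B_def sum_distrib_left mult.commute)
    finally show ?thesis .
  qed
  moreover have "B * norm x \<le> (B + 1) * norm x" for x :: 'a by (simp add: distrib_right)
  ultimately have "d x y \<le> (B + 1) * dist x y" for x y
    unfolding d dist_norm by (meson order_trans)
  moreover have "B \<ge> 0" unfolding B_def by (intro sum_nonneg pos)
  then have "B + 1 > 0" by simp
  ultimately show ?thesis by blast
qed

lemma continuous_on_d [continuous_intros]:
  assumes "continuous_on S g" "continuous_on S k"
  shows "continuous_on S (\<lambda>x. d (g x) (k x))"
proof -
  obtain B where B: "B > 0" "\<And>x y. d x y \<le> B * dist x y" using d_le_dist by blast
  have *: "\<bar>d x y - d x' y'\<bar> \<le> B * (dist x x' + dist y y')" for x y x' y'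
  proof -
    have "d x y \<le> d x x' + (d x' y' + d y' y)" "d x' y' \<le> d x' x + (d x y + d y y')"
      by (meson add_left_mono d_triangle order_trans)+
    then have "\<bar>d x y - d x' y'\<bar> \<le> d x x' + d y y'"
      using d_commute[of x x'] d_commute[of y y'] by linarith
    also have "\<dots> \<le> B * dist x x' + B * dist y y'" by (intro add_mono B(2))
    finally show ?thesis by (simp only: distrib_left)
  qed
  have "dist (d (fst z) (snd z)) (d (fst z') (snd z')) \<le> (B * 2) * dist z z'" for z z' :: "'a \<times> 'a"
  proof -
    have "dist (fst z) (fst z') + dist (snd z) (snd z') \<le> 2 * dist z z'"
      using dist_fst_le[of z z'] dist_snd_le[of z z'] by linarith
    then have "B * (dist (fst z) (fst z') + dist (snd z) (snd z')) \<le> B * (2 * dist z z')"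
      using B(1) by (intro mult_left_mono) auto
    then show ?thesis using *[of "fst z" "snd z" "fst z'" "snd z'"] unfolding dist_real_def by linarith
  qed
  then have "(B * 2)-lipschitz_on UNIV (\<lambda>z::'a\<times>'a. d (fst z) (snd z))"
    using B(1) by (intro lipschitz_onI) auto
  then have "continuous_on UNIV (\<lambda>z::'a\<times>'a. d (fst z) (snd z))"
    by (rule lipschitz_on_continuous_on)
  from continuous_on_compose2[OF this continuous_on_Pair[OF assms]] show ?thesis by simp
qed

lemma dist_le_d: "\<exists>b>0. \<forall>x y. b * dist x y \<le> d x y"
proof -
  obtain nrm where n: "is_norm nrm" and d: "d = (\<lambda>x y. nrm (x - y))"
    using norm_induced unfolding norm_induced_metric_def by blast
  have "continuous_on (sphere 0 1) (\<lambda>x. d x 0)" by (intro continuous_intros)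
  moreover have "compact (sphere (0::'a) 1)" "sphere (0::'a) 1 \<noteq> {}" by auto
  ultimately obtain u where u: "u \<in> sphere 0 1" "\<And>x. x \<in> sphere 0 1 \<Longrightarrow> d u 0 \<le> d x 0"
    using continuous_attains_inf by metis
  have "d u 0 \<noteq> 0" using u(1) d_eq_0_iff by auto
  then have "d u 0 > 0" using d_nonneg[of u 0] by simp
  moreover have "d u 0 * dist x y \<le> d x y" for x y
  proof (cases "x = y")
    case False
    define z where "z = (1 / norm (x - y)) *\<^sub>R (x - y)"
    have "d u 0 \<le> d z 0" using False by (intro u(2)) (simp add: z_def)
    also have "d z 0 = d x y / norm (x - y)" using n by (simp add: d z_def is_norm_def)
    finally show ?thesis using False by (simp add: field_simps dist_norm)
  qed simp
  ultimately show ?thesis by blast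
qed

lemma open_d_ball: "open {y. d x y < r}"
  by (intro open_Collect_less continuous_intros)

lemma compact_d_cball: "compact {y. d x y \<le> r}"
proof -
  obtain b where b: "b > 0" "\<And>x y. b * dist x y \<le> d x y" using dist_le_d by blast
  have "{y. d x y \<le> r} \<subseteq> cball x (r / b)"
  proof
    fix y assume "y \<in> {y. d x y \<le> r}"
    then have "b * dist x y \<le> r" using b(2)[of x y] by simp
    then show "y \<in> cball x (r / b)" using b(1) by (simp add: field_simps)
  qed
  then have "bounded {y. d x y \<le> r}" using bounded_cball bounded_subset by blast
  moreover have "closed {y. d x y \<le> r}" by (intro closed_Collect_le continuous_intros)
  ultimately show ?thesis by (simp add: compact_eq_bounded_closed)
qed

lemma open_contains_d_ball:
  assumes "open U" "x \<in> U"
  shows "\<exists>r>0. {y. d x y < r} \<subseteq> U"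
proof -
  obtain b where b: "b > 0" "\<And>x y. b * dist x y \<le> d x y" using dist_le_d by blast
  obtain e where e: "e > 0" "ball x e \<subseteq> U" using assms openE by blast
  have "{y. d x y < b * e} \<subseteq> ball x e"
  proof
    fix y assume "y \<in> {y. d x y < b * e}"
    then have "b * dist x y < b * e" using b(2)[of x y] by simp
    then show "y \<in> ball x e" using b(1) by simp
  qed
  then show ?thesis using b(1) e by (intro exI[of _ "b * e"]) auto
qed

lemma compact_d_bounded:
  assumes "compact S"
  shows "\<exists>R>0. \<forall>y\<in>S. d x y \<le> R"
proof -
  have "compact (d x ` S)"
    by (intro compact_continuous_image assms continuous_intros)
  then obtain R where "\<forall>z\<in>d x ` S. \<bar>z\<bar> \<le> R"
    using compact_imp_bounded bounded_real by metis
  then have "\<forall>y\<in>S. d x y \<le> max R 1" by fastforce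
  then show ?thesis by (intro exI[of _ "max R 1"]) auto
qed

text \<open>Total boundedness in the form used by the counting argument behind Schief's theorem: a ball
  of radius \<open>e/2\<close> contains at most one point of an \<open>e\<close>-separated set.\<close>

lemma packing_bound:
  assumes "compact S" "0 < e"
  shows "\<exists>\<gamma>::nat. \<forall>A. A \<subseteq> S \<longrightarrow> (\<forall>x\<in>A. \<forall>y\<in>A. x \<noteq> y \<longrightarrow> e \<le> d x y) \<longrightarrow> card A \<le> \<gamma>"
proof -
  have "\<exists>F. finite F \<and> F \<subseteq> S \<and> S \<subseteq> (\<Union>c\<in>F. {y. d c y < e / 2})"
  proof (rule compactE_image[OF assms(1), of S "\<lambda>c. {y. d c y < e / 2}"])
    show "S \<subseteq> (\<Union>c\<in>S. {y. d c y < e / 2})" using assms(2) by force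
  next
    fix F assume "F \<subseteq> S" "finite F" "S \<subseteq> (\<Union>c\<in>F. {y. d c y < e / 2})"
    then show ?thesis by blast
  qed (rule open_d_ball)
  then obtain F where F: "finite F" "S \<subseteq> (\<Union>c\<in>F. {y. d c y < e / 2})" by blast
  have "card A \<le> card F" if A: "A \<subseteq> S" "\<forall>x\<in>A. \<forall>y\<in>A. x \<noteq> y \<longrightarrow> e \<le> d x y" for A
  proof -
    have "\<forall>x\<in>A. \<exists>c\<in>F. d c x < e / 2" using A(1) F(2) by auto
    then obtain \<phi> where \<phi>: "\<And>x. x \<in> A \<Longrightarrow> \<phi> x \<in> F" "\<And>x. x \<in> A \<Longrightarrow> d (\<phi> x) x < e / 2" by metis
    have "inj_on \<phi> A"
    proof (rule inj_onI, rule ccontr)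
      fix x y assume *: "x \<in> A" "y \<in> A" "\<phi> x = \<phi> y" "x \<noteq> y"
      then have "e \<le> d x y" using A(2) by blast
      then show False using \<phi>(2)[of x] \<phi>(2)[of y] * d_triangle[of x y "\<phi> x"] d_commute[of x "\<phi> x"]
        by simp
    qed
    then show ?thesis using \<phi>(1) F(1) by (intro card_inj_on_le[of \<phi>]) auto
  qed
  then show ?thesis by blast
qed

text \<open>Ratios are not required to be below 1, so that the identity is included: it carries the
  condensation measure in the equation of an in-homogeneous self-similar measure.\<close>

definition similitude :: "real \<Rightarrow> ('a \<Rightarrow> 'a) \<Rightarrow> bool" where
  "similitude r h \<longleftrightarrow> 0 < r \<and> (\<forall>x y. d (h x) (h y) = r * d x y)"

lemma similitude_id: "similitude 1 id"
  by (simp add: similitude_def)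

lemma similitude_comp: "similitude r h \<Longrightarrow> similitude q k \<Longrightarrow> similitude (r * q) (h \<circ> k)"
  by (simp add: similitude_def)

lemma similitude_continuous:
  assumes "similitude r h"
  shows "continuous_on S h"
proof -
  obtain B where B: "B > 0" "\<And>x y. d x y \<le> B * dist x y" using d_le_dist by blast
  obtain b where b: "b > 0" "\<And>x y. b * dist x y \<le> d x y" using dist_le_d by blast
  have "dist (h x) (h y) \<le> r * B / b * dist x y" for x y
  proof -
    have "b * dist (h x) (h y) \<le> r * d x y" using b(2)[of "h x" "h y"] assms
      by (simp add: similitude_def)
    also have "\<dots> \<le> r * (B * dist x y)" using assms B(2) by (simp add: similitude_def)
    finally show ?thesis using b(1) by (simp add: field_simps)
  qed
  moreover have "r * B / b \<ge> 0" using assms B(1) b(1) by (simp add: similitude_def)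
  ultimately have "(r * B / b)-lipschitz_on S h" by (auto simp: lipschitz_on_def)
  then show ?thesis by (rule lipschitz_on_continuous_on)
qed

text \<open>The image is open by invariance of domain, and closed because preimages of bounded sets are
  bounded; a connected space has no other non-empty clopen subset. Surjectivity is what makes
  preimages of quantizing sets as good as images.\<close>

lemma similitude_bij:
  assumes h: "similitude r h"
  shows "bij h"
proof -
  have r: "0 < r" "\<And>x y. d (h x) (h y) = r * d x y" using h by (auto simp: similitude_def)
  have inj: "inj h"
    by (rule injI) (metis d_eq_0_iff mult_eq_0_iff order_less_irrefl r)
  have "open (range h)"
    using invariance_of_domain[OF similitude_continuous[OF h] open_UNIV inj] .
  moreover have "closed (range h)"
  proof (rule closed_sequential_limits[THEN iffD2], intro allI impI, elim conjE)
    fix z l assume z: "\<forall>n. z n \<in> range h" and l: "z \<longlonglongrightarrow> l"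
    obtain R where R: "\<And>y. y \<in> range z \<Longrightarrow> d (h 0) y \<le> R"
    proof -
      have "bounded (range z)" using l convergent_imp_bounded convergentI by blast
      then have "compact (closure (range z))" by simp
      then obtain R where "\<forall>y\<in>closure (range z). d (h 0) y \<le> R"
        using compact_d_bounded by blast
      then show thesis by (intro that[of R]) (meson closure_subset subsetD)
    qed
    define K where "K = {y. d 0 y \<le> R / r}"
    have "z n \<in> h ` K" for n
    proof -
      obtain y where y: "z n = h y" using z by blast
      have "d (h 0) (z n) \<le> R" by (rule R) simp
      then have "r * d 0 y \<le> R" using y r(2)[of 0 y] by simp
      then show ?thesis using y r(1) by (auto simp: K_def field_simps)
    qed
    moreover have "compact (h ` K)"
      unfolding K_def by (intro compact_continuous_image compact_d_cball similitude_continuous[OF h])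
    ultimately have "l \<in> h ` K" using l compact_imp_closed closed_sequentially by blast
    then show "l \<in> range h" by blast
  qed
  ultimately have "range h = UNIV" using clopen by blast
  with inj show ?thesis by (simp add: bij_def)
qed

lemma similitude_image_d_ball:
  assumes h: "similitude r h"
  shows "h ` {y. d x y < e} = {z. d (h x) z < r * e}"
proof -
  have r: "0 < r" "\<And>x y. d (h x) (h y) = r * d x y" using h by (auto simp: similitude_def)
  have "{z. d (h x) z < r * e} \<subseteq> h ` {y. d x y < e}"
  proof
    fix z assume z: "z \<in> {z. d (h x) z < r * e}"
    have "surj h" using similitude_bij[OF h] by (simp add: bij_def)
    then obtain y where "z = h y" by blast
    then show "z \<in> h ` {y. d x y < e}" using z r by simp
  qed
  then show ?thesis using r by auto
qed

lemma similitude_open_image: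
  assumes "similitude r h" "open A"
  shows "open (h ` A)"
  by (rule invariance_of_domain[OF similitude_continuous[OF assms(1)] assms(2)])
     (rule inj_on_subset[OF bij_is_inj[OF similitude_bij[OF assms(1)]] subset_UNIV])

lemma dist_to_set_le: "a \<in> A \<Longrightarrow> dist_to_set d x A \<le> d x a"
  unfolding dist_to_set_def by (intro cINF_lower bdd_belowI[of _ 0]) (auto simp: d_nonneg)

lemma dist_to_set_greatest:
  "A \<noteq> {} \<Longrightarrow> (\<And>a. a \<in> A \<Longrightarrow> r \<le> d x a) \<Longrightarrow> r \<le> dist_to_set d x A"
  unfolding dist_to_set_def by (intro cINF_greatest)

lemma dist_to_set_nonneg: "A \<noteq> {} \<Longrightarrow> 0 \<le> dist_to_set d x A"
  by (rule dist_to_set_greatest) (auto simp: d_nonneg)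

lemma dist_to_set_mono: "A \<noteq> {} \<Longrightarrow> A \<subseteq> B \<Longrightarrow> dist_to_set d x B \<le> dist_to_set d x A"
  by (rule dist_to_set_greatest) (auto intro: dist_to_set_le)

lemma dist_to_set_singleton [simp]: "dist_to_set d x {a} = d x a"
  by (simp add: dist_to_set_def)

lemma dist_to_set_insert:
  assumes "A \<noteq> {}"
  shows "dist_to_set d x (insert a A) = min (d x a) (dist_to_set d x A)"
proof (rule antisym)
  show "dist_to_set d x (insert a A) \<le> min (d x a) (dist_to_set d x A)"
    using assms by (auto intro: dist_to_set_le dist_to_set_mono)
  show "min (d x a) (dist_to_set d x A) \<le> dist_to_set d x (insert a A)"
    using dist_to_set_le[of _ A x] by (intro dist_to_set_greatest) (auto simp: min_le_iff_disj)
qed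

lemma dist_to_set_triangle:
  assumes "A \<noteq> {}"
  shows "dist_to_set d x A \<le> d x y + dist_to_set d y A"
proof -
  have "dist_to_set d x A - d x y \<le> dist_to_set d y A"
  proof (rule dist_to_set_greatest[OF assms])
    fix a assume "a \<in> A"
    then show "dist_to_set d x A - d x y \<le> d y a"
      using dist_to_set_le[of a A x] d_triangle[of x a y] by linarith
  qed
  then show ?thesis by simp
qed

lemma continuous_on_dist_to_set [continuous_intros]:
  assumes "A \<noteq> {}" "continuous_on S g"
  shows "continuous_on S (\<lambda>x. dist_to_set d (g x) A)"
proof -
  obtain B where B: "B > 0" "\<And>x y. d x y \<le> B * dist x y" using d_le_dist by blast
  have "B-lipschitz_on UNIV (\<lambda>x. dist_to_set d x A)"
  proof (rule lipschitz_onI)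
    fix x y :: 'a
    have "\<bar>dist_to_set d x A - dist_to_set d y A\<bar> \<le> d x y"
      using dist_to_set_triangle[OF assms(1), of x y] dist_to_set_triangle[OF assms(1), of y x]
        d_commute[of x y] by linarith
    then show "dist (dist_to_set d x A) (dist_to_set d y A) \<le> B * dist x y"
      using B(2)[of x y] by (simp add: dist_real_def)
  qed (use B(1) in simp)
  then have "continuous_on UNIV (\<lambda>x. dist_to_set d x A)" by (rule lipschitz_on_continuous_on)
  from continuous_on_compose2[OF this assms(2)] show ?thesis by simp
qed

lemma dist_to_set_image:
  assumes h: "similitude r h" and A: "A \<noteq> {}"
  shows "dist_to_set d (h x) (h ` A) = r * dist_to_set d x A"
proof (rule antisym)
  have r: "0 < r" "\<And>x y. d (h x) (h y) = r * d x y" using h by (auto simp: similitude_def)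
  have "dist_to_set d (h x) (h ` A) / r \<le> dist_to_set d x A"
  proof (rule dist_to_set_greatest[OF A])
    fix a assume "a \<in> A"
    then have "dist_to_set d (h x) (h ` A) \<le> d (h x) (h a)" by (intro dist_to_set_le) auto
    then show "dist_to_set d (h x) (h ` A) / r \<le> d x a" using r by (simp add: field_simps)
  qed
  then show "dist_to_set d (h x) (h ` A) \<le> r * dist_to_set d x A" using r by (simp add: field_simps)
  show "r * dist_to_set d x A \<le> dist_to_set d (h x) (h ` A)"
    using A dist_to_set_le[of _ A x] r by (intro dist_to_set_greatest) auto
qed

lemma similitude_vimage_nonempty:
  assumes "similitude r h" "A \<noteq> {}"
  shows "h -` A \<noteq> {}"
proof -
  have "surj h" using similitude_bij[OF assms(1)] by (simp add: bij_def)
  then have "h ` (h -` A) = A" by (rule surj_image_vimage_eq)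
  then show ?thesis using assms(2) by (metis image_empty)
qed

lemma dist_to_set_vimage:
  assumes h: "similitude r h" and A: "A \<noteq> {}"
  shows "dist_to_set d (h x) A = r * dist_to_set d x (h -` A)"
proof -
  have "surj h" using similitude_bij[OF h] by (simp add: bij_def)
  then have "h ` (h -` A) = A" by (rule surj_image_vimage_eq)
  then show ?thesis
    using dist_to_set_image[OF h similitude_vimage_nonempty[OF h A], of x] by simp
qed

end

section \<open>Integration against mixtures of image measures\<close>

text \<open>Against these measures every continuous function is integrable, so the truncated logarithms
  of distances below can be integrated by the Bochner integral without further bookkeeping.\<close>

definition compactly_carried :: "'a::euclidean_space measure \<Rightarrow> bool" where
  "compactly_carried P \<longleftrightarrow> borel_probability P \<and> (\<exists>S. compact S \<and> measure P S = 1)"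

lemma compactly_carriedD:
  assumes "compactly_carried P"
  shows "prob_space P" "sets P = sets borel" "space P = UNIV"
  using assms sets_eq_imp_space_eq[of P borel]
  by (auto simp: compactly_carried_def borel_probability_def)

lemma measurable_compactly_carried:
  assumes "compactly_carried P" "h \<in> borel_measurable borel"
  shows "h \<in> borel_measurable P"
  using assms(2) measurable_cong_sets[OF compactly_carriedD(2)[OF assms(1)] refl] by blast

lemma AE_in_carrier:
  assumes "compactly_carried P" "compact S" "measure P S = 1"
  shows "AE x in P. x \<in> S"
proof -
  interpret prob_space P using compactly_carriedD[OF assms(1)] by blast
  have "S \<in> sets P" using compactly_carriedD(2)[OF assms(1)] assms(2) borel_compact by auto
  then show ?thesis using assms(3) AE_prob_1 by blast
qed

lemma AE_bounded_continuous:
  fixes P :: "'a::euclidean_space measure" and h :: "'a \<Rightarrow> real"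
  assumes P: "compactly_carried P" and h: "continuous_on UNIV h"
  shows "\<exists>B. AE x in P. \<bar>h x\<bar> \<le> B"
proof -
  obtain S where S: "compact S" "measure P S = 1"
    using P unfolding compactly_carried_def by blast
  have "compact (h ` S)" using S(1) h continuous_on_subset by (blast intro: compact_continuous_image)
  then obtain B where B: "\<forall>y\<in>h ` S. \<bar>y\<bar> \<le> B" using compact_imp_bounded bounded_real by metis
  have "AE x in P. \<bar>h x\<bar> \<le> B"
    using AE_in_carrier[OF P S] by eventually_elim (use B in auto)
  then show ?thesis by blast
qed

lemma integrable_compactly_carried:
  fixes P :: "'a::euclidean_space measure" and h :: "'a \<Rightarrow> real"
  assumes P: "compactly_carried P" and h: "continuous_on UNIV h"
  shows "integrable P h"
proof -
  interpret prob_space P using compactly_carriedD[OF P] by blast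
  obtain B where "AE x in P. \<bar>h x\<bar> \<le> B" using AE_bounded_continuous[OF P h] by blast
  moreover have "h \<in> borel_measurable P"
    using h by (intro measurable_compactly_carried[OF P] borel_measurable_continuous_onI)
  ultimately show ?thesis by (intro integrable_const_bound[of _ B]) auto
qed

lemma integral_mono_compactly_carried:
  fixes P :: "'a::euclidean_space measure" and h :: "'a \<Rightarrow> real"
  assumes P: "compactly_carried P" and "continuous_on UNIV h" "continuous_on UNIV k"
    and "\<And>x. h x \<le> k x"
  shows "(\<integral>x. h x \<partial>P) \<le> (\<integral>x. k x \<partial>P)"
  using assms by (intro integral_mono integrable_compactly_carried) auto

lemma integral_compactly_carried_ge:
  fixes P :: "'a::euclidean_space measure" and h :: "'a \<Rightarrow> real"
  assumes P: "compactly_carried P" and h: "continuous_on UNIV h" and "AE x in P. c \<le> h x"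
  shows "c \<le> (\<integral>x. h x \<partial>P)"
proof -
  interpret prob_space P using compactly_carriedD[OF P] by blast
  show ?thesis using assms by (intro integral_ge_const integrable_compactly_carried) auto
qed

lemma integral_compactly_carried_le:
  fixes P :: "'a::euclidean_space measure" and h :: "'a \<Rightarrow> real"
  assumes P: "compactly_carried P" and h: "continuous_on UNIV h" and "AE x in P. h x \<le> c"
  shows "(\<integral>x. h x \<partial>P) \<le> c"
proof -
  interpret prob_space P using compactly_carriedD[OF P] by blast
  show ?thesis using assms by (intro integral_le_const integrable_compactly_carried) auto
qed

lemma integral_const_add:
  fixes P :: "'a::euclidean_space measure" and h :: "'a \<Rightarrow> real"
  assumes P: "compactly_carried P" and h: "continuous_on UNIV h"
  shows "(\<integral>x. c + h x \<partial>P) = c + (\<integral>x. h x \<partial>P)"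
proof -
  interpret prob_space P using compactly_carriedD[OF P] by blast
  show ?thesis using integrable_compactly_carried[OF P h] by (simp add: prob_space)
qed

text \<open>The equation between measures of sets extends to integrals by the standard induction over
  nonnegative measurable functions.\<close>

lemma nn_integral_mixture:
  fixes P :: "'a::topological_space measure" and Q :: "'i \<Rightarrow> 'a measure"
    and F :: "'i \<Rightarrow> 'a \<Rightarrow> 'a" and h :: "'a \<Rightarrow> ennreal"
  assumes I: "finite I" and sets: "sets P = sets borel" "\<And>i. i \<in> I \<Longrightarrow> sets (Q i) = sets borel"
    and F: "\<And>i. i \<in> I \<Longrightarrow> F i \<in> borel_measurable borel"
    and eq: "\<And>A. A \<in> sets borel \<Longrightarrow>
               emeasure P A = (\<Sum>i\<in>I. ennreal (w i) * emeasure (Q i) (F i -` A))"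
    and h: "h \<in> borel_measurable borel"
  shows "(\<integral>\<^sup>+x. h x \<partial>P) = (\<Sum>i\<in>I. ennreal (w i) * (\<integral>\<^sup>+x. h (F i x) \<partial>Q i))"
proof -
  have mQ: "k \<in> borel_measurable (Q i)" if "i \<in> I" "k \<in> borel_measurable borel" for i
      and k :: "'a \<Rightarrow> ennreal"
    using that(2) by (simp add: measurable_cong_sets[OF sets(2)[OF that(1)] refl])
  have mF: "(\<lambda>x. k (F i x)) \<in> borel_measurable (Q i)"
    if "i \<in> I" "k \<in> borel_measurable borel" for i and k :: "'a \<Rightarrow> ennreal"
    by (intro mQ that(1) measurable_compose[OF F[OF that(1)] that(2)])
  have mP: "k \<in> borel_measurable P" if "k \<in> borel_measurable borel" for k :: "'a \<Rightarrow> ennreal"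
    using that by (simp add: measurable_cong_sets[OF sets(1) refl])
  show ?thesis
    using h
  proof (induction h rule: borel_measurable_induct)
    case (cong f g)
    then show ?case by auto
  next
    case (set A)
    have "F i -` A \<in> sets (Q i)" if "i \<in> I" for i
      using measurable_sets[OF F[OF that] set] sets(2)[OF that] by simp
    then have "(\<integral>\<^sup>+x. indicator A (F i x) \<partial>Q i) = emeasure (Q i) (F i -` A)" if "i \<in> I" for i
    proof -
      have "(\<integral>\<^sup>+x. indicator A (F i x) \<partial>Q i) = (\<integral>\<^sup>+x. indicator (F i -` A) x \<partial>Q i)"
        by (intro nn_integral_cong) (simp add: indicator_def)
      then show ?thesis using \<open>\<And>i. i \<in> I \<Longrightarrow> F i -` A \<in> sets (Q i)\<close>[OF that] by simp
    qed
    moreover have "(\<integral>\<^sup>+x. indicator A x \<partial>P) = emeasure P A" using set sets(1) by simp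
    ultimately show ?case using eq[OF set] by simp
  next
    case (mult u c)
    have "(\<integral>\<^sup>+x. c * u x \<partial>P) = c * (\<Sum>i\<in>I. ennreal (w i) * (\<integral>\<^sup>+x. u (F i x) \<partial>Q i))"
      using mult by (simp add: nn_integral_cmult mP)
    also have "\<dots> = (\<Sum>i\<in>I. ennreal (w i) * (\<integral>\<^sup>+x. c * u (F i x) \<partial>Q i))"
      unfolding sum_distrib_left using mult
      by (intro sum.cong refl) (simp add: nn_integral_cmult mF mult.left_commute)
    finally show ?case .
  next
    case (add u v)
    have "(\<integral>\<^sup>+x. v x + u x \<partial>P) = (\<integral>\<^sup>+x. v x \<partial>P) + (\<integral>\<^sup>+x. u x \<partial>P)"
      using add by (intro nn_integral_add mP)
    also have "\<dots> = (\<Sum>i\<in>I. ennreal (w i) * (\<integral>\<^sup>+x. v (F i x) + u (F i x) \<partial>Q i))"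
      using add by (simp add: nn_integral_add mF sum.distrib[symmetric] distrib_left)
    finally show ?case .
  next
    case (seq U)
    have "(\<integral>\<^sup>+x. (SUP n. U n x) \<partial>P) = (SUP n. \<integral>\<^sup>+x. U n x \<partial>P)"
      using seq by (intro nn_integral_monotone_convergence_SUP mP)
    also have "\<dots> = (SUP n. \<Sum>i\<in>I. ennreal (w i) * (\<integral>\<^sup>+x. U n (F i x) \<partial>Q i))"
      using seq by simp
    also have "\<dots> = (\<Sum>i\<in>I. SUP n. ennreal (w i) * (\<integral>\<^sup>+x. U n (F i x) \<partial>Q i))"
      using seq(3) by (intro ennreal_SUP_sum)
        (auto simp: incseq_def le_fun_def intro!: mult_left_mono nn_integral_mono)
    also have "\<dots> = (\<Sum>i\<in>I. ennreal (w i) * (\<integral>\<^sup>+x. (SUP n. U n (F i x)) \<partial>Q i))"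
    proof (intro sum.cong refl)
      fix i assume i: "i \<in> I"
      have "incseq (\<lambda>n x. U n (F i x))" using seq(3) by (auto simp: incseq_def le_fun_def)
      then have "(\<integral>\<^sup>+x. (SUP n. U n (F i x)) \<partial>Q i) = (SUP n. \<integral>\<^sup>+x. U n (F i x) \<partial>Q i)"
        using seq(1) i by (intro nn_integral_monotone_convergence_SUP mF)
      then show "(SUP n. ennreal (w i) * (\<integral>\<^sup>+x. U n (F i x) \<partial>Q i))
          = ennreal (w i) * (\<integral>\<^sup>+x. (SUP n. U n (F i x)) \<partial>Q i)"
        by (simp add: SUP_mult_left_ennreal)
    qed
    finally show ?case by (simp add: image_comp)
  qed
qed

text \<open>The equation \<open>P = \<Sum> w\<^sub>i Q\<^sub>i \<circ> F\<^sub>i\<^sup>-\<^sup>1\<close>. A self-similar measure is the case in which all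
  \<open>Q\<^sub>i\<close> are \<open>P\<close>; an in-homogeneous one has the condensation measure as \<open>Q\<^sub>0\<close>, with \<open>F\<^sub>0\<close> the
  identity. Both recursions can therefore be treated by the same lemmas.\<close>

definition mixture ::
    "'i set \<Rightarrow> ('i \<Rightarrow> real) \<Rightarrow> ('i \<Rightarrow> 'a \<Rightarrow> 'a) \<Rightarrow> ('i \<Rightarrow> 'a measure) \<Rightarrow> 'a::euclidean_space measure \<Rightarrow> bool"
  where
  "mixture I w F Q P \<longleftrightarrow>
     finite I \<and> (\<forall>i\<in>I. 0 < w i) \<and> sum w I = 1 \<and>
     compactly_carried P \<and> (\<forall>i\<in>I. compactly_carried (Q i) \<and> continuous_on UNIV (F i)) \<and>
     (\<forall>A\<in>sets borel. measure P A = (\<Sum>i\<in>I. w i * measure (Q i) (F i -` A)))"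

lemma integral_mixture:
  fixes h :: "'a::euclidean_space \<Rightarrow> real"
  assumes mix: "mixture I w F Q P" and h: "continuous_on UNIV h"
  shows "(\<integral>x. h x \<partial>P) = (\<Sum>i\<in>I. w i * (\<integral>x. h (F i x) \<partial>Q i))"
proof -
  have I: "finite I" "\<And>i. i \<in> I \<Longrightarrow> 0 < w i" "sum w I = 1"
    and P: "compactly_carried P" and Q: "\<And>i. i \<in> I \<Longrightarrow> compactly_carried (Q i)"
    and F: "\<And>i. i \<in> I \<Longrightarrow> continuous_on UNIV (F i)"
    and meas: "\<And>A. A \<in> sets borel \<Longrightarrow> measure P A = (\<Sum>i\<in>I. w i * measure (Q i) (F i -` A))"
    using mix unfolding mixture_def by auto
  interpret P: prob_space P using compactly_carriedD[OF P] by blast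
  have hF: "continuous_on UNIV (\<lambda>x. h (F i x))" if "i \<in> I" for i
    using continuous_on_compose2[OF h F[OF that]] by simp
  obtain BP where BP: "AE x in P. \<bar>h x\<bar> \<le> BP" using AE_bounded_continuous[OF P h] by blast
  have "\<forall>i\<in>I. \<exists>B. AE x in Q i. \<bar>h (F i x)\<bar> \<le> B"
    using AE_bounded_continuous[OF Q hF] by blast
  then obtain BQ where BQ: "\<And>i. i \<in> I \<Longrightarrow> AE x in Q i. \<bar>h (F i x)\<bar> \<le> BQ i" by metis
  \<comment> \<open>Adding a large constant makes all integrands nonnegative, so that the extended
    nonnegative integral applies.\<close>
  define B where "B = \<bar>BP\<bar> + (\<Sum>i\<in>I. \<bar>BQ i\<bar>)"
  have BB: "BP \<le> B" "\<And>i. i \<in> I \<Longrightarrow> BQ i \<le> B"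
  proof -
    have "0 \<le> (\<Sum>i\<in>I. \<bar>BQ i\<bar>)" by (rule sum_nonneg) simp
    then show "BP \<le> B" unfolding B_def using abs_ge_self[of BP] by linarith
    show "BQ i \<le> B" if "i \<in> I" for i
      unfolding B_def using member_le_sum[of i I "\<lambda>i. \<bar>BQ i\<bar>"] that I(1) by simp
  qed
  have hB: "continuous_on UNIV (\<lambda>x. B + h x)" by (intro continuous_intros h)
  have hFB: "continuous_on UNIV (\<lambda>x. B + h (F i x))" if "i \<in> I" for i
    by (intro continuous_intros hF that)
  have posP: "AE x in P. 0 \<le> B + h x" using BP by eventually_elim (use BB in auto)
  have posQ: "AE x in Q i. 0 \<le> B + h (F i x)" if "i \<in> I" for i
    using BQ[OF that] by eventually_elim (use BB(2)[OF that] in auto)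
  have "ennreal (\<integral>x. B + h x \<partial>P) = (\<integral>\<^sup>+x. ennreal (B + h x) \<partial>P)"
    using nn_integral_eq_integral[OF integrable_compactly_carried[OF P hB] posP] by simp
  also have "\<dots> = (\<Sum>i\<in>I. ennreal (w i) * (\<integral>\<^sup>+x. ennreal (B + h (F i x)) \<partial>Q i))"
  proof (rule nn_integral_mixture[OF I(1)])
    fix A :: "'a set" assume A: "A \<in> sets borel"
    have "emeasure P A = ennreal (\<Sum>i\<in>I. w i * measure (Q i) (F i -` A))"
      by (simp add: P.emeasure_eq_measure meas[OF A])
    also have "\<dots> = (\<Sum>i\<in>I. ennreal (w i * measure (Q i) (F i -` A)))"
      using I(2) by (intro sum_ennreal[symmetric]) (simp add: less_imp_le)
    also have "\<dots> = (\<Sum>i\<in>I. ennreal (w i) * emeasure (Q i) (F i -` A))"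
    proof (intro sum.cong refl)
      fix i assume i: "i \<in> I"
      interpret Q: prob_space "Q i" using compactly_carriedD[OF Q[OF i]] by blast
      show "ennreal (w i * measure (Q i) (F i -` A)) = ennreal (w i) * emeasure (Q i) (F i -` A)"
        using I(2)[OF i] by (simp add: Q.emeasure_eq_measure ennreal_mult)
    qed
    finally show "emeasure P A = (\<Sum>i\<in>I. ennreal (w i) * emeasure (Q i) (F i -` A))" .
  next
    show "F i \<in> borel_measurable borel" if "i \<in> I" for i
      by (rule borel_measurable_continuous_onI[OF F[OF that]])
    have "(\<lambda>x. B + h x) \<in> borel_measurable borel" by (rule borel_measurable_continuous_onI[OF hB])
    then show "(\<lambda>x. ennreal (B + h x)) \<in> borel_measurable borel" by simp
  qed (use compactly_carriedD(2)[OF P] compactly_carriedD(2)[OF Q] in simp_all)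
  also have "\<dots> = (\<Sum>i\<in>I. ennreal (w i) * ennreal (\<integral>x. B + h (F i x) \<partial>Q i))"
    using nn_integral_eq_integral[OF integrable_compactly_carried[OF Q hFB] posQ] by simp
  also have "\<dots> = (\<Sum>i\<in>I. ennreal (w i * (\<integral>x. B + h (F i x) \<partial>Q i)))"
    using I(2) by (intro sum.cong refl ennreal_mult[symmetric] integral_nonneg_AE posQ) (auto simp: less_imp_le)
  also have "\<dots> = ennreal (\<Sum>i\<in>I. w i * (\<integral>x. B + h (F i x) \<partial>Q i))"
    using I(2) by (intro sum_ennreal mult_nonneg_nonneg integral_nonneg_AE posQ) (auto simp: less_imp_le)
  finally have "(\<integral>x. B + h x \<partial>P) = (\<Sum>i\<in>I. w i * (\<integral>x. B + h (F i x) \<partial>Q i))"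
    using I(2) posP posQ
    by (subst (asm) ennreal_inj) (auto intro!: sum_nonneg mult_nonneg_nonneg integral_nonneg_AE simp: less_imp_le)
  also have "\<dots> = (\<Sum>i\<in>I. w i * B + w i * (\<integral>x. h (F i x) \<partial>Q i))"
    by (intro sum.cong refl) (simp add: integral_const_add[OF Q hF] distrib_left)
  also have "\<dots> = B + (\<Sum>i\<in>I. w i * (\<integral>x. h (F i x) \<partial>Q i))"
    by (simp add: sum.distrib sum_distrib_right[symmetric] I(3))
  finally show ?thesis by (simp add: integral_const_add[OF P h])
qed

section \<open>Upper bounds for the error\<close>

lemma weight_less_1:
  fixes w :: "'i \<Rightarrow> real"
  assumes "finite I" "\<And>i. i \<in> I \<Longrightarrow> 0 < w i" "sum w I = 1" "i \<in> I" "j \<in> I" "i \<noteq> j"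
  shows "w i < 1"
proof -
  have "w i + w j = sum w {i, j}" using assms by simp
  also have "\<dots> \<le> sum w I" using assms by (intro sum_mono2) (auto simp: less_imp_le)
  finally show ?thesis using assms(2)[OF assms(5)] assms(3) by simp
qed

text \<open>Induction along the recursion \<open>x \<mapsto> w\<^sub>i x\<close> of a real budget. One step leads from \<open>x > 1\<close> to
  values that are still at least \<open>\<theta>\<close>, and finitely many steps reach \<open>[\<theta>, 1]\<close> because the
  weights are bounded away from 1.\<close>

lemma scaling_induct:
  fixes w :: "'i \<Rightarrow> real"
  assumes I: "finite I" and \<theta>: "0 < \<theta>" and w: "\<And>i. i \<in> I \<Longrightarrow> \<theta> \<le> w i" "\<And>i. i \<in> I \<Longrightarrow> w i < 1"
    and base: "\<And>x. \<theta> \<le> x \<Longrightarrow> x \<le> 1 \<Longrightarrow> \<Phi> x"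
    and step: "\<And>x. 1 < x \<Longrightarrow> (\<And>i. i \<in> I \<Longrightarrow> \<Phi> (w i * x)) \<Longrightarrow> \<Phi> x"
    and x: "\<theta> \<le> x"
  shows "\<Phi> x"
proof -
  define m where "m = Max (insert (1 / 2) (w ` I))"
  have fin: "finite (insert (1 / 2) (w ` I))" using I by simp
  have m: "0 < m" "m < 1" "\<And>i. i \<in> I \<Longrightarrow> w i \<le> m"
  proof -
    have "1 / 2 \<le> m" unfolding m_def using fin by (intro Max_ge) auto
    then show "0 < m" by simp
    show "m < 1" unfolding m_def using w(2) by (subst Max_less_iff[OF fin]) auto
    show "w i \<le> m" if "i \<in> I" for i unfolding m_def using fin that by (intro Max_ge) auto
  qed
  have *: "\<Phi> x" if "\<theta> \<le> x" "x * m ^ k \<le> 1" for x k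
    using that
  proof (induction k arbitrary: x)
    case 0
    then show ?case using base by simp
  next
    case (Suc k)
    show ?case
    proof (cases "x \<le> 1")
      case False
      show ?thesis
      proof (rule step)
        fix i assume i: "i \<in> I"
        have "\<theta> * 1 \<le> w i * x" using w(1)[OF i] False \<theta> by (intro mult_mono) auto
        moreover have "w i * x * m ^ k \<le> m * x * m ^ k"
          using m(1) m(3)[OF i] False by (intro mult_right_mono) auto
        ultimately show "\<Phi> (w i * x)" using Suc.prems(2) by (intro Suc.IH) (auto simp: mult_ac)
      qed (use False in simp)
    qed (use base Suc.prems in simp)
  qed
  obtain k where "m ^ k < 1 / x" using real_arch_pow_inv[of "1 / x" m] m x \<theta> by auto
  then have "x * m ^ k \<le> 1" using x \<theta> by (simp add: field_simps)
  with * x show ?thesis by blast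
qed

context norm_metric
begin

lemma continuous_on_ln_dist_to_set [continuous_intros]:
  "A \<noteq> {} \<Longrightarrow> 0 < \<delta> \<Longrightarrow> continuous_on S h \<Longrightarrow>
    continuous_on S (\<lambda>x. ln (max \<delta> (dist_to_set d (h x) A)))"
  by (intro continuous_intros) auto

text \<open>The error is measured by the logarithm truncated from below at some \<open>\<delta>\<close>, which bounds the
  genuine error from above and keeps the integrand continuous.\<close>

definition quantizable :: "'a measure \<Rightarrow> real \<Rightarrow> real \<Rightarrow> real \<Rightarrow> real \<Rightarrow> bool" where
  "quantizable P A K e x \<longleftrightarrow>
     (\<exists>\<alpha> \<delta>. finite \<alpha> \<and> \<alpha> \<noteq> {} \<and> real (card \<alpha>) \<le> A * x \<and> 0 < \<delta> \<and>
        (\<integral>y. ln (max \<delta> (dist_to_set d y \<alpha>)) \<partial>P) \<le> K - e * ln x)"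

lemma quantizable_mono:
  assumes "quantizable P A K e x" "A \<le> A'" "K \<le> K'" "0 \<le> x"
  shows "quantizable P A' K' e x"
proof -
  have "A * x \<le> A' * x" using assms by (intro mult_right_mono)
  moreover have "K - e * ln x \<le> K' - e * ln x" using assms by simp
  ultimately show ?thesis using assms(1) unfolding quantizable_def by (meson order_trans)
qed

lemma quantizable_rescale:
  assumes "\<And>x. 1 \<le> x \<Longrightarrow> quantizable P A K e x" "0 < \<theta>" "\<theta> \<le> x"
  shows "quantizable P (A / \<theta>) (K + e * ln \<theta>) e x"
proof -
  have "quantizable P A K e (x / \<theta>)" using assms by (intro assms(1)) simp
  then show ?thesis using assms(2,3) by (simp add: quantizable_def ln_div algebra_simps)
qed

text \<open>Each piece \<open>Q\<^sub>i\<close> receives the share \<open>w\<^sub>i\<close> of the budget, and the images of the quantizing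
  sets are united. The point counts add up exactly since the weights sum to 1; the term
  \<open>- e log w\<^sub>i\<close> is the price of the smaller budget, and \<open>log s\<^sub>i\<close> the gain from the
  contraction.\<close>

lemma quantizable_mixture:
  assumes mix: "mixture I w F Q P" and sim: "\<And>i. i \<in> I \<Longrightarrow> similitude (s i) (F i)"
    and x: "0 < x" and q: "\<And>i. i \<in> I \<Longrightarrow> quantizable (Q i) A (K i) e (w i * x)"
    and K: "(\<Sum>i\<in>I. w i * (ln (s i) - e * ln (w i) + K i)) \<le> L"
  shows "quantizable P A L e x"
proof -
  have I: "finite I" "\<And>i. i \<in> I \<Longrightarrow> 0 < w i" "sum w I = 1"
    and P: "compactly_carried P" and Q: "\<And>i. i \<in> I \<Longrightarrow> compactly_carried (Q i)"
    and F: "\<And>i. i \<in> I \<Longrightarrow> continuous_on UNIV (F i)"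
    using mix unfolding mixture_def by auto
  have "I \<noteq> {}" using I(3) by auto
  have s: "\<And>i. i \<in> I \<Longrightarrow> 0 < s i" using sim by (simp add: similitude_def)
  have "\<forall>i\<in>I. \<exists>\<alpha> \<delta>. finite \<alpha> \<and> \<alpha> \<noteq> {} \<and> real (card \<alpha>) \<le> A * (w i * x) \<and> 0 < \<delta> \<and>
        (\<integral>y. ln (max \<delta> (dist_to_set d y \<alpha>)) \<partial>Q i) \<le> K i - e * ln (w i * x)"
    using q unfolding quantizable_def by blast
  then obtain \<alpha> \<delta> where \<alpha>: "\<And>i. i \<in> I \<Longrightarrow> finite (\<alpha> i)" "\<And>i. i \<in> I \<Longrightarrow> \<alpha> i \<noteq> {}"
      "\<And>i. i \<in> I \<Longrightarrow> real (card (\<alpha> i)) \<le> A * (w i * x)"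
    and \<delta>: "\<And>i. i \<in> I \<Longrightarrow> 0 < \<delta> i"
    and int: "\<And>i. i \<in> I \<Longrightarrow>
        (\<integral>y. ln (max (\<delta> i) (dist_to_set d y (\<alpha> i))) \<partial>Q i) \<le> K i - e * ln (w i * x)"
    by metis
  define \<beta> where "\<beta> = (\<Union>i\<in>I. F i ` \<alpha> i)"
  define \<epsilon> where "\<epsilon> = Min ((\<lambda>i. s i * \<delta> i) ` I)"
  have \<epsilon>: "0 < \<epsilon>" "\<And>i. i \<in> I \<Longrightarrow> \<epsilon> \<le> s i * \<delta> i"
    unfolding \<epsilon>_def using I \<open>I \<noteq> {}\<close> s \<delta> by (auto simp: Min_gr_iff intro: Min_le)
  have \<beta>: "finite \<beta>" "\<beta> \<noteq> {}" using I(1) \<alpha>(1,2) \<open>I \<noteq> {}\<close> by (auto simp: \<beta>_def)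
  have "card \<beta> \<le> (\<Sum>i\<in>I. card (F i ` \<alpha> i))" unfolding \<beta>_def by (rule card_UN_le[OF I(1)])
  also have "\<dots> \<le> (\<Sum>i\<in>I. card (\<alpha> i))" by (intro sum_mono card_image_le \<alpha>)
  finally have "real (card \<beta>) \<le> (\<Sum>i\<in>I. real (card (\<alpha> i)))" by (simp flip: of_nat_sum)
  also have "\<dots> \<le> (\<Sum>i\<in>I. A * (w i * x))" by (intro sum_mono \<alpha>)
  also have "\<dots> = A * x" using I(3) by (simp flip: sum_distrib_left sum_distrib_right)
  finally have card: "real (card \<beta>) \<le> A * x" .
  have "(\<integral>y. ln (max \<epsilon> (dist_to_set d y \<beta>)) \<partial>P)
      = (\<Sum>i\<in>I. w i * (\<integral>y. ln (max \<epsilon> (dist_to_set d (F i y) \<beta>)) \<partial>Q i))"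
    by (intro integral_mixture[OF mix] continuous_intros \<beta> \<epsilon>)
  also have "\<dots> \<le> (\<Sum>i\<in>I. w i * (ln (s i) + (K i - e * ln (w i * x))))"
  proof (intro sum_mono mult_left_mono)
    fix i assume i: "i \<in> I"
    have "ln (max \<epsilon> (dist_to_set d (F i y) \<beta>)) \<le> ln (s i) + ln (max (\<delta> i) (dist_to_set d y (\<alpha> i)))" for y
    proof -
      have "dist_to_set d (F i y) \<beta> \<le> s i * dist_to_set d y (\<alpha> i)"
        using dist_to_set_mono[of "F i ` \<alpha> i" \<beta> "F i y"] dist_to_set_image[OF sim[OF i] \<alpha>(2)[OF i]] i \<alpha>(2)[OF i]
        by (auto simp: \<beta>_def)
      then have "max \<epsilon> (dist_to_set d (F i y) \<beta>) \<le> max (s i * \<delta> i) (s i * dist_to_set d y (\<alpha> i))"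
        using \<epsilon>(2)[OF i] by (intro max.mono)
      also have "\<dots> = s i * max (\<delta> i) (dist_to_set d y (\<alpha> i))"
        using s[OF i] by (simp add: max_mult_distrib_left)
      finally have "max \<epsilon> (dist_to_set d (F i y) \<beta>) \<le> s i * max (\<delta> i) (dist_to_set d y (\<alpha> i))" .
      then have "ln (max \<epsilon> (dist_to_set d (F i y) \<beta>)) \<le> ln (s i * max (\<delta> i) (dist_to_set d y (\<alpha> i)))"
        using \<epsilon>(1) by (intro ln_mono) auto
      also have "\<dots> = ln (s i) + ln (max (\<delta> i) (dist_to_set d y (\<alpha> i)))"
        using s[OF i] \<delta>[OF i] by (intro ln_mult_pos) auto
      finally show ?thesis .
    qed
    then have "(\<integral>y. ln (max \<epsilon> (dist_to_set d (F i y) \<beta>)) \<partial>Q i)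
        \<le> (\<integral>y. ln (s i) + ln (max (\<delta> i) (dist_to_set d y (\<alpha> i))) \<partial>Q i)"
      using i by (intro integral_mono_compactly_carried[OF Q] continuous_intros \<beta> \<epsilon> F \<alpha> \<delta>)
    also have "\<dots> = ln (s i) + (\<integral>y. ln (max (\<delta> i) (dist_to_set d y (\<alpha> i))) \<partial>Q i)"
      using i by (intro integral_const_add[OF Q] continuous_intros \<alpha> \<delta>)
    finally show "(\<integral>y. ln (max \<epsilon> (dist_to_set d (F i y) \<beta>)) \<partial>Q i) \<le> ln (s i) + (K i - e * ln (w i * x))"
      using int[OF i] by linarith
  qed (use I(2) in \<open>simp add: less_imp_le\<close>)
  also have "\<dots> = (\<Sum>i\<in>I. w i * (ln (s i) - e * ln (w i) + K i) - w i * (e * ln x))"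
  proof (intro sum.cong refl)
    fix i assume "i \<in> I"
    then have "ln (w i * x) = ln (w i) + ln x" using I(2) x by (intro ln_mult_pos) auto
    then show "w i * (ln (s i) + (K i - e * ln (w i * x)))
        = w i * (ln (s i) - e * ln (w i) + K i) - w i * (e * ln x)"
      by (simp add: algebra_simps)
  qed
  also have "\<dots> = (\<Sum>i\<in>I. w i * (ln (s i) - e * ln (w i) + K i)) - e * ln x"
    by (simp add: sum_subtractf I(3) flip: sum_distrib_right)
  also have "\<dots> \<le> L - e * ln x" using K by simp
  finally show ?thesis unfolding quantizable_def using \<beta> \<epsilon>(1) card by blast
qed

text \<open>Here \<open>J\<close> collects the pieces that are copies of \<open>P\<close> itself. When all pieces are, the
  constant has to reproduce itself, which is the balance condition on the weights and ratios.
  When some piece is a measure already known to be quantizable, the copies carry total weight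
  below 1, and every large enough constant is reproduced.\<close>

lemma quantizable_self:
  assumes mix: "mixture I w F Q P" and sim: "\<And>i. i \<in> I \<Longrightarrow> similitude (s i) (F i)"
    and w1: "\<And>i. i \<in> I \<Longrightarrow> w i < 1" and e: "0 \<le> e"
    and J: "J \<subseteq> I" "\<And>i. i \<in> J \<Longrightarrow> Q i = P"
    and Q: "\<And>i. i \<in> I - J \<Longrightarrow> \<exists>A K. \<forall>x\<ge>1. quantizable (Q i) A K e x"
    and bal: "J = I \<Longrightarrow> (\<Sum>i\<in>I. w i * (ln (s i) - e * ln (w i))) \<le> 0"
  shows "\<exists>A K. 0 < A \<and> (\<forall>x\<ge>1. quantizable P A K e x)"
proof -
  have I: "finite I" "\<And>i. i \<in> I \<Longrightarrow> 0 < w i" "sum w I = 1" and P: "compactly_carried P"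
    using mix unfolding mixture_def by auto
  have "I \<noteq> {}" using I(3) by auto
  define \<theta> where "\<theta> = Min (w ` I)"
  have \<theta>: "0 < \<theta>" "\<And>i. i \<in> I \<Longrightarrow> \<theta> \<le> w i"
    unfolding \<theta>_def using I \<open>I \<noteq> {}\<close> by (auto simp: Min_gr_iff intro: Min_le)
  have "\<forall>i\<in>I-J. \<exists>A K. \<forall>x\<ge>\<theta>. quantizable (Q i) A K e x"
    using Q quantizable_rescale[OF _ \<theta>(1)] by blast
  then obtain A' K' where q: "\<And>i x. i \<in> I - J \<Longrightarrow> \<theta> \<le> x \<Longrightarrow> quantizable (Q i) (A' i) (K' i) e x"
    by metis
  define A where "A = 1 / \<theta> + (\<Sum>i\<in>I-J. \<bar>A' i\<bar>)"
  have A: "1 / \<theta> \<le> A" "\<And>i. i \<in> I - J \<Longrightarrow> A' i \<le> A"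
  proof -
    have n: "0 \<le> (\<Sum>i\<in>I-J. \<bar>A' i\<bar>)" by (intro sum_nonneg) auto
    then show "1 / \<theta> \<le> A" by (simp add: A_def)
    fix i assume "i \<in> I - J"
    then have "\<bar>A' i\<bar> \<le> (\<Sum>i\<in>I-J. \<bar>A' i\<bar>)" using I(1) by (intro member_le_sum) auto
    then show "A' i \<le> A" using \<theta>(1) by (simp add: A_def add_increasing)
  qed
  define B where "B = (\<integral>y. ln (max 1 (dist_to_set d y {0})) \<partial>P)"
  define c where "c = (\<Sum>i\<in>I. w i * (ln (s i) - e * ln (w i))) + (\<Sum>i\<in>I-J. w i * K' i)"
  define v where "v = (\<Sum>i\<in>I-J. w i)"
  define K where "K = max B (if J = I then B else c / v)"
  \<comment> \<open>The pieces outside \<open>J\<close> have mass \<open>v\<close>. If \<open>v\<close> is 0, then \<open>c\<close> is the balance.\<close>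
  have cK: "c \<le> v * K"
  proof (cases "J = I")
    case True
    then show ?thesis using bal by (simp add: c_def v_def)
  next
    case False
    then have "0 < v" unfolding v_def using J(1) I(1,2) by (intro sum_pos) auto
    moreover have "c / v \<le> K" using False by (simp add: K_def)
    ultimately show ?thesis by (simp add: field_simps)
  qed
  have "quantizable P A K e x" if "\<theta> \<le> x" for x
  proof (rule scaling_induct[where \<Phi> = "quantizable P A K e" and I = I and w = w and \<theta> = \<theta>])
    fix x assume x: "\<theta> \<le> x" "x \<le> 1"
    have "1 \<le> 1 / \<theta> * x" using x \<theta>(1) by simp
    also have "\<dots> \<le> A * x" using A x \<theta>(1) by (intro mult_right_mono) auto
    finally have "1 \<le> A * x" .
    moreover have "e * ln x \<le> 0" using x \<theta>(1) e by (intro mult_nonneg_nonpos) auto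
    then have "B \<le> K - e * ln x" by (auto simp: K_def max_def)
    ultimately show "quantizable P A K e x"
      unfolding quantizable_def B_def by (intro exI[of _ "{0}"] exI[of _ 1]) auto
  next
    fix x assume x: "1 < x" and IH: "\<And>i. i \<in> I \<Longrightarrow> quantizable P A K e (w i * x)"
    show "quantizable P A K e x"
    proof (rule quantizable_mixture[OF mix sim, where K = "\<lambda>i. if i \<in> J then K else K' i"])
      fix i assume i: "i \<in> I"
      show "quantizable (Q i) A (if i \<in> J then K else K' i) e (w i * x)"
      proof (cases "i \<in> J")
        case False
        have "\<theta> * 1 \<le> w i * x" using x \<theta>(2)[OF i] \<theta>(1) by (intro mult_mono) auto
        then have "quantizable (Q i) (A' i) (K' i) e (w i * x)" using False i by (intro q) auto
        then show ?thesis using A(2) False i I(2)[OF i] x by (auto intro: quantizable_mono)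
      qed (use IH[OF i] J(2) in simp)
    next
      have "(\<Sum>i\<in>I. w i * (if i \<in> J then K else K' i)) = (\<Sum>i\<in>J. w i * K) + (\<Sum>i\<in>I-J. w i * K' i)"
        using J(1) I(1) by (subst sum.subset_diff[of J]) (auto intro!: arg_cong2[where f = "(+)"] sum.cong)
      moreover have "sum w J = 1 - v" using sum.subset_diff[OF J(1) I(1), of w] I(3) by (simp add: v_def)
      then have "(\<Sum>i\<in>J. w i * K) = K - v * K"
        by (simp add: left_diff_distrib flip: sum_distrib_right)
      ultimately have "(\<Sum>i\<in>I. w i * (ln (s i) - e * ln (w i) + (if i \<in> J then K else K' i))) = c + (K - v * K)"
        by (simp add: distrib_left sum.distrib c_def)
      then show "(\<Sum>i\<in>I. w i * (ln (s i) - e * ln (w i) + (if i \<in> J then K else K' i))) \<le> K"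
        using cK by simp
    qed (use x in auto)
  qed (use I \<theta> w1 that in auto)
  moreover have "\<theta> \<le> 1"
    using \<theta>(2) w1 \<open>I \<noteq> {}\<close> by (meson all_not_in_conv less_imp_le order_trans)
  moreover have "0 < 1 / \<theta>" using \<theta>(1) by simp
  then have "0 < A" using A(1) by linarith
  ultimately show ?thesis by (meson order_trans)
qed

end

section \<open>From the open set condition to the strong open set condition\<close>

primrec word_map :: "(nat \<Rightarrow> 'a \<Rightarrow> 'a) \<Rightarrow> nat list \<Rightarrow> 'a \<Rightarrow> 'a" where
  "word_map h [] = id"
| "word_map h (i # w) = h i \<circ> word_map h w"

lemma word_map_append: "word_map h (u @ v) = word_map h u \<circ> word_map h v"
  by (induction u) (auto simp: o_assoc)

definition word_ratio :: "(nat \<Rightarrow> real) \<Rightarrow> nat list \<Rightarrow> real" where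
  "word_ratio r w = prod_list (map r w)"

lemma word_ratio_simps [simp]:
  "word_ratio r [] = 1" "word_ratio r (i # w) = r i * word_ratio r w"
  "word_ratio r (u @ v) = word_ratio r u * word_ratio r v"
  by (simp_all add: word_ratio_def)

lemma word_map_image_subset:
  "w \<in> lists I \<Longrightarrow> (\<And>i. i \<in> I \<Longrightarrow> h i ` A \<subseteq> A) \<Longrightarrow> word_map h w ` A \<subseteq> A"
  by (induction w rule: lists.induct) (auto simp: image_subset_iff)

locale iterated_function_system = norm_metric d for d :: "'a::euclidean_space \<Rightarrow> 'a \<Rightarrow> real" +
  fixes m :: nat and h :: "nat \<Rightarrow> 'a \<Rightarrow> 'a" and r :: "nat \<Rightarrow> real" and C :: "'a set"
  assumes m: "2 \<le> m"
    and similitude: "\<And>i. i \<in> {1..m} \<Longrightarrow> similitude (r i) (h i)"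
    and ratio_less_1: "\<And>i. i \<in> {1..m} \<Longrightarrow> r i < 1"
    and C: "compact C" "C \<noteq> {}"
    and C_eq: "C = (\<Union>i\<in>{1..m}. h i ` C)"
begin

lemma ratio_pos: "i \<in> {1..m} \<Longrightarrow> 0 < r i"
  using similitude by (simp add: similitude_def)

lemma word_similitude:
  "w \<in> lists {1..m} \<Longrightarrow> similitude (word_ratio r w) (word_map h w)"
proof (induction w)
  case (Cons i w)
  then show ?case using similitude_comp[OF similitude[of i], of "word_ratio r w" "word_map h w"]
    by (simp add: comp_def)
qed (use similitude_id in simp)

lemma word_ratio_pos: "w \<in> lists {1..m} \<Longrightarrow> 0 < word_ratio r w"
  using word_similitude by (simp add: similitude_def)

lemma word_ratio_le_1: "w \<in> lists {1..m} \<Longrightarrow> word_ratio r w \<le> 1"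
proof (induction w)
  case (Cons i w)
  then have "r i * word_ratio r w \<le> 1 * 1"
    using ratio_less_1[of i] word_ratio_pos[of w] by (intro mult_mono) auto
  then show ?case by simp
qed simp

lemma word_ratio_less_1:
  assumes "w \<in> lists {1..m}" "w \<noteq> []"
  shows "word_ratio r w < 1"
proof -
  obtain i v where w: "w = i # v" using assms(2) list.exhaust by blast
  then have iv: "i \<in> {1..m}" "v \<in> lists {1..m}" using assms(1) by auto
  have "r i * word_ratio r v \<le> r i * 1"
    using word_ratio_le_1[OF iv(2)] ratio_pos[OF iv(1)] by (intro mult_left_mono) auto
  then show ?thesis using ratio_less_1[OF iv(1)] w by simp
qed

lemma d_word_map:
  "w \<in> lists {1..m} \<Longrightarrow> d (word_map h w x) (word_map h w y) = word_ratio r w * d x y"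
  using word_similitude by (simp add: similitude_def)

lemma word_map_bij: "w \<in> lists {1..m} \<Longrightarrow> bij (word_map h w)"
  using word_similitude similitude_bij by blast

lemma word_map_C: "w \<in> lists {1..m} \<Longrightarrow> word_map h w ` C \<subseteq> C"
  by (rule word_map_image_subset) (use C_eq in auto)

text \<open>Incomparable words split at some letter after a common prefix, and there disjointness of the
  first-level images applies.\<close>

lemma parallel_word_images_disjoint:
  assumes v: "v \<in> lists {1..m}" and w: "w \<in> lists {1..m}" and par: "v \<parallel> w"
    and U: "\<And>i. i \<in> {1..m} \<Longrightarrow> h i ` U \<subseteq> U" "disjoint_family_on (\<lambda>i. h i ` U) {1..m}"
  shows "word_map h v ` U \<inter> word_map h w ` U = {}"
proof -
  obtain p b bs c cs where bc: "b \<noteq> c" and vw: "v = p @ b # bs" "w = p @ c # cs"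
    using parallel_decomp[OF par] by blast
  have in_m: "p \<in> lists {1..m}" "b \<in> {1..m}" "c \<in> {1..m}" "bs \<in> lists {1..m}" "cs \<in> lists {1..m}"
    using v w vw by auto
  have "word_map h bs ` U \<subseteq> U" "word_map h cs ` U \<subseteq> U"
    using word_map_image_subset in_m U(1) by blast+
  then have "word_map h v ` U \<subseteq> word_map h p ` (h b ` U)" "word_map h w ` U \<subseteq> word_map h p ` (h c ` U)"
    by (auto simp: vw word_map_append)
  moreover have "h b ` U \<inter> h c ` U = {}"
    using U(2) in_m bc by (auto simp: disjoint_family_on_def)
  then have "word_map h p ` (h b ` U) \<inter> word_map h p ` (h c ` U) = {}"
    using word_map_bij[OF in_m(1)] by (metis bij_is_inj image_Int image_empty)
  ultimately show ?thesis by blast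
qed

definition min_ratio :: real where
  "min_ratio = Min (r ` {1..m})"

lemma min_ratio: "0 < min_ratio" "i \<in> {1..m} \<Longrightarrow> min_ratio \<le> r i" "min_ratio < 1"
proof -
  have ne: "r ` {1..m} \<noteq> {}" using m by auto
  show "0 < min_ratio" using ratio_pos ne by (auto simp: min_ratio_def)
  show *: "min_ratio \<le> r i" if "i \<in> {1..m}" for i using that by (simp add: min_ratio_def)
  show "min_ratio < 1" using *[of 1] ratio_less_1[of 1] m by simp
qed

text \<open>Cutting a word where its ratio first falls to \<open>q\<close> or below overshoots by at most one
  letter.\<close>

lemma word_prefix_of_ratio:
  assumes "u \<in> lists {1..m}" "word_ratio r u \<le> q" "0 < q" "q \<le> 1"
  shows "\<exists>v. prefix v u \<and> word_ratio r v \<le> q \<and> min_ratio * q \<le> word_ratio r v"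
  using assms(1,2)
proof (induction u rule: rev_induct)
  case Nil
  have "min_ratio * q \<le> 1 * 1" using min_ratio assms by (intro mult_mono) auto
  then show ?case using Nil by auto
next
  case (snoc i u)
  show ?case
  proof (cases "word_ratio r u \<le> q")
    case True
    then show ?thesis using snoc by (auto intro: prefix_prefix)
  next
    case False
    have "min_ratio * q \<le> r i * word_ratio r u"
      using False snoc.prems(1) min_ratio(1) min_ratio(2)[of i] assms(3) by (intro mult_mono) auto
    then show ?thesis using snoc.prems(2) by (intro exI[of _ "u @ [i]"]) (simp add: mult.commute)
  qed
qed

text \<open>Cylinders of pairwise incomparable words whose size is comparable to that of the cylinder of
  \<open>w\<close> and which come close to it, relative to its size. Schief's idea is to choose \<open>w\<close> and \<open>T\<close>
  with as many such neighbours as possible.\<close>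

definition close_words :: "nat list \<Rightarrow> nat list set \<Rightarrow> bool" where
  "close_words w T \<longleftrightarrow> w \<in> lists {1..m} \<and> T \<subseteq> lists {1..m} \<and> finite T \<and>
     (\<forall>u\<in>T. \<forall>v\<in>T. u \<noteq> v \<longrightarrow> u \<parallel> v) \<and>
     (\<forall>v\<in>T. min_ratio * word_ratio r w \<le> word_ratio r v \<and> word_ratio r v \<le> word_ratio r w \<and>
        (\<exists>x\<in>word_map h v ` C. \<exists>y\<in>word_map h w ` C. d x y < 2 * word_ratio r w))"

text \<open>Pulling the neighbours back by \<open>w\<close> brings them to unit scale. Each contains the
  image of a fixed ball inside the set of the open set condition; these images are disjoint and
  not too small, so their centres are separated points of a fixed ball.\<close>

lemma close_words_bounded:
  assumes "open_set_condition m h"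
  shows "\<exists>\<gamma>::nat. \<forall>w T. close_words w T \<longrightarrow> card T \<le> \<gamma>"
proof -
  obtain U where U: "U \<noteq> {}" "open U" "disjoint_family_on (\<lambda>i. h i ` U) {1..m}"
      "\<And>i. i \<in> {1..m} \<Longrightarrow> h i ` U \<subseteq> U"
    using assms unfolding open_set_condition_def by blast
  obtain u where u: "u \<in> U" using U(1) by blast
  obtain e where e: "e > 0" "{y. d u y < e} \<subseteq> U" using open_contains_d_ball[OF U(2) u] by blast
  obtain D where D: "D > 0" "\<And>c. c \<in> C \<Longrightarrow> d u c \<le> D" using compact_d_bounded[OF C(1)] by blast
  obtain \<gamma> where \<gamma>: "\<And>A. A \<subseteq> {y. d u y \<le> 2 * D + 2} \<Longrightarrow>
      (\<forall>x\<in>A. \<forall>y\<in>A. x \<noteq> y \<longrightarrow> min_ratio * e \<le> d x y) \<Longrightarrow> card A \<le> \<gamma>"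
    using packing_bound[OF compact_d_cball, of "min_ratio * e"] min_ratio(1) e(1) by (metis mult_pos_pos)
  have "card T \<le> \<gamma>" if T: "close_words w T" for w T
  proof -
    let ?R = "word_ratio r" and ?f = "word_map h"
    have w: "w \<in> lists {1..m}" and W: "\<And>v. v \<in> T \<Longrightarrow> v \<in> lists {1..m}"
      and par: "\<And>u v. u \<in> T \<Longrightarrow> v \<in> T \<Longrightarrow> u \<noteq> v \<Longrightarrow> u \<parallel> v"
      and R: "\<And>v. v \<in> T \<Longrightarrow> min_ratio * ?R w \<le> ?R v" "\<And>v. v \<in> T \<Longrightarrow> ?R v \<le> ?R w"
      and close: "\<And>v. v \<in> T \<Longrightarrow> \<exists>x\<in>C. \<exists>y\<in>C. d (?f v x) (?f w y) < 2 * ?R w"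
      using T unfolding close_words_def by auto
    have Rw: "0 < ?R w" using word_ratio_pos[OF w] .
    define z where "z v = inv (?f w) (?f v u)" for v
    have fz: "?f w (z v) = ?f v u" for v
      unfolding z_def using word_map_bij[OF w] by (simp add: bij_is_surj surj_f_inv_f)
    have dz: "?R w * d x (z v) = d (?f w x) (?f v u)" for x v
      using d_word_map[OF w, of x "z v"] fz by simp
    have sep: "min_ratio * e \<le> d (z v) (z v')" if v: "v \<in> T" "v' \<in> T" "v \<noteq> v'" for v v'
    proof -
      have "?f v ` U \<inter> ?f v' ` U = {}"
        using parallel_word_images_disjoint[OF W W par] v U by blast
      then have "?f v' u \<notin> ?f v ` U" using u by blast
      then have "?f v' u \<notin> ?f v ` {y. d u y < e}" using e(2) by blast
      then have "?R v * e \<le> d (?f v u) (?f v' u)"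
        unfolding similitude_image_d_ball[OF word_similitude[OF W[OF v(1)]]] by simp
      moreover have "min_ratio * ?R w * e \<le> ?R v * e"
        using R(1)[OF v(1)] e(1) by (intro mult_right_mono) auto
      ultimately have "?R w * (min_ratio * e) \<le> ?R w * d (z v) (z v')"
        using dz[of "z v" v'] fz[of v] by (simp add: mult_ac)
      then show ?thesis using Rw by simp
    qed
    have "z ` T \<subseteq> {y. d u y \<le> 2 * D + 2}"
    proof clarify
      fix v assume v: "v \<in> T"
      obtain x y where xy: "x \<in> C" "y \<in> C" "d (?f v x) (?f w y) < 2 * ?R w" using close[OF v] by blast
      have "d (?f w u) (?f v u) \<le> d (?f w u) (?f w y) + (d (?f w y) (?f v x) + d (?f v x) (?f v u))"
        by (meson add_left_mono d_triangle order_trans)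
      also have "d (?f w u) (?f w y) \<le> ?R w * D"
        using d_word_map[OF w] D(2)[OF xy(2)] Rw by simp
      also have "d (?f v x) (?f v u) \<le> ?R w * D"
        using d_word_map[OF W[OF v]] D(2)[OF xy(1)] R(2)[OF v] Rw d_commute[of u x] d_nonneg[of x u]
        by (simp add: mult_mono)
      also have "d (?f w y) (?f v x) \<le> 2 * ?R w" using xy(3) d_commute[of "?f w y"] by simp
      finally have "?R w * d u (z v) \<le> ?R w * (2 * D + 2)" by (simp add: dz algebra_simps)
      then show "d u (z v) \<le> 2 * D + 2" using Rw by simp
    qed
    moreover have "\<forall>x\<in>z`T. \<forall>y\<in>z`T. x \<noteq> y \<longrightarrow> min_ratio * e \<le> d x y" using sep by auto
    ultimately have "card (z ` T) \<le> \<gamma>" by (rule \<gamma>)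
    moreover have "inj_on z T"
    proof (rule inj_onI, rule ccontr)
      fix v v' assume "v \<in> T" "v' \<in> T" "z v = z v'" "v \<noteq> v'"
      then have "min_ratio * e \<le> 0" using sep[of v v'] by simp
      then show False using mult_pos_pos[OF min_ratio(1) e(1)] by simp
    qed
    ultimately show ?thesis by (simp add: card_image)
  qed
  then show ?thesis by blast
qed

text \<open>For a pair \<open>(w, T)\<close> with the maximal number of neighbours, prefixing all words by \<open>b\<close>
  gives a pair with equally many neighbours. By maximality \<open>b @ w\<close> has no further ones, so
  no cylinder of comparable size whose word is incomparable with \<open>b\<close> comes close to that of
  \<open>b @ w\<close>. The smaller copy \<open>a @ w\<close> lies in such a cylinder: cut its word at that size.\<close>

lemma separated_copies:
  assumes "open_set_condition m h"
  shows "\<exists>w\<in>lists {1..m}. \<forall>a\<in>lists {1..m}. \<forall>b\<in>lists {1..m}. a \<parallel> b \<longrightarrow> word_ratio r a \<le> word_ratio r b \<longrightarrow>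
     (\<forall>x\<in>word_map h (a @ w) ` C. \<forall>y\<in>word_map h (b @ w) ` C. 2 * word_ratio r (b @ w) \<le> d x y)"
proof -
  let ?R = "word_ratio r" and ?f = "word_map h"
  obtain \<gamma> where \<gamma>: "\<And>w T. close_words w T \<Longrightarrow> card T \<le> \<gamma>"
    using close_words_bounded[OF assms] by blast
  have "close_words [] {}" by (simp add: close_words_def)
  then obtain w T where wT: "close_words w T" "\<And>w' T'. close_words w' T' \<Longrightarrow> card T' \<le> card T"
    using ex_has_greatest_nat[of "\<lambda>(w, T). close_words w T" "([], {})" "\<lambda>(w, T). card T" "Suc \<gamma>"] \<gamma> by (auto simp: less_Suc_eq_le)
  have w: "w \<in> lists {1..m}" and W: "\<And>v. v \<in> T \<Longrightarrow> v \<in> lists {1..m}" and fin: "finite T"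
    and par: "\<And>u v. u \<in> T \<Longrightarrow> v \<in> T \<Longrightarrow> u \<noteq> v \<Longrightarrow> u \<parallel> v"
    and R: "\<And>v. v \<in> T \<Longrightarrow> min_ratio * ?R w \<le> ?R v" "\<And>v. v \<in> T \<Longrightarrow> ?R v \<le> ?R w"
    and close: "\<And>v. v \<in> T \<Longrightarrow> \<exists>x\<in>C. \<exists>y\<in>C. d (?f v x) (?f w y) < 2 * ?R w"
    using wT(1) unfolding close_words_def by auto
  have far: "2 * ?R (b @ w) \<le> d x y"
    if b: "b \<in> lists {1..m}" and v: "v \<in> lists {1..m}" "v \<parallel> b"
      and Rv: "min_ratio * ?R (b @ w) \<le> ?R v" "?R v \<le> ?R (b @ w)"
      and x: "x \<in> ?f v ` C" and y: "y \<in> ?f (b @ w) ` C" for b v x y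
  proof (rule ccontr)
    assume near: "\<not> 2 * ?R (b @ w) \<le> d x y"
    have Rb: "0 < ?R b" using word_ratio_pos[OF b] .
    have vb: "v \<parallel> b @ u" for u using parallel_append[OF v(2), of "[]" u] by simp
    \<comment> \<open>Otherwise \<open>v\<close> could be added to the \<open>b\<close>-prefixed neighbours, beyond the maximal number.\<close>
    have "close_words (b @ w) (insert v ((@) b ` T))"
      unfolding close_words_def
    proof (intro conjI ballI impI)
      fix u assume u: "u \<in> insert v ((@) b ` T)"
      show "min_ratio * ?R (b @ w) \<le> ?R u" "?R u \<le> ?R (b @ w)"
        using u Rv R Rb by (auto simp: mult.left_commute)
      show "\<exists>x\<in>?f u ` C. \<exists>y\<in>?f (b @ w) ` C. d x y < 2 * ?R (b @ w)"
      proof (cases "u = v")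
        case True
        then show ?thesis using near x y by (meson not_le)
      next
        case False
        then obtain t where t: "t \<in> T" "u = b @ t" using u by blast
        obtain p q where pq: "p \<in> C" "q \<in> C" "d (?f t p) (?f w q) < 2 * ?R w" using close[OF t(1)] by blast
        have "d (?f u p) (?f (b @ w) q) < 2 * ?R (b @ w)"
          using pq(3) Rb by (simp add: t(2) word_map_append d_word_map[OF b])
        then show ?thesis using pq by blast
      qed
      fix u' assume u': "u' \<in> insert v ((@) b ` T)" "u \<noteq> u'"
      show "u \<parallel> u'"
      proof (cases "u = v \<or> u' = v")
        case True
        then show ?thesis using u u' vb parallel_commute by blast
      next
        case False
        then obtain t t' where "t \<in> T" "u = b @ t" "t' \<in> T" "u' = b @ t'" using u u' by blast
        then show ?thesis using par[of t t'] u'(2) by (simp add: parallel_def)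
      qed
    next
      show "insert v ((@) b ` T) \<subseteq> lists {1..m}"
        using v(1) W b by (simp add: image_subset_iff)
    qed (use w b fin in simp_all)
    then have "card (insert v ((@) b ` T)) \<le> card T" by (rule wT(2))
    moreover have "v \<notin> (@) b ` T" using v(2) by (auto simp: parallel_def)
    moreover have "card ((@) b ` T) = card T" by (intro card_image) (simp add: inj_on_def)
    ultimately show False using fin by simp
  qed
  have "2 * ?R (b @ w) \<le> d x y"
    if a: "a \<in> lists {1..m}" and b: "b \<in> lists {1..m}" and ab: "a \<parallel> b" "?R a \<le> ?R b"
      and x: "x \<in> ?f (a @ w) ` C" and y: "y \<in> ?f (b @ w) ` C" for a b x y
  proof -
    have aw: "a @ w \<in> lists {1..m}" and bw: "b @ w \<in> lists {1..m}" using a b w by auto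
    have "?R (a @ w) \<le> ?R (b @ w)" using ab(2) word_ratio_pos[OF w] by simp
    then obtain v where v: "prefix v (a @ w)" "?R v \<le> ?R (b @ w)" "min_ratio * ?R (b @ w) \<le> ?R v"
      using word_prefix_of_ratio[OF aw _ word_ratio_pos[OF bw] word_ratio_le_1[OF bw]] by blast
    obtain z where z: "a @ w = v @ z" using v(1) prefixE by blast
    then have vz: "v \<in> lists {1..m}" "z \<in> lists {1..m}" using aw by auto
    \<comment> \<open>Cut off at the size of the larger copy, the word stays incomparable with \<open>b\<close>.\<close>
    have "\<not> prefix b v"
      using ab(1) v(1) prefix_same_cases[of a "a @ w" b] prefix_order.trans[of b v "a @ w"]
      by (auto simp: parallel_def)
    moreover have "\<not> prefix v b"
    proof
      assume "prefix v b"
      then obtain t where t: "b = v @ t" using prefixE by blast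
      then have "t \<in> lists {1..m}" "t \<noteq> []" using b \<open>\<not> prefix b v\<close> by auto
      then have "?R t < 1" "?R t * ?R w \<le> ?R t * 1"
        using word_ratio_less_1[of t] word_ratio_le_1[OF w] word_ratio_pos[of t]
        by (auto intro!: mult_left_mono simp: less_imp_le)
      then have "?R t * ?R w < 1" by linarith
      then have "?R v * (?R t * ?R w) < ?R v * 1" using word_ratio_pos[OF vz(1)] by (intro mult_strict_left_mono)
      then show False using v(2) t by (simp add: mult.assoc)
    qed
    ultimately have "v \<parallel> b" by (simp add: parallel_def)
    moreover have "x \<in> ?f v ` C"
      using x word_map_C[OF vz(2)] by (auto simp: z word_map_append)
    ultimately show ?thesis using far[OF b vz(1) _ v(3,2) _ y] by blast
  qed
  then show ?thesis using w by blast
qed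

text \<open>The unit neighbourhood of \<open>C\<close>, transported by all words \<open>a @ w\<close>, is the desired set: the
  neighbourhoods that belong to incomparable words are too far apart to overlap.\<close>

theorem strong_open_set_condition:
  assumes "open_set_condition m h"
  shows "\<exists>V. open V \<and> (\<forall>i\<in>{1..m}. h i ` V \<subseteq> V) \<and> disjoint_family_on (\<lambda>i. h i ` V) {1..m} \<and> V \<inter> C \<noteq> {}"
proof -
  let ?R = "word_ratio r" and ?f = "word_map h"
  from separated_copies[OF assms] obtain w where w: "w \<in> lists {1..m}"
    and sep_copies: "\<forall>a\<in>lists {1..m}. \<forall>b\<in>lists {1..m}. a \<parallel> b \<longrightarrow> ?R a \<le> ?R b \<longrightarrow>
     (\<forall>x\<in>?f (a @ w) ` C. \<forall>y\<in>?f (b @ w) ` C. 2 * ?R (b @ w) \<le> d x y)" ..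
  have sep: "2 * ?R (b @ w) \<le> d (?f (a @ w) x) (?f (b @ w) y)"
    if "a \<in> lists {1..m}" "b \<in> lists {1..m}" "a \<parallel> b" "?R a \<le> ?R b" "x \<in> C" "y \<in> C" for a b x y
    using sep_copies[rule_format, OF that(1-4) imageI[OF that(5)] imageI[OF that(6)]] .
  define B where "B = (\<Union>c\<in>C. {z. d c z < 1})"
  define V where "V = (\<Union>a\<in>lists {1..m}. ?f (a @ w) ` B)"
  have "open B" unfolding B_def by (intro open_UN ballI open_d_ball)
  then have "open V"
    unfolding V_def using w by (intro open_UN ballI similitude_open_image[OF word_similitude]) auto
  moreover have "h i ` V \<subseteq> V" if i: "i \<in> {1..m}" for i
  proof -
    have "h i (?f (a @ w) z) \<in> V" if "a \<in> lists {1..m}" "z \<in> B" for a z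
    proof -
      have "h i (?f (a @ w) z) = ?f ((i # a) @ w) z" by simp
      moreover have "i # a \<in> lists {1..m}" using i that by simp
      ultimately show ?thesis unfolding V_def using that(2) by blast
    qed
    moreover have "\<exists>a\<in>lists {1..m}. \<exists>z\<in>B. x = ?f (a @ w) z" if "x \<in> V" for x
      using that unfolding V_def by blast
    ultimately show ?thesis by blast
  qed
  moreover have "disjoint_family_on (\<lambda>i. h i ` V) {1..m}"
  proof -
    have ord: False
      if a: "i # a \<in> lists {1..m}" "j # b \<in> lists {1..m}" and ij: "i \<noteq> j"
        and le: "?R (i # a) \<le> ?R (j # b)" and z: "z \<in> B" "z' \<in> B"
        and eq: "?f ((i # a) @ w) z = ?f ((j # b) @ w) z'" for i a j b z z'
    proof -
      define a' b' where "a' = i # a" and "b' = j # b"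
      obtain c c' where c: "c \<in> C" "d c z < 1" "c' \<in> C" "d c' z' < 1" using z by (auto simp: B_def)
      have ab: "a' @ w \<in> lists {1..m}" "b' @ w \<in> lists {1..m}" using a w by (auto simp: a'_def b'_def)
      have "a' \<parallel> b'" using ij by (simp add: a'_def b'_def parallel_def)
      then have "2 * ?R (b' @ w) \<le> d (?f (a' @ w) c) (?f (b' @ w) c')"
        using a le c by (intro sep) (simp_all add: a'_def b'_def)
      also have "\<dots> \<le> d (?f (a' @ w) c) (?f (a' @ w) z) + d (?f (a' @ w) z) (?f (b' @ w) c')"
        by (rule d_triangle)
      also have "\<dots> = ?R (a' @ w) * d c z + ?R (b' @ w) * d c' z'"
      proof -
        have "?f (a' @ w) z = ?f (b' @ w) z'" using eq by (simp only: a'_def b'_def)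
        then have "d (?f (a' @ w) z) (?f (b' @ w) c') = ?R (b' @ w) * d z' c'"
          using d_word_map[OF ab(2)] by (simp only:)
        then show ?thesis using d_word_map[OF ab(1)] d_commute[of z' c'] by (simp only:)
      qed
      also have "\<dots> < ?R (a' @ w) * 1 + ?R (b' @ w) * 1"
        using c word_ratio_pos[OF ab(1)] word_ratio_pos[OF ab(2)]
        by (intro add_strict_mono mult_strict_left_mono)
      also have "\<dots> \<le> 2 * ?R (b' @ w)"
        using le word_ratio_pos[OF w] by (simp add: a'_def b'_def)
      finally show False by simp
    qed
    have "h i ` V \<inter> h j ` V = {}" if ij: "i \<in> {1..m}" "j \<in> {1..m}" "i \<noteq> j" for i j
    proof (rule ccontr)
      assume "h i ` V \<inter> h j ` V \<noteq> {}"
      then obtain a b z z' where a: "a \<in> lists {1..m}" "b \<in> lists {1..m}" and z: "z \<in> B" "z' \<in> B"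
        and "h i (?f (a @ w) z) = h j (?f (b @ w) z')"
        unfolding V_def by auto
      then have eq: "?f ((i # a) @ w) z = ?f ((j # b) @ w) z'" by simp
      have ia: "i # a \<in> lists {1..m}" and jb: "j # b \<in> lists {1..m}" using a ij by auto
      show False
      proof (cases "?R (i # a) \<le> ?R (j # b)")
        case True
        show False by (rule ord[OF ia jb ij(3) True z eq])
      next
        case False
        then have "?R (j # b) \<le> ?R (i # a)" by linarith
        from ord[OF jb ia ij(3)[symmetric] this z(2,1) eq[symmetric]] show False .
      qed
    qed
    then show ?thesis by (simp add: disjoint_family_on_def)
  qed
  moreover have "V \<inter> C \<noteq> {}"
  proof -
    obtain c where c: "c \<in> C" using C(2) by blast
    then have "c \<in> B" unfolding B_def by (intro UN_I[of c]) simp_all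
    then have "?f ([] @ w) c \<in> V" unfolding V_def by blast
    moreover have "?f ([] @ w) c \<in> C" using word_map_C[OF w] c by auto
    ultimately show ?thesis by blast
  qed
  ultimately show ?thesis by blast
qed

end

section \<open>Lower bounds for the error\<close>

text \<open>The cut at \<open>\<delta>\<close> keeps all integrals finite until the end, when \<open>\<delta>\<close> tends to 0. The cut at
  1 makes the function nonpositive when \<open>\<delta> \<le> 1\<close>, hence superadditive under minima; distances
  above 1 can be reduced to 1 in a lower bound.\<close>

definition truncated_ln :: "real \<Rightarrow> real \<Rightarrow> real" where
  "truncated_ln \<delta> x = ln (max \<delta> (min 1 x))"

lemma truncated_ln_mono: "0 < \<delta> \<Longrightarrow> x \<le> y \<Longrightarrow> truncated_ln \<delta> x \<le> truncated_ln \<delta> y"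
  unfolding truncated_ln_def by (intro ln_mono) auto

lemma truncated_ln_ge: "0 < \<delta> \<Longrightarrow> ln \<delta> \<le> truncated_ln \<delta> x"
  unfolding truncated_ln_def by (intro ln_mono) auto

lemma truncated_ln_ge_ln: "0 < y \<Longrightarrow> y \<le> x \<Longrightarrow> y \<le> 1 \<Longrightarrow> ln y \<le> truncated_ln \<delta> x"
  unfolding truncated_ln_def by (intro ln_mono) auto

lemma truncated_ln_nonpos: "0 < \<delta> \<Longrightarrow> \<delta> \<le> 1 \<Longrightarrow> truncated_ln \<delta> x \<le> 0"
  unfolding truncated_ln_def by (simp add: ln_le_zero_iff)

lemma truncated_ln_min:
  assumes "0 < \<delta>" "\<delta> \<le> 1"
  shows "truncated_ln \<delta> x + truncated_ln \<delta> y \<le> truncated_ln \<delta> (min x y)"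
  using truncated_ln_nonpos[OF assms, of x] truncated_ln_nonpos[OF assms, of y] by (auto simp: min_def)

lemma truncated_ln_scale:
  assumes "0 < \<delta>" "\<delta> \<le> 1" "0 < s" "s \<le> 1"
  shows "ln s + truncated_ln \<delta> x \<le> truncated_ln \<delta> (s * x)"
proof -
  have "s * \<delta> \<le> \<delta>" using assms by (simp add: mult_left_le_one_le)
  moreover have "s * min 1 x \<le> min 1 (s * x)" using assms by (simp add: min_mult_distrib_left)
  ultimately have "max (s * \<delta>) (s * min 1 x) \<le> max \<delta> (min 1 (s * x))" by (intro max.mono)
  then have "s * max \<delta> (min 1 x) \<le> max \<delta> (min 1 (s * x))" using assms by (simp add: max_mult_distrib_left)
  then have "ln (s * max \<delta> (min 1 x)) \<le> truncated_ln \<delta> (s * x)"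
    unfolding truncated_ln_def using assms by (intro ln_mono) auto
  moreover have "ln (s * max \<delta> (min 1 x)) = ln s + truncated_ln \<delta> x"
    unfolding truncated_ln_def using assms by (intro ln_mult_pos) auto
  ultimately show ?thesis by simp
qed

lemma continuous_on_truncated_ln [continuous_intros]:
  "0 < \<delta> \<Longrightarrow> continuous_on S g \<Longrightarrow> continuous_on S (\<lambda>x. truncated_ln \<delta> (g x))"
  unfolding truncated_ln_def by (intro continuous_intros) auto

text \<open>An a priori bound, however bad, turns the self-referential inequality
  \<open>inf \<Phi> \<ge> c + q inf \<Phi>\<close> into a bound that does not depend on it. With \<open>b = log \<delta>\<close> this is the
  source of all lower bounds that are uniform in \<open>\<delta>\<close>.\<close>

lemma bootstrap_lower_bound:
  fixes \<Phi> :: "'b \<Rightarrow> real"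
  assumes "\<beta> \<in> F" "q < 1" and below: "\<And>\<beta>. \<beta> \<in> F \<Longrightarrow> b \<le> \<Phi> \<beta>"
    and step: "\<And>l \<beta>. (\<And>\<gamma>. \<gamma> \<in> F \<Longrightarrow> l \<le> \<Phi> \<gamma>) \<Longrightarrow> \<beta> \<in> F \<Longrightarrow> c + q * l \<le> \<Phi> \<beta>"
  shows "c / (1 - q) \<le> \<Phi> \<beta>"
proof -
  define l where "l = (INF \<beta>\<in>F. \<Phi> \<beta>)"
  have l: "l \<le> \<Phi> \<gamma>" if "\<gamma> \<in> F" for \<gamma>
    unfolding l_def using that below by (intro cINF_lower bdd_belowI2)
  have "c + q * l \<le> (INF \<beta>\<in>F. \<Phi> \<beta>)" using assms(1) step[OF l] by (intro cINF_greatest) auto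
  then have "c / (1 - q) \<le> l" using assms(2) by (simp add: l_def[symmetric] field_simps)
  then show ?thesis using l[OF assms(1)] by linarith
qed

context norm_metric
begin

definition log_error :: "real \<Rightarrow> 'a measure \<Rightarrow> 'a set \<Rightarrow> real" where
  "log_error \<delta> P \<beta> = (\<integral>y. truncated_ln \<delta> (dist_to_set d y \<beta>) \<partial>P)"

lemma log_error_antimono:
  assumes "compactly_carried P" "0 < \<delta>" "\<beta> \<noteq> {}" "\<beta> \<subseteq> \<gamma>"
  shows "log_error \<delta> P \<gamma> \<le> log_error \<delta> P \<beta>"
  unfolding log_error_def using assms
  by (intro integral_mono_compactly_carried continuous_intros truncated_ln_mono dist_to_set_mono) auto

lemma log_error_ge:
  assumes "compactly_carried P" "0 < \<delta>" "\<beta> \<noteq> {}"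
  shows "ln \<delta> \<le> log_error \<delta> P \<beta>"
  unfolding log_error_def using assms
  by (intro integral_compactly_carried_ge continuous_intros) (auto simp: truncated_ln_ge)

lemma log_error_nonpos:
  assumes "compactly_carried P" "0 < \<delta>" "\<delta> \<le> 1" "\<beta> \<noteq> {}"
  shows "log_error \<delta> P \<beta> \<le> 0"
  unfolding log_error_def using assms
  by (intro integral_compactly_carried_le continuous_intros) (auto simp: truncated_ln_nonpos)

text \<open>The distance to a union is a minimum of distances, and the truncated logarithm of a minimum
  is at least the sum. The resulting bound is linear in the number of points, far from the
  logarithmic truth, but a linear charge is what adds up over the pieces of a self-similar
  measure.\<close>

lemma log_error_insert:
  assumes P: "compactly_carried P" and \<delta>: "0 < \<delta>" "\<delta> \<le> 1" and \<beta>: "\<beta> \<noteq> {}"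
  shows "log_error \<delta> P {a} + log_error \<delta> P \<beta> \<le> log_error \<delta> P (insert a \<beta>)"
proof -
  have c: "continuous_on UNIV (\<lambda>y. truncated_ln \<delta> (dist_to_set d y {a}))"
       "continuous_on UNIV (\<lambda>y. truncated_ln \<delta> (dist_to_set d y \<beta>))"
       "continuous_on UNIV (\<lambda>y. truncated_ln \<delta> (dist_to_set d y (insert a \<beta>)))"
    using \<delta> \<beta> by (auto intro!: continuous_intros simp del: dist_to_set_singleton)
  have "log_error \<delta> P {a} + log_error \<delta> P \<beta>
      = (\<integral>y. truncated_ln \<delta> (dist_to_set d y {a}) + truncated_ln \<delta> (dist_to_set d y \<beta>) \<partial>P)"
    unfolding log_error_def
    using c by (intro Bochner_Integration.integral_add[symmetric] integrable_compactly_carried[OF P])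
  also have "\<dots> \<le> log_error \<delta> P (insert a \<beta>)"
    unfolding log_error_def
    using c truncated_ln_min[OF \<delta>] dist_to_set_insert[OF \<beta>]
    by (intro integral_mono_compactly_carried[OF P] continuous_on_add) auto
  finally show ?thesis .
qed

text \<open>The distance of \<open>F\<^sub>i y\<close> to \<open>\<beta>\<close> is \<open>s\<^sub>i\<close> times that of \<open>y\<close> to the preimage of \<open>\<beta>\<close>. The
  truncation only helps, as \<open>s\<^sub>i \<delta> \<le> \<delta>\<close>.\<close>

lemma log_error_mixture:
  assumes mix: "mixture I w F Q P" and sim: "\<And>i. i \<in> I \<Longrightarrow> similitude (s i) (F i)"
    and s: "\<And>i. i \<in> I \<Longrightarrow> s i \<le> 1" and \<delta>: "0 < \<delta>" "\<delta> \<le> 1" and \<beta>: "\<beta> \<noteq> {}"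
  shows "(\<Sum>i\<in>I. w i * (ln (s i) + log_error \<delta> (Q i) (F i -` \<beta>))) \<le> log_error \<delta> P \<beta>"
proof -
  have I: "\<And>i. i \<in> I \<Longrightarrow> 0 < w i" and Q: "\<And>i. i \<in> I \<Longrightarrow> compactly_carried (Q i)"
    and F: "\<And>i. i \<in> I \<Longrightarrow> continuous_on UNIV (F i)"
    using mix unfolding mixture_def by auto
  have "(\<Sum>i\<in>I. w i * (ln (s i) + log_error \<delta> (Q i) (F i -` \<beta>)))
      \<le> (\<Sum>i\<in>I. w i * (\<integral>y. truncated_ln \<delta> (dist_to_set d (F i y) \<beta>) \<partial>Q i))"
  proof (intro sum_mono mult_left_mono)
    fix i assume i: "i \<in> I"
    have ne: "F i -` \<beta> \<noteq> {}" by (rule similitude_vimage_nonempty[OF sim[OF i] \<beta>])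
    have "ln (s i) + log_error \<delta> (Q i) (F i -` \<beta>)
        = (\<integral>y. ln (s i) + truncated_ln \<delta> (dist_to_set d y (F i -` \<beta>)) \<partial>Q i)"
      unfolding log_error_def
      by (intro integral_const_add[symmetric] Q i continuous_intros ne \<delta>)
    also have "\<dots> \<le> (\<integral>y. truncated_ln \<delta> (dist_to_set d (F i y) \<beta>) \<partial>Q i)"
    proof (intro integral_mono_compactly_carried Q i continuous_intros ne \<delta> \<beta> F)
      fix y
      show "ln (s i) + truncated_ln \<delta> (dist_to_set d y (F i -` \<beta>)) \<le> truncated_ln \<delta> (dist_to_set d (F i y) \<beta>)"
        using truncated_ln_scale[OF \<delta> _ s[OF i]] sim[OF i] dist_to_set_vimage[OF sim[OF i] \<beta>]
        by (simp add: similitude_def)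
    qed
    finally show "ln (s i) + log_error \<delta> (Q i) (F i -` \<beta>) \<le> (\<integral>y. truncated_ln \<delta> (dist_to_set d (F i y) \<beta>) \<partial>Q i)" .
  qed (use I in \<open>simp add: less_imp_le\<close>)
  also have "\<dots> = log_error \<delta> P \<beta>"
    unfolding log_error_def
    by (intro integral_mixture[OF mix, symmetric] continuous_intros \<delta> \<beta>)
  finally show ?thesis .
qed

end

locale self_similar_ifs = iterated_function_system d m h r C
  for d :: "'a::euclidean_space \<Rightarrow> 'a \<Rightarrow> real" and m h r C +
  fixes t :: "nat \<Rightarrow> real" and P :: "'a measure"
  assumes mix: "mixture {1..m} t h (\<lambda>_. P) P" and carrier: "measure P C = 1"
begin

lemma compactly_carried_P: "compactly_carried P" and t_pos: "i \<in> {1..m} \<Longrightarrow> 0 < t i" and t_sum: "sum t {1..m} = 1"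
  using mix by (auto simp: mixture_def)

lemma t_less_1: "i \<in> {1..m} \<Longrightarrow> t i < 1"
  using weight_less_1[of "{1..m}" t i "if i = 1 then 2 else 1"] t_pos t_sum m by auto

definition mean_ln_ratio :: real where
  "mean_ln_ratio = (\<Sum>i=1..m. t i * ln (r i))"

lemma mean_ln_ratio_neg: "mean_ln_ratio < 0"
proof -
  have "mean_ln_ratio < (\<Sum>i=1..m. 0)"
    unfolding mean_ln_ratio_def using m t_pos ratio_pos ratio_less_1
    by (intro sum_strict_mono) (auto intro!: mult_pos_neg)
  then show ?thesis by simp
qed

lemma small_cylinder:
  assumes "x \<in> C" "0 < \<epsilon>"
  shows "\<exists>w\<in>lists {1..m}. \<forall>y\<in>C. d (word_map h w y) x < \<epsilon>"
proof -
  define \<rho> where "\<rho> = Max (r ` {1..m})"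
  have "\<rho> \<in> r ` {1..m}" unfolding \<rho>_def using m by (intro Max_in) auto
  then have \<rho>: "0 < \<rho>" "\<rho> < 1" using ratio_pos ratio_less_1 by auto
  have \<rho>_ge: "r i \<le> \<rho>" if "i \<in> {1..m}" for i using that by (simp add: \<rho>_def)
  obtain D where D: "D > 0" "\<And>c c'. c \<in> C \<Longrightarrow> c' \<in> C \<Longrightarrow> d c c' \<le> D"
  proof -
    obtain R where R: "R > 0" "\<forall>c\<in>C. d x c \<le> R" using compact_d_bounded[OF C(1)] by blast
    show thesis
    proof (rule that[of "R + R"])
      fix c c' assume "c \<in> C" "c' \<in> C"
      then have "d x c \<le> R" "d x c' \<le> R" using R(2) by blast+
      then show "d c c' \<le> R + R" using d_triangle[of c c' x] d_commute[of c x] by linarith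
    qed (use R(1) in simp)
  qed
  have *: "\<exists>w\<in>lists {1..m}. x \<in> word_map h w ` C \<and> word_ratio r w \<le> \<rho> ^ k" if "x \<in> C" for x k
    using that
  proof (induction k arbitrary: x)
    case 0
    then show ?case by (intro bexI[of _ "[]"]) auto
  next
    case (Suc k)
    obtain i y where i: "i \<in> {1..m}" "y \<in> C" "x = h i y" using Suc.prems C_eq by blast
    obtain w where w: "w \<in> lists {1..m}" "y \<in> word_map h w ` C" "word_ratio r w \<le> \<rho> ^ k"
      using Suc.IH[OF i(2)] by blast
    have "r i * word_ratio r w \<le> \<rho> * \<rho> ^ k"
      using \<rho>_ge[OF i(1)] w \<rho> word_ratio_pos[OF w(1)] by (intro mult_mono) auto
    moreover have "x \<in> word_map h (i # w) ` C" using w(2) i(3) by auto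
    ultimately show ?case using i(1) w(1) by (intro bexI[of _ "i # w"]) auto
  qed
  obtain k where k: "\<rho> ^ k < \<epsilon> / D" using real_arch_pow_inv[of "\<epsilon> / D" \<rho>] \<rho> D(1) assms(2) by auto
  obtain w where w: "w \<in> lists {1..m}" "x \<in> word_map h w ` C" "word_ratio r w \<le> \<rho> ^ k"
    using *[OF assms(1)] by blast
  then obtain z where z: "z \<in> C" "x = word_map h w z" by blast
  have "d (word_map h w y) x < \<epsilon>" if "y \<in> C" for y
  proof -
    have "d (word_map h w y) x = word_ratio r w * d y z" using d_word_map[OF w(1)] z(2) by simp
    also have "\<dots> \<le> \<rho> ^ k * D"
      using w(3) D(2)[OF that z(1)] d_nonneg \<rho>(1) by (intro mult_mono) auto
    also have "\<dots> < \<epsilon>" using k D(1) by (simp add: field_simps)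
    finally show ?thesis .
  qed
  then show ?thesis using w(1) by blast
qed

text \<open>If \<open>\<beta>\<close> keeps away from one cylinder, then the mass \<open>t\<^sub>w\<close> of that cylinder contributes a
  constant, and only the remaining mass \<open>1 - t\<^sub>w\<close> is charged with the worst case \<open>l\<close> over the
  family. Each letter of \<open>w\<close> costs one application of the recursion, hence one mean log ratio.\<close>

lemma log_error_cylinder:
  assumes w: "w \<in> lists {1..m}" and \<delta>: "0 < \<delta>" "\<delta> \<le> 1" and \<eta>: "0 < \<eta>" "\<eta> \<le> 1"
    and F: "\<And>\<beta>. \<beta> \<in> F \<Longrightarrow> \<beta> \<noteq> {}" "\<And>i \<beta>. i \<in> {1..m} \<Longrightarrow> \<beta> \<in> F \<Longrightarrow> h i -` \<beta> \<in> F"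
    and l: "\<And>\<beta>. \<beta> \<in> F \<Longrightarrow> l \<le> log_error \<delta> P \<beta>"
    and \<beta>: "\<beta> \<in> F" "\<And>y. y \<in> C \<Longrightarrow> \<eta> \<le> dist_to_set d (word_map h w y) \<beta>"
  shows "word_ratio t w * ln \<eta> + (1 - word_ratio t w) * l + real (length w) * mean_ln_ratio
           \<le> log_error \<delta> P \<beta>"
  using w \<beta>
proof (induction w arbitrary: \<beta>)
  case Nil
  have "AE y in P. ln \<eta> \<le> truncated_ln \<delta> (dist_to_set d y \<beta>)"
    using AE_in_carrier[OF compactly_carried_P C(1) carrier]
    by eventually_elim (use Nil \<eta> in \<open>auto intro!: truncated_ln_ge_ln\<close>)
  then show ?case
    unfolding log_error_def using F(1)[OF Nil.prems(1)] \<delta>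
    by (simp add: integral_compactly_carried_ge[OF compactly_carried_P] continuous_intros)
next
  case (Cons i w)
  have i: "i \<in> {1..m}" and w: "w \<in> lists {1..m}" using Cons.hyps by auto
  have ne: "\<beta> \<noteq> {}" using F(1) Cons.prems(1) .
  define T where "T = word_ratio t w"
  define v where "v = T * ln \<eta> + (1 - T) * l + real (length w) * mean_ln_ratio"
  have "v \<le> log_error \<delta> P (h i -` \<beta>)"
    unfolding v_def T_def
  proof (rule Cons.IH[OF F(2)[OF i Cons.prems(1)]])
    fix y assume "y \<in> C"
    then have "\<eta> \<le> r i * dist_to_set d (word_map h w y) (h i -` \<beta>)"
      using Cons.prems(2)[of y] dist_to_set_vimage[OF similitude[OF i] ne] by simp
    also have "\<dots> \<le> dist_to_set d (word_map h w y) (h i -` \<beta>)"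
      using ratio_less_1[OF i] ratio_pos[OF i] dist_to_set_nonneg[OF similitude_vimage_nonempty[OF similitude[OF i] ne]]
      by (simp add: mult_left_le_one_le)
    finally show "\<eta> \<le> dist_to_set d (word_map h w y) (h i -` \<beta>)" .
  qed
  then have "(\<Sum>j=1..m. t j * (ln (r j) + (if j = i then v else l)))
      \<le> (\<Sum>j=1..m. t j * (ln (r j) + log_error \<delta> P (h j -` \<beta>)))"
    using l F(2) Cons.prems(1) t_pos by (intro sum_mono mult_left_mono) (auto simp: less_imp_le)
  also have "\<dots> \<le> log_error \<delta> P \<beta>"
    using ratio_less_1 by (intro log_error_mixture[OF mix similitude] \<delta> ne) (auto simp: less_imp_le)
  finally have "(\<Sum>j=1..m. t j * (ln (r j) + (if j = i then v else l))) \<le> log_error \<delta> P \<beta>" .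
  moreover have "(\<Sum>j=1..m. t j * (ln (r j) + (if j = i then v else l)))
      = (\<Sum>j=1..m. t j * ln (r j) + t j * l + (if j = i then t j * (v - l) else 0))"
    by (intro sum.cong refl) (simp add: algebra_simps)
  moreover have "\<dots> = mean_ln_ratio + l + t i * (v - l)"
    using i by (simp add: sum.distrib mean_ln_ratio_def t_sum[simplified] flip: sum_distrib_right)
  moreover have "t i * (real (length w) * mean_ln_ratio) \<ge> real (length w) * mean_ln_ratio"
  proof -
    have "real (length w) * mean_ln_ratio \<le> 0" using mean_ln_ratio_neg by (simp add: mult_nonneg_nonpos)
    then have "1 * (real (length w) * mean_ln_ratio) \<le> t i * (real (length w) * mean_ln_ratio)"
      using t_less_1[OF i] by (intro mult_right_mono_neg) auto
    then show ?thesis by simp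
  qed
  ultimately show ?case by (simp add: v_def T_def[symmetric] algebra_simps)
qed

text \<open>Since the remaining masses stay below 1 uniformly, the preceding estimate can be
  bootstrapped. Closedness of \<open>F\<close> under preimages plays the role of self-similarity for the
  sets.\<close>

lemma log_error_bounded_below:
  assumes F: "\<And>\<beta>. \<beta> \<in> F \<Longrightarrow> \<beta> \<noteq> {}" "\<And>i \<beta>. i \<in> {1..m} \<Longrightarrow> \<beta> \<in> F \<Longrightarrow> h i -` \<beta> \<in> F"
    and W: "finite W" "W \<subseteq> lists {1..m}" and \<eta>: "0 < \<eta>"
    and far: "\<And>\<beta>. \<beta> \<in> F \<Longrightarrow> \<exists>w\<in>W. \<forall>y\<in>C. \<eta> \<le> dist_to_set d (word_map h w y) \<beta>"
  shows "\<exists>K. \<forall>\<delta> \<beta>. 0 < \<delta> \<longrightarrow> \<delta> \<le> 1 \<longrightarrow> \<beta> \<in> F \<longrightarrow> - K \<le> log_error \<delta> P \<beta>"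
proof -
  define \<zeta> where "\<zeta> = min 1 \<eta>"
  have \<zeta>: "0 < \<zeta>" "\<zeta> \<le> 1" "\<zeta> \<le> \<eta>" using \<eta> by (auto simp: \<zeta>_def)
  define L where "L = Max (insert 0 (length ` W))"
  define \<tau> where "\<tau> = Min (insert 1 (word_ratio t ` W))"
  have L: "length w \<le> L" if "w \<in> W" for w using that W(1) by (simp add: L_def)
  have tw: "0 < word_ratio t w" if "w \<in> lists {1..m}" for w
    using that by (induction w) (auto simp: t_pos)
  have "\<forall>w\<in>W. 0 < word_ratio t w" using W(2) tw by blast
  then have \<tau>: "0 < \<tau>" "\<And>w. w \<in> W \<Longrightarrow> \<tau> \<le> word_ratio t w"
    using W(1) by (auto simp: \<tau>_def Min_gr_iff)
  define c where "c = ln \<zeta> + real L * mean_ln_ratio"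
  have "c / (1 - (1 - \<tau>)) \<le> log_error \<delta> P \<beta>" if \<delta>: "0 < \<delta>" "\<delta> \<le> 1" and \<beta>: "\<beta> \<in> F" for \<delta> \<beta>
  proof (rule bootstrap_lower_bound[OF \<beta>])
    show "ln \<delta> \<le> log_error \<delta> P \<beta>" if "\<beta> \<in> F" for \<beta>
      using F(1)[OF that] \<delta> by (intro log_error_ge[OF compactly_carried_P])
    fix l \<beta> assume l: "\<And>\<gamma>. \<gamma> \<in> F \<Longrightarrow> l \<le> log_error \<delta> P \<gamma>" and \<beta>: "\<beta> \<in> F"
    obtain w where w: "w \<in> W" "\<And>y. y \<in> C \<Longrightarrow> \<eta> \<le> dist_to_set d (word_map h w y) \<beta>"
      using far[OF \<beta>] by blast
    have "l \<le> 0" using l[OF \<beta>] log_error_nonpos[OF compactly_carried_P \<delta> F(1)[OF \<beta>]] by linarith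
    then have 1: "(1 - \<tau>) * l \<le> (1 - word_ratio t w) * l"
      using \<tau>(2)[OF w(1)] by (intro mult_right_mono_neg) auto
    have 2: "real L * mean_ln_ratio \<le> real (length w) * mean_ln_ratio"
      using L[OF w(1)] mean_ln_ratio_neg by (intro mult_right_mono_neg) auto
    have tw1: "word_ratio t w \<le> 1"
    proof -
      have "word_ratio t w \<le> 1" if "w \<in> lists {1..m}" for w
        using that
      proof (induction w)
        case (Cons i w)
        then have "t i * word_ratio t w \<le> 1 * 1"
          using t_less_1[of i] tw[of w] by (intro mult_mono) auto
        then show ?case by simp
      qed simp
      from this[OF subsetD[OF W(2) w(1)]] show ?thesis .
    qed
    have "ln \<zeta> \<le> 0" using \<zeta> by simp
    then have 3: "ln \<zeta> \<le> word_ratio t w * ln \<zeta>"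
      using mult_right_mono_neg[OF tw1, of "ln \<zeta>"] by simp
    have wl: "w \<in> lists {1..m}" using w(1) W(2) by blast
    have "word_ratio t w * ln \<zeta> + (1 - word_ratio t w) * l + real (length w) * mean_ln_ratio
           \<le> log_error \<delta> P \<beta>"
    proof (rule log_error_cylinder[OF wl \<delta> \<zeta>(1,2) F l \<beta>])
      show "\<zeta> \<le> dist_to_set d (word_map h w y) \<beta>" if "y \<in> C" for y
        using w(2)[OF that] \<zeta>(3) by linarith
    qed
    then show "c + (1 - \<tau>) * l \<le> log_error \<delta> P \<beta>" using 1 2 3 unfolding c_def by linarith
  qed (use \<tau> in simp)
  then show ?thesis by (intro exI[of _ "- (c / (1 - (1 - \<tau>)))"]) auto
qed

text \<open>Integrability of \<open>log d(x, -V)\<close>: some small cylinder lies well inside \<open>V\<close>, because \<open>V\<close>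
  meets \<open>C\<close>. The family consists of all non-empty subsets of the complement, which is closed under
  preimages as \<open>h\<^sub>i(V) \<subseteq> V\<close>.\<close>

lemma log_error_complement_bounded_below:
  assumes V: "open V" "\<And>i. i \<in> {1..m} \<Longrightarrow> h i ` V \<subseteq> V" "V \<inter> C \<noteq> {}" "V \<noteq> UNIV"
  shows "\<exists>K. \<forall>\<delta>. 0 < \<delta> \<longrightarrow> \<delta> \<le> 1 \<longrightarrow> - K \<le> log_error \<delta> P (- V)"
proof -
  define F where "F = {\<beta>. \<beta> \<noteq> {} \<and> \<beta> \<subseteq> - V}"
  obtain x where x: "x \<in> V" "x \<in> C" using V(3) by blast
  obtain \<epsilon> where \<epsilon>: "\<epsilon> > 0" "{y. d x y < \<epsilon>} \<subseteq> V" using open_contains_d_ball[OF V(1) x(1)] by blast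
  obtain w where w: "w \<in> lists {1..m}" "\<And>y. y \<in> C \<Longrightarrow> d (word_map h w y) x < \<epsilon> / 2"
    using small_cylinder[OF x(2), of "\<epsilon> / 2"] \<epsilon>(1) by auto
  have "\<exists>K. \<forall>\<delta> \<beta>. 0 < \<delta> \<longrightarrow> \<delta> \<le> 1 \<longrightarrow> \<beta> \<in> F \<longrightarrow> - K \<le> log_error \<delta> P \<beta>"
  proof (rule log_error_bounded_below[where W = "{w}" and \<eta> = "\<epsilon> / 2"])
    show "h i -` \<beta> \<in> F" if "i \<in> {1..m}" "\<beta> \<in> F" for i \<beta>
      using that V(2)[OF that(1)] similitude_vimage_nonempty[OF similitude[OF that(1)]] by (auto simp: F_def)
    fix \<beta> assume \<beta>: "\<beta> \<in> F"
    have "\<epsilon> / 2 \<le> dist_to_set d (word_map h w y) \<beta>" if y: "y \<in> C" for y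
    proof (rule dist_to_set_greatest)
      fix b assume "b \<in> \<beta>"
      then have "\<epsilon> \<le> d x b" using \<beta> \<epsilon>(2) by (force simp: F_def not_less)
      then show "\<epsilon> / 2 \<le> d (word_map h w y) b"
        using w(2)[OF y] d_triangle[of x b "word_map h w y"] d_commute[of x "word_map h w y"] by linarith
    qed (use \<beta> F_def in blast)
    then show "\<exists>w\<in>{w}. \<forall>y\<in>C. \<epsilon> / 2 \<le> dist_to_set d (word_map h w y) \<beta>" by blast
  qed (use w \<epsilon> F_def in auto)
  moreover have "- V \<in> F" using V(4) by (auto simp: F_def)
  ultimately show ?thesis by blast
qed

text \<open>A point cannot be close to two small cylinders around distinct points of \<open>C\<close>.\<close>

lemma log_error_point_bounded_below:
  assumes x: "x \<in> C" "x' \<in> C" "x \<noteq> x'"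
  shows "\<exists>K. \<forall>\<delta>. \<forall>a::'a. 0 < \<delta> \<longrightarrow> \<delta> \<le> 1 \<longrightarrow> - K \<le> log_error \<delta> P {a}"
proof -
  define \<epsilon> where "\<epsilon> = d x x' / 4"
  have \<epsilon>: "\<epsilon> > 0" using x(3) d_eq_0_iff[of x x'] d_nonneg[of x x'] by (simp add: \<epsilon>_def)
  obtain w where w: "w \<in> lists {1..m}" "\<And>y. y \<in> C \<Longrightarrow> d (word_map h w y) x < \<epsilon>"
    using small_cylinder[OF x(1) \<epsilon>] by auto
  obtain w' where w': "w' \<in> lists {1..m}" "\<And>y. y \<in> C \<Longrightarrow> d (word_map h w' y) x' < \<epsilon>"
    using small_cylinder[OF x(2) \<epsilon>] by auto
  have "\<exists>K. \<forall>\<delta> \<beta>. 0 < \<delta> \<longrightarrow> \<delta> \<le> 1 \<longrightarrow> \<beta> \<in> range (\<lambda>a::'a. {a}) \<longrightarrow> - K \<le> log_error \<delta> P \<beta>"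
  proof (rule log_error_bounded_below[where W = "{w, w'}" and \<eta> = \<epsilon>])
    show "h i -` \<beta> \<in> range (\<lambda>a::'a. {a})" if i: "i \<in> {1..m}" and \<beta>: "\<beta> \<in> range (\<lambda>a::'a. {a})" for i \<beta>
    proof -
      obtain a where "\<beta> = {a}" using \<beta> by blast
      moreover have "h i -` {a} = {inv (h i) a}"
        using bij_vimage_eq_inv_image[OF similitude_bij[OF similitude[OF i]], of "{a}"] by simp
      ultimately show ?thesis by blast
    qed
    fix \<beta> assume "\<beta> \<in> range (\<lambda>a::'a. {a})"
    then obtain a where a: "\<beta> = {a}" by blast
    have "2 * \<epsilon> \<le> d x a \<or> 2 * \<epsilon> \<le> d x' a"
      using d_triangle[of x x' a] d_commute[of a x'] by (simp add: \<epsilon>_def) linarith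
    then show "\<exists>w\<in>{w, w'}. \<forall>y\<in>C. \<epsilon> \<le> dist_to_set d (word_map h w y) \<beta>"
    proof
      assume *: "2 * \<epsilon> \<le> d x a"
      have "\<epsilon> \<le> d (word_map h w y) a" if "y \<in> C" for y
        using w(2)[OF that] * d_triangle[of x a "word_map h w y"] d_commute[of x "word_map h w y"] by linarith
      then show ?thesis using a by simp
    next
      assume *: "2 * \<epsilon> \<le> d x' a"
      have "\<epsilon> \<le> d (word_map h w' y) a" if "y \<in> C" for y
        using w'(2)[OF that] * d_triangle[of x' a "word_map h w' y"] d_commute[of x' "word_map h w' y"] by linarith
      then show ?thesis using a by simp
    qed
  qed (use w w' \<epsilon> in auto)
  then show ?thesis by blast
qed

text \<open>The induction runs over a real budget \<open>x\<close> that is independent of the number of points; the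
  excess of points over budget is paid for linearly by the term \<open>k card \<alpha> / x\<close>. This term is
  additive over the pieces, because a point of \<open>\<alpha>\<close> lies in at most one \<open>h\<^sub>i(V)\<close>. Taking
  \<open>x = n\<close> at the end makes it a constant.\<close>

lemma log_error_lower_bound:
  assumes osc: "open_set_condition m h" and e: "0 \<le> e"
    and bal: "0 \<le> (\<Sum>i=1..m. t i * (ln (r i) - e * ln (t i)))"
  shows "\<exists>K. \<forall>\<delta> \<alpha> n. 0 < \<delta> \<longrightarrow> \<delta> \<le> 1 \<longrightarrow> finite \<alpha> \<longrightarrow> \<alpha> \<noteq> {} \<longrightarrow> card \<alpha> \<le> n \<longrightarrow>
           - e * ln (real n) - K \<le> log_error \<delta> P \<alpha>"
proof -
  obtain V where V: "open V" "\<And>i. i \<in> {1..m} \<Longrightarrow> h i ` V \<subseteq> V"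
      "disjoint_family_on (\<lambda>i. h i ` V) {1..m}" "V \<inter> C \<noteq> {}"
    using strong_open_set_condition[OF osc] by blast
  have m12: "1 \<in> {1..m}" "2 \<in> {1..m}" using m by auto
  have disj: "h 1 ` V \<inter> h 2 ` V = {}" using V(3) m12 by (auto simp: disjoint_family_on_def)
  have "V \<noteq> UNIV"
  proof
    assume "V = UNIV"
    moreover have "surj (h 1)" "surj (h 2)"
      using similitude_bij[OF similitude[OF m12(1)]] similitude_bij[OF similitude[OF m12(2)]]
      by (simp_all only: bij_def)
    ultimately show False using disj by simp
  qed
  then obtain K where K: "\<And>\<delta>. 0 < \<delta> \<Longrightarrow> \<delta> \<le> 1 \<Longrightarrow> - K \<le> log_error \<delta> P (- V)"
    using log_error_complement_bounded_below[OF V(1,2,4)] by blast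
  obtain x where x: "x \<in> V" "x \<in> C" using V(4) by blast
  \<comment> \<open>Disjointness of the images of \<open>V\<close> excludes that \<open>C\<close> is a single point.\<close>
  have "h 1 x \<in> C" "h 2 x \<in> C" using C_eq x(2) m12 by blast+
  moreover have "h 1 x \<noteq> h 2 x" using disj x(1) by blast
  ultimately obtain K' where K': "\<forall>\<delta> a. 0 < \<delta> \<longrightarrow> \<delta> \<le> 1 \<longrightarrow> - K' \<le> log_error \<delta> P {a}"
    using log_error_point_bounded_below[of "h 1 x" "h 2 x"] by blast
  define k where "k = max 0 K'"
  have k: "0 \<le> k" "- k \<le> log_error \<delta> P {a}" if "0 < \<delta>" "\<delta> \<le> 1" for \<delta> a
  proof -
    show "0 \<le> k" by (simp add: k_def)
    have "- k \<le> - K'" by (simp add: k_def)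
    also have "\<dots> \<le> log_error \<delta> P {a}" using K' that by blast
    finally show "- k \<le> log_error \<delta> P {a}" .
  qed
  note k = k(1)[of 1, simplified] k(2)
  define \<theta> where "\<theta> = Min (t ` {1..m})"
  have \<theta>: "0 < \<theta>" "\<And>i. i \<in> {1..m} \<Longrightarrow> \<theta> \<le> t i"
    unfolding \<theta>_def using m t_pos by (auto simp: Min_gr_iff)
  \<comment> \<open>On \<open>[\<theta>, 1]\<close> the target contains the nonnegative term \<open>- e log x\<close>, at most \<open>- e log \<theta>\<close>.\<close>
  define L where "L = K - e * ln \<theta>"
  have main: "\<forall>\<alpha>. finite \<alpha> \<longrightarrow> \<alpha> \<subseteq> V \<longrightarrow>
      - e * ln x - L - k * real (card \<alpha>) / x \<le> log_error \<delta> P (\<alpha> \<union> - V)"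
    if \<delta>: "0 < \<delta>" "\<delta> \<le> 1" and x: "\<theta> \<le> x" for \<delta> x
  proof (rule scaling_induct[where I = "{1..m}" and w = t and \<theta> = \<theta> and x = x])
    fix x assume x: "\<theta> \<le> x" "x \<le> 1"
    show "\<forall>\<alpha>. finite \<alpha> \<longrightarrow> \<alpha> \<subseteq> V \<longrightarrow>
      - e * ln x - L - k * real (card \<alpha>) / x \<le> log_error \<delta> P (\<alpha> \<union> - V)"
    proof (intro allI impI)
      fix \<alpha> :: "'a set" assume \<alpha>: "finite \<alpha>"
      have "- K - k * real (card \<alpha>) \<le> log_error \<delta> P (\<alpha> \<union> - V)"
        using \<alpha>
      proof (induction \<alpha> rule: finite_induct)
        case empty
        then show ?case using K[OF \<delta>] by simp
      next
        case (insert a \<alpha>)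
        have "log_error \<delta> P {a} + log_error \<delta> P (\<alpha> \<union> - V) \<le> log_error \<delta> P (insert a \<alpha> \<union> - V)"
          using log_error_insert[OF compactly_carried_P \<delta>, of "\<alpha> \<union> - V" a] \<open>V \<noteq> UNIV\<close> by auto
        then show ?case using insert k(2)[OF \<delta>, of a] by (simp add: algebra_simps)
      qed
      moreover have "k * real (card \<alpha>) * x \<le> k * real (card \<alpha>) * 1"
        using x k(1) by (intro mult_left_mono) auto
      then have "k * real (card \<alpha>) \<le> k * real (card \<alpha>) / x"
        using x \<theta>(1) by (simp add: field_simps)
      moreover have "e * ln \<theta> \<le> e * ln x"
        using x \<theta>(1) e by (intro mult_left_mono ln_mono) auto
      ultimately show "- e * ln x - L - k * real (card \<alpha>) / x \<le> log_error \<delta> P (\<alpha> \<union> - V)"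
        unfolding L_def by linarith
    qed
  next
    fix x :: real assume x: "1 < x"
      and IH: "\<And>i. i \<in> {1..m} \<Longrightarrow> \<forall>\<alpha>. finite \<alpha> \<longrightarrow> \<alpha> \<subseteq> V \<longrightarrow>
        - e * ln (t i * x) - L - k * real (card \<alpha>) / (t i * x) \<le> log_error \<delta> P (\<alpha> \<union> - V)"
    show "\<forall>\<alpha>. finite \<alpha> \<longrightarrow> \<alpha> \<subseteq> V \<longrightarrow>
      - e * ln x - L - k * real (card \<alpha>) / x \<le> log_error \<delta> P (\<alpha> \<union> - V)"
    proof (intro allI impI)
      fix \<alpha> assume \<alpha>: "finite \<alpha>" "\<alpha> \<subseteq> V"
      define A where "A i = h i -` \<alpha> \<inter> V" for i
      have inj: "inj_on (h i) B" if "i \<in> {1..m}" for i B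
        using similitude_bij[OF similitude[OF that]] by (meson bij_is_inj inj_on_subset subset_UNIV)
      have A: "finite (A i)" "A i \<subseteq> V" if "i \<in> {1..m}" for i
        using \<alpha>(1) inj[OF that] by (auto simp: A_def intro: finite_vimageI)
      have "(\<Sum>i=1..m. card (A i)) = (\<Sum>i=1..m. card (h i ` A i))"
        using inj by (intro sum.cong refl card_image[symmetric])
      also have "\<dots> = card (\<Union>i\<in>{1..m}. h i ` A i)"
      proof (rule card_UN_disjoint[symmetric])
        show "\<forall>i\<in>{1..m}. \<forall>j\<in>{1..m}. i \<noteq> j \<longrightarrow> h i ` A i \<inter> h j ` A j = {}"
        proof (intro ballI impI)
          fix i j assume "i \<in> {1..m}" "j \<in> {1..m}" "i \<noteq> j"
          then have "h i ` V \<inter> h j ` V = {}" using V(3) by (simp add: disjoint_family_on_def)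
          then show "h i ` A i \<inter> h j ` A j = {}" unfolding A_def by blast
        qed
      qed (use A in auto)
      also have "\<dots> \<le> card \<alpha>" using \<alpha>(1) by (intro card_mono) (auto simp: A_def)
      finally have "(\<Sum>i=1..m. card (A i)) \<le> card \<alpha>" .
      then have "(\<Sum>i=1..m. real (card (A i))) \<le> real (card \<alpha>)" by (metis of_nat_le_iff of_nat_sum)
      then have "k / x * (\<Sum>i=1..m. real (card (A i))) \<le> k / x * real (card \<alpha>)"
        using k(1) x by (intro mult_left_mono) auto
      then have "- e * ln x - L - k * real (card \<alpha>) / x
          \<le> (\<Sum>i=1..m. t i * (ln (r i) - e * ln (t i))) - e * ln x - L - k / x * (\<Sum>i=1..m. real (card (A i)))"
        using bal by simp
      also have "\<dots> = (\<Sum>i=1..m. t i * (ln (r i) - e * ln (t i)) - t i * (e * ln x) - t i * L - k / x * real (card (A i)))"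
        by (simp add: sum_subtractf t_sum[simplified] sum_distrib_left flip: sum_distrib_right)
      also have "\<dots> = (\<Sum>i=1..m. t i * (ln (r i) + (- e * ln (t i * x) - L - k * real (card (A i)) / (t i * x))))"
      proof (intro sum.cong refl)
        fix i assume "i \<in> {1..m}"
        then have ti: "0 < t i" by (rule t_pos)
        then have "ln (t i * x) = ln (t i) + ln x" using x by (intro ln_mult_pos) auto
        then show "t i * (ln (r i) - e * ln (t i)) - t i * (e * ln x) - t i * L - k / x * real (card (A i))
            = t i * (ln (r i) + (- e * ln (t i * x) - L - k * real (card (A i)) / (t i * x)))"
          using ti x by (simp add: algebra_simps)
      qed
      also have "\<dots> \<le> (\<Sum>i=1..m. t i * (ln (r i) + log_error \<delta> P (h i -` (\<alpha> \<union> - V))))"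
      proof (intro sum_mono mult_left_mono add_left_mono)
        fix i assume i: "i \<in> {1..m}"
        have "- e * ln (t i * x) - L - k * real (card (A i)) / (t i * x) \<le> log_error \<delta> P (A i \<union> - V)"
          using IH[OF i] A[OF i] by blast
        also have "\<dots> \<le> log_error \<delta> P (h i -` (\<alpha> \<union> - V))"
        proof (rule log_error_antimono[OF compactly_carried_P \<delta>(1)])
          show "h i -` (\<alpha> \<union> - V) \<noteq> {}" using \<open>V \<noteq> UNIV\<close> by (intro similitude_vimage_nonempty[OF similitude[OF i]]) auto
          show "h i -` (\<alpha> \<union> - V) \<subseteq> A i \<union> - V" using V(2)[OF i] by (auto simp: A_def)
        qed
        finally show "- e * ln (t i * x) - L - k * real (card (A i)) / (t i * x) \<le> log_error \<delta> P (h i -` (\<alpha> \<union> - V))" .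
      qed (use t_pos in \<open>simp add: less_imp_le\<close>)
      also have "\<dots> \<le> log_error \<delta> P (\<alpha> \<union> - V)"
        using ratio_less_1 \<open>V \<noteq> UNIV\<close>
        by (intro log_error_mixture[OF mix similitude] \<delta>) (auto simp: less_imp_le)
      finally show "- e * ln x - L - k * real (card \<alpha>) / x \<le> log_error \<delta> P (\<alpha> \<union> - V)" .
    qed
  qed (use \<theta> t_less_1 x in auto)
  have "- e * ln (real n) - (L + k) \<le> log_error \<delta> P \<alpha>"
    if \<delta>: "0 < \<delta>" "\<delta> \<le> 1" and \<alpha>: "finite \<alpha>" "\<alpha> \<noteq> {}" "card \<alpha> \<le> n" for \<delta> \<alpha> n
  proof -
    have "0 < card \<alpha>" using \<alpha> by (simp add: card_gt_0_iff)
    then have n: "1 \<le> real n" using \<alpha>(3) by simp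
    have "\<theta> \<le> real n" using \<theta>(2)[OF m12(1)] t_less_1[OF m12(1)] n by linarith
    then have "- e * ln (real n) - L - k * real (card (\<alpha> \<inter> V)) / real n \<le> log_error \<delta> P ((\<alpha> \<inter> V) \<union> - V)"
      using main[OF \<delta>] \<alpha>(1) by blast
    also have "\<dots> \<le> log_error \<delta> P \<alpha>" using \<alpha> by (intro log_error_antimono compactly_carried_P \<delta>) auto
    finally have *: "- e * ln (real n) - L - k * real (card (\<alpha> \<inter> V)) / real n \<le> log_error \<delta> P \<alpha>" .
    have "card (\<alpha> \<inter> V) \<le> n" using \<alpha> card_mono[of \<alpha> "\<alpha> \<inter> V"] by (meson Int_lower1 order_trans)
    then have "k * real (card (\<alpha> \<inter> V)) \<le> k * real n" using k(1) by (intro mult_left_mono) auto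
    then have "k * real (card (\<alpha> \<inter> V)) / real n \<le> k" using n by (simp add: field_simps)
    then show ?thesis using * by linarith
  qed
  then show ?thesis by blast
qed

end

section \<open>Supports and invariant measures\<close>

text \<open>The complement is a union of open null sets, and by Lindelof countably many of
  them suffice.\<close>

lemma measure_topological_support:
  fixes P :: "'a::euclidean_space measure"
  assumes P: "borel_probability P"
  shows "closed (topological_support P)" "measure P (topological_support P) = 1"
proof -
  interpret prob_space P using P by (simp add: borel_probability_def)
  have sets: "sets P = sets borel" using P by (simp add: borel_probability_def)
  then have space: "space P = UNIV" using sets_eq_imp_space_eq by fastforce
  define \<U> where "\<U> = {U. open U \<and> emeasure P U = 0}"
  have eq: "topological_support P = - \<Union>\<U>"
  proof
    show "topological_support P \<subseteq> - \<Union>\<U>"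
    proof
      fix x assume x: "x \<in> topological_support P"
      have "x \<notin> U" if "U \<in> \<U>" for U
      proof -
        have "closed (- U) \<and> emeasure P (- (- U)) = 0" using that by (auto simp: \<U>_def)
        then have "x \<in> - U" using x unfolding topological_support_def by blast
        then show ?thesis by simp
      qed
      then show "x \<in> - \<Union>\<U>" by blast
    qed
    show "- \<Union>\<U> \<subseteq> topological_support P"
      unfolding topological_support_def \<U>_def by auto
  qed
  show "closed (topological_support P)" unfolding topological_support_def by blast
  obtain \<V> where \<V>: "\<V> \<subseteq> \<U>" "countable \<V>" "\<Union>\<V> = \<Union>\<U>"
    by (rule Lindelof[of \<U>]) (auto simp: \<U>_def)
  have "\<V> \<subseteq> null_sets P"
    using \<V>(1) by (auto simp: \<U>_def null_sets_def sets)
  then have "(\<Union>U\<in>\<V>. U) \<in> null_sets P" using \<V>(2) by (intro null_sets_UN') auto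
  then have "\<Union>\<U> \<in> null_sets P" using \<V>(3) by simp
  then have "measure P (\<Union>\<U>) = 0" "\<Union>\<U> \<in> sets P"
    by (auto simp: null_setsD1 measure_def)
  then show "measure P (topological_support P) = 1"
    unfolding eq using prob_compl[of "\<Union>\<U>"] by (simp add: space Compl_eq_Diff_UNIV)
qed

lemma topological_support_minimal:
  fixes P :: "'a::euclidean_space measure"
  assumes P: "borel_probability P" and F: "closed F" "measure P F = 1"
  shows "topological_support P \<subseteq> F"
proof -
  interpret prob_space P using P by (simp add: borel_probability_def)
  have sets: "sets P = sets borel" using P by (simp add: borel_probability_def)
  then have space: "space P = UNIV" using sets_eq_imp_space_eq by fastforce
  have "prob (- F) = 0" using F prob_compl[of F] sets by (simp add: space Compl_eq_Diff_UNIV)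
  then show ?thesis using F(1) unfolding topological_support_def by (auto simp: emeasure_eq_measure)
qed

lemma self_similar_measure_imp_mixture:
  fixes P :: "'a::euclidean_space measure"
  assumes "self_similar_measure m h t P" "compact (topological_support P)"
    and "probability_vector {1..m} t" "\<And>i. i \<in> {1..m} \<Longrightarrow> 0 < t i"
    and "\<And>i. i \<in> {1..m} \<Longrightarrow> continuous_on UNIV (h i)"
  shows "mixture {1..m} t h (\<lambda>_. P) P"
proof -
  have "compactly_carried P"
    using assms measure_topological_support[of P]
    by (auto simp: compactly_carried_def self_similar_measure_def)
  then show ?thesis
    using assms by (simp add: mixture_def self_similar_measure_def probability_vector_def)
qed

text \<open>The support inherits the invariance of the measure, so it can serve as the attractor of the
  system.\<close>

lemma support_self_similar:
  fixes P :: "'a::euclidean_space measure" and m :: nat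
  assumes mix: "mixture {1..m} t h (\<lambda>_. P) P" and C: "C = topological_support P" "compact C"
  shows "C = (\<Union>i\<in>{1..m}. h i ` C)"
proof -
  have t: "\<And>i. i \<in> {1..m} \<Longrightarrow> 0 < t i" "sum t {1..m} = 1" and P: "compactly_carried P"
    and h: "\<And>i. i \<in> {1..m} \<Longrightarrow> continuous_on UNIV (h i)"
    and meas: "\<And>A. A \<in> sets borel \<Longrightarrow> measure P A = (\<Sum>i=1..m. t i * measure P (h i -` A))"
    using mix by (auto simp: mixture_def)
  have bP: "borel_probability P" using P by (simp add: compactly_carried_def)
  interpret prob_space P using compactly_carriedD[OF P] by blast
  have PC: "measure P C = 1" using measure_topological_support[OF bP] C by simp
  have vim: "closed (h i -` F)" if "i \<in> {1..m}" "closed F" for i F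
    using h[OF that(1)] by (intro continuous_closed_vimage that(2)) (simp add: continuous_on_eq_continuous_at)
  have sub: "C \<subseteq> h i -` C" if i: "i \<in> {1..m}" for i
  proof -
    have "measure P (h i -` C) = 1"
    proof (rule ccontr)
      assume "measure P (h i -` C) \<noteq> 1"
      then have "measure P (h i -` C) < 1" using prob_le_1[of "h i -` C"] by linarith
      then have "(\<Sum>j=1..m. t j * measure P (h j -` C)) < (\<Sum>j=1..m. t j * 1)"
        using i t(1) by (intro sum_strict_mono_ex1) (auto intro!: mult_left_mono bexI[of _ i] simp: less_imp_le)
      moreover have "measure P C = (\<Sum>j=1..m. t j * measure P (h j -` C))"
        using C(2) by (intro meas) (simp add: borel_compact)
      ultimately show False using PC t(2) by simp
    qed
    then show ?thesis
      using topological_support_minimal[OF bP vim[OF i]] C compact_imp_closed by blast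
  qed
  have "compact (\<Union>i\<in>{1..m}. h i ` C)"
    using C(2) h by (intro compact_UN compact_continuous_image) (auto intro: continuous_on_subset)
  then have H: "closed (\<Union>i\<in>{1..m}. h i ` C)" by (rule compact_imp_closed)
  have "1 \<le> measure P (h i -` (\<Union>i\<in>{1..m}. h i ` C))" if i: "i \<in> {1..m}" for i
  proof -
    have "C \<subseteq> h i -` (\<Union>i\<in>{1..m}. h i ` C)" using i by blast
    then have "measure P C \<le> measure P (h i -` (\<Union>i\<in>{1..m}. h i ` C))"
      using vim[OF i H] compactly_carriedD(2)[OF P] by (intro finite_measure_mono) auto
    then show ?thesis using PC by simp
  qed
  then have "(\<Sum>i=1..m. t i * 1) \<le> (\<Sum>i=1..m. t i * measure P (h i -` (\<Union>i\<in>{1..m}. h i ` C)))"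
    using t(1) by (intro sum_mono mult_left_mono) (auto simp: less_imp_le)
  also have "\<dots> = measure P (\<Union>i\<in>{1..m}. h i ` C)" using H by (intro meas[symmetric]) simp
  finally have "measure P (\<Union>i\<in>{1..m}. h i ` C) = 1" using t(2) prob_le_1 by (simp add: antisym)
  then have "C \<subseteq> (\<Union>i\<in>{1..m}. h i ` C)" unfolding C(1) using topological_support_minimal[OF bP H] C(1) by simp
  then show ?thesis using sub by blast
qed

text \<open>A large ball \<open>S\<close> is mapped into itself by all \<open>f\<^sub>i\<close> and carries \<open>\<nu>\<close>. Then
  \<open>\<mu>(S) \<ge> p\<^sub>0 + (1 - p\<^sub>0) \<mu>(S)\<close>, which leaves only \<open>\<mu>(S) = 1\<close>.\<close>

lemma (in norm_metric) inhomogeneous_imp_compactly_carried: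
  assumes \<mu>: "inhomogeneous_self_similar_measure N f p \<nu> \<mu>" and \<nu>: "compactly_carried \<nu>"
    and f: "\<And>i. i \<in> {1..N} \<Longrightarrow> similitude (s i) (f i)" "\<And>i. i \<in> {1..N} \<Longrightarrow> s i < 1"
    and p: "\<And>i. i \<in> {0..N} \<Longrightarrow> 0 < p i" "sum p {0..N} = 1"
  shows "compactly_carried \<mu>"
proof -
  have b\<mu>: "borel_probability \<mu>"
    and meas: "\<And>A. A \<in> sets borel \<Longrightarrow>
        measure \<mu> A = p 0 * measure \<nu> A + (\<Sum>i=1..N. p i * measure \<mu> (f i -` A))"
    using \<mu> by (auto simp: inhomogeneous_self_similar_measure_def)
  interpret prob_space \<mu> using b\<mu> by (simp add: borel_probability_def)
  interpret \<nu>: prob_space \<nu> using compactly_carriedD[OF \<nu>] by blast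
  obtain C where C: "compact C" "measure \<nu> C = 1" using \<nu> by (auto simp: compactly_carried_def)
  obtain R0 where R0: "R0 > 0" "\<And>y. y \<in> C \<Longrightarrow> d 0 y \<le> R0" using compact_d_bounded[OF C(1)] by blast
  define R where "R = R0 + (\<Sum>i=1..N. d 0 (f i 0) / (1 - s i))"
  have nn: "0 \<le> d 0 (f i 0) / (1 - s i)" if "i \<in> {1..N}" for i
    using f(2)[OF that] d_nonneg by simp
  have R: "R0 \<le> R" "\<And>i. i \<in> {1..N} \<Longrightarrow> d 0 (f i 0) \<le> (1 - s i) * R"
  proof -
    have "0 \<le> (\<Sum>i=1..N. d 0 (f i 0) / (1 - s i))" using nn by (intro sum_nonneg)
    then show "R0 \<le> R" by (simp add: R_def)
    fix i assume i: "i \<in> {1..N}"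
    have "d 0 (f i 0) / (1 - s i) \<le> (\<Sum>i=1..N. d 0 (f i 0) / (1 - s i))"
      using i nn by (intro member_le_sum) auto
    then have "d 0 (f i 0) / (1 - s i) \<le> R" using R0(1) by (simp add: R_def)
    then show "d 0 (f i 0) \<le> (1 - s i) * R" using f(2)[OF i] by (simp add: field_simps)
  qed
  define S where "S = {y. d 0 y \<le> R}"
  have S: "compact S" by (simp add: S_def compact_d_cball)
  have "S \<subseteq> f i -` S" if i: "i \<in> {1..N}" for i
  proof
    fix y assume y: "y \<in> S"
    have "d 0 (f i y) \<le> d 0 (f i 0) + d (f i 0) (f i y)" by (rule d_triangle)
    also have "d (f i 0) (f i y) = s i * d 0 y" using f(1)[OF i] by (simp add: similitude_def)
    also have "\<dots> \<le> s i * R" using y f(1)[OF i] by (simp add: S_def similitude_def)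
    finally show "y \<in> f i -` S" using R(2)[OF i] by (simp add: S_def algebra_simps)
  qed
  moreover have "f i -` S \<in> sets borel" if i: "i \<in> {1..N}" for i
  proof -
    have "f i \<in> borel_measurable borel"
      by (rule borel_measurable_continuous_onI[OF similitude_continuous[OF f(1)[OF i]]])
    from measurable_sets[OF this, of S] S show ?thesis by (simp add: borel_compact)
  qed
  ultimately have inc: "measure \<mu> S \<le> measure \<mu> (f i -` S)" if "i \<in> {1..N}" for i
    using that b\<mu> by (intro finite_measure_mono) (auto simp: borel_probability_def)
  have "C \<subseteq> S" using R0(2) R(1) by (force simp: S_def)
  then have "measure \<nu> C \<le> measure \<nu> S"
    using S compactly_carriedD(2)[OF \<nu>] by (intro \<nu>.finite_measure_mono) (auto simp: borel_compact)
  then have "measure \<nu> S = 1" using C(2) \<nu>.prob_le_1[of S] by simp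
  then have "measure \<mu> S = p 0 + (\<Sum>i=1..N. p i * measure \<mu> (f i -` S))"
    using meas[of S] S by (simp add: borel_compact)
  moreover have "(\<Sum>i=1..N. p i * measure \<mu> S) \<le> (\<Sum>i=1..N. p i * measure \<mu> (f i -` S))"
    using inc p(1) by (intro sum_mono mult_left_mono) (auto simp: less_imp_le)
  moreover have "(\<Sum>i=1..N. p i * measure \<mu> S) = sum p {1..N} * measure \<mu> S"
    by (rule sum_distrib_right[symmetric])
  moreover have "sum p {1..N} = 1 - p 0" using p(2) by (simp add: sum.atLeast_Suc_atMost)
  ultimately have "p 0 + (1 - p 0) * measure \<mu> S \<le> measure \<mu> S" by simp
  then have "p 0 * 1 \<le> p 0 * measure \<mu> S" by (simp add: algebra_simps)
  then have "measure \<mu> S = 1" using p(1)[of 0] prob_le_1[of S] by simp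
  then show ?thesis using b\<mu> S by (auto simp: compactly_carried_def)
qed

lemma inhomogeneous_imp_mixture:
  fixes \<mu> \<nu> :: "'a::euclidean_space measure"
  assumes \<mu>: "inhomogeneous_self_similar_measure N f p \<nu> \<mu>"
    and cc: "compactly_carried \<nu>" "compactly_carried \<mu>"
    and f: "\<And>i. i \<in> {1..N} \<Longrightarrow> continuous_on UNIV (f i)"
    and p: "\<And>i. i \<in> {0..N} \<Longrightarrow> 0 < p i" "sum p {0..N} = 1"
  shows "mixture {0..N} p (f(0 := id)) ((\<lambda>_. \<mu>)(0 := \<nu>)) \<mu>"
  unfolding mixture_def
proof (intro conjI ballI)
  fix A :: "'a set" assume "A \<in> sets borel"
  then have "measure \<mu> A = p 0 * measure \<nu> A + (\<Sum>i=1..N. p i * measure \<mu> (f i -` A))"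
    using \<mu> by (simp add: inhomogeneous_self_similar_measure_def)
  then show "measure \<mu> A
      = (\<Sum>i=0..N. p i * measure (((\<lambda>_. \<mu>)(0 := \<nu>)) i) ((f(0 := id)) i -` A))"
    by (simp add: sum.atLeast_Suc_atMost)
qed (use cc f p in \<open>auto simp: continuous_on_id[unfolded id_def] id_def Suc_le_eq\<close>)

lemma eexp_mono: "x \<le> y \<Longrightarrow> eexp x \<le> eexp y"
  by (cases x; cases y) (auto simp: eexp_def)

lemma eexp_ereal [simp]: "eexp (ereal x) = ereal (exp x)"
  by (simp add: eexp_def)

context norm_metric
begin

lemma ereal_integral_le:
  assumes P: "compactly_carried P" and \<alpha>: "\<alpha> \<noteq> {}" and \<delta>: "0 < \<delta>"
  shows "ereal_integral P (\<lambda>x. elog (ereal (dist_to_set d x \<alpha>)))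
           \<le> ereal (\<integral>x. ln (max \<delta> (dist_to_set d x \<alpha>)) \<partial>P)"
proof -
  define g where "g x = ln (max \<delta> (dist_to_set d x \<alpha>))" for x
  have int: "integrable P g"
    unfolding g_def by (intro integrable_compactly_carried[OF P] continuous_intros \<alpha> \<delta>)
  have le: "elog (ereal (dist_to_set d x \<alpha>)) \<le> ereal (g x)" for x
    unfolding elog_def g_def using \<delta> by (auto intro!: ln_mono)
  have le': "ereal (- g x) \<le> - elog (ereal (dist_to_set d x \<alpha>))" for x
    using le[of x] ereal_minus_le_minus[of "ereal (g x)"] by simp
  have E: "ennreal r = e2ennreal (ereal r)" for r by (simp add: ennreal_def e2ennreal_def)
  have "ereal_integral P (\<lambda>x. elog (ereal (dist_to_set d x \<alpha>)))
      \<le> enn2ereal (\<integral>\<^sup>+x. ennreal (g x) \<partial>P) - enn2ereal (\<integral>\<^sup>+x. ennreal (- g x) \<partial>P)"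
    unfolding ereal_integral_def
  proof (intro ereal_minus_mono)
    show "enn2ereal (\<integral>\<^sup>+x. e2ennreal (elog (ereal (dist_to_set d x \<alpha>))) \<partial>P) \<le> enn2ereal (\<integral>\<^sup>+x. ennreal (g x) \<partial>P)"
      unfolding E less_eq_ennreal.rep_eq[symmetric] using le by (intro nn_integral_mono e2ennreal_mono)
    show "enn2ereal (\<integral>\<^sup>+x. ennreal (- g x) \<partial>P) \<le> enn2ereal (\<integral>\<^sup>+x. e2ennreal (- elog (ereal (dist_to_set d x \<alpha>))) \<partial>P)"
      unfolding E less_eq_ennreal.rep_eq[symmetric] using le'
      by (intro nn_integral_mono e2ennreal_mono)
  qed
  also have "\<dots> = ereal (\<integral>x. g x \<partial>P)"
  proof -
    obtain a where a: "0 \<le> a" "(\<integral>\<^sup>+x. ennreal (g x) \<partial>P) = ennreal a"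
      using real_integrable_def int by (metis ennreal_cases infinity_ennreal_def)
    obtain b where b: "0 \<le> b" "(\<integral>\<^sup>+x. ennreal (- g x) \<partial>P) = ennreal b"
      using real_integrable_def int by (metis ennreal_cases infinity_ennreal_def)
    show ?thesis
      unfolding real_lebesgue_integral_def[OF int] using a b by (simp add: enn2ereal_ennreal)
  qed
  finally show ?thesis by (simp add: g_def)
qed

text \<open>Monotone convergence as \<open>\<delta> = 1/(k+1)\<close> tends to 0. A bound that is uniform in \<open>\<delta>\<close> shows in
  particular that the negative part of the logarithm is integrable.\<close>

lemma ereal_integral_ge:
  assumes P: "compactly_carried P" and \<alpha>: "\<alpha> \<noteq> {}"
    and L: "\<And>\<delta>. 0 < \<delta> \<Longrightarrow> \<delta> \<le> 1 \<Longrightarrow> L \<le> log_error \<delta> P \<alpha>"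
  shows "ereal L \<le> ereal_integral P (\<lambda>x. elog (ereal (dist_to_set d x \<alpha>)))"
proof -
  define D where "D x = dist_to_set d x \<alpha>" for x
  define G where "G k x = ennreal (- truncated_ln (1 / real (Suc k)) (D x))" for k x
  have cont: "continuous_on UNIV (\<lambda>x. - truncated_ln (1 / real (Suc k)) (D x))" for k
    unfolding D_def using \<alpha> by (intro continuous_intros) auto
  have meas: "G k \<in> borel_measurable P" for k
  proof -
    have "(\<lambda>x. - truncated_ln (1 / real (Suc k)) (D x)) \<in> borel_measurable P"
      by (intro measurable_compactly_carried[OF P] borel_measurable_continuous_onI cont)
    then show ?thesis unfolding G_def by simp
  qed
  have inc: "incseq G"
  proof (rule incseq_SucI, rule le_funI)
    fix k x
    have "truncated_ln (1 / real (Suc (Suc k))) (D x) \<le> truncated_ln (1 / real (Suc k)) (D x)"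
      unfolding truncated_ln_def by (intro ln_mono max.mono) (auto simp: frac_le less_max_iff_disj)
    then show "G k x \<le> G (Suc k) x" unfolding G_def by (intro ennreal_leI) simp
  qed
  have ptw: "e2ennreal (- elog (ereal (D x))) \<le> (SUP k. G k x)" for x
  proof (cases "D x \<le> 0")
    case True
    have top: "(SUP k. G k x) = \<infinity>"
      unfolding infinity_ennreal_def
    proof (rule ennreal_SUP_eq_top)
      fix n :: nat
      obtain k where k: "exp (real n) \<le> real k" using real_arch_simple by blast
      then have "real n \<le> ln (real (Suc k))" by (subst ln_ge_iff) auto
      also have "\<dots> = - truncated_ln (1 / real (Suc k)) (D x)"
      proof -
        have "min 1 (D x) \<le> 1 / real (Suc k)" using True order_trans[of "D x" 0 "1 / real (Suc k)"] by simp
        then have "max (1 / real (Suc k)) (min 1 (D x)) = 1 / real (Suc k)" by (rule max_absorb1)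
        then show ?thesis by (simp only: truncated_ln_def) (simp add: ln_div)
      qed
      finally have "of_nat n \<le> G k x" unfolding G_def ennreal_of_nat_eq_real_of_nat by (rule ennreal_leI)
      then show "\<exists>k\<in>UNIV. of_nat n \<le> G k x" by blast
    qed
    show ?thesis unfolding top by simp
  next
    case False
    obtain k where k: "1 / real (Suc k) < D x" using False nat_approx_posE by (metis not_le)
    show ?thesis
    proof (cases "D x \<le> 1")
      case True
      have "e2ennreal (- elog (ereal (D x))) = G k x"
        using True False k by (simp add: elog_def G_def truncated_ln_def max_def min_def ennreal_def e2ennreal_def)
      also have "\<dots> \<le> (SUP k. G k x)" by (rule SUP_upper) simp
      finally show ?thesis .
    next
      case False
      then have "- elog (ereal (D x)) \<le> 0" by (simp add: elog_def)
      then have "e2ennreal (- elog (ereal (D x))) = 0" by (simp add: e2ennreal_neg)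
      then show ?thesis by simp
    qed
  qed
  have "L \<le> 0" using L[of 1] log_error_nonpos[OF P, of 1 \<alpha>] \<alpha> by simp
  have "(\<integral>\<^sup>+x. e2ennreal (- elog (ereal (D x))) \<partial>P) \<le> (\<integral>\<^sup>+x. (SUP k. G k x) \<partial>P)"
    by (intro nn_integral_mono ptw)
  also have "\<dots> = (SUP k. \<integral>\<^sup>+x. G k x \<partial>P)"
    by (intro nn_integral_monotone_convergence_SUP inc meas)
  also have "\<dots> \<le> ennreal (- L)"
  proof (rule SUP_least)
    fix k
    have "(\<integral>\<^sup>+x. G k x \<partial>P) = ennreal (\<integral>x. - truncated_ln (1 / real (Suc k)) (D x) \<partial>P)"
      unfolding G_def
      by (intro nn_integral_eq_integral integrable_compactly_carried[OF P] cont)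
         (auto simp: truncated_ln_nonpos)
    also have "\<dots> = ennreal (- log_error (1 / real (Suc k)) P \<alpha>)"
      by (simp add: log_error_def D_def)
    also have "\<dots> \<le> ennreal (- L)" using L[of "1 / real (Suc k)"] by (intro ennreal_leI) simp
    finally show "(\<integral>\<^sup>+x. G k x \<partial>P) \<le> ennreal (- L)" .
  qed
  finally have "enn2ereal (\<integral>\<^sup>+x. e2ennreal (- elog (ereal (D x))) \<partial>P) \<le> enn2ereal (ennreal (- L))"
    by (simp add: less_eq_ennreal.rep_eq)
  then have "enn2ereal (\<integral>\<^sup>+x. e2ennreal (- elog (ereal (D x))) \<partial>P) \<le> ereal (- L)"
    using \<open>L \<le> 0\<close> by (simp add: enn2ereal_ennreal)
  then have "0 - ereal (- L) \<le> ereal_integral P (\<lambda>x. elog (ereal (D x)))"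
    unfolding ereal_integral_def by (intro ereal_minus_mono) auto
  then show ?thesis by (simp add: D_def)
qed

end

text \<open>A two-sided power bound contains both the coefficients and the dimension: after taking
  logarithms and dividing by \<open>log n\<close> the constants disappear.\<close>

lemma quantization_asymptotics:
  fixes d :: "'a \<Rightarrow> 'a \<Rightarrow> real"
  assumes D: "0 < D" and ab: "0 < a" "0 < b"
    and bounds: "\<forall>\<^sub>F n in sequentially. ereal (a * real n powr (- (1 / D))) \<le> geometric_mean_error d P n \<and>
        geometric_mean_error d P n \<le> ereal (b * real n powr (- (1 / D)))"
  shows "0 < lower_quantization_coefficient d P D \<and>
         lower_quantization_coefficient d P D \<le> upper_quantization_coefficient d P D \<and>
         upper_quantization_coefficient d P D < \<infinity> \<and>
         has_quantization_dimension d P D"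
proof (intro conjI)
  define G where "G = geometric_mean_error d P"
  have "\<forall>\<^sub>F n in sequentially. ereal a \<le> ereal (real n powr (1 / D)) * G n \<and>
      ereal (real n powr (1 / D)) * G n \<le> ereal b"
    using bounds eventually_gt_at_top[of 0]
  proof eventually_elim
    case (elim n)
    have one: "real n powr (1 / D) * (c * real n powr (- (1 / D))) = c" for c
      using elim(2) by (simp add: powr_minus)
    have "ereal (real n powr (1 / D)) * ereal (a * real n powr (- (1 / D))) \<le> ereal (real n powr (1 / D)) * G n"
      using elim by (intro ereal_mult_left_mono) (auto simp: G_def)
    moreover have "ereal (real n powr (1 / D)) * G n \<le> ereal (real n powr (1 / D)) * ereal (b * real n powr (- (1 / D)))"
      using elim by (intro ereal_mult_left_mono) (auto simp: G_def)
    ultimately show ?case using one by simp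
  qed
  then have ev: "\<forall>\<^sub>F n in sequentially. ereal a \<le> ereal (real n powr (1 / D)) * G n"
      "\<forall>\<^sub>F n in sequentially. ereal (real n powr (1 / D)) * G n \<le> ereal b"
    by (auto elim: eventually_mono)
  have "ereal a \<le> lower_quantization_coefficient d P D"
    unfolding lower_quantization_coefficient_def G_def[symmetric] using ev(1) by (rule Liminf_bounded)
  then show "0 < lower_quantization_coefficient d P D"
    by (rule less_le_trans[rotated]) (use ab(1) in simp)
  have "upper_quantization_coefficient d P D \<le> ereal b"
    unfolding upper_quantization_coefficient_def G_def[symmetric] using ev(2) by (rule Limsup_bounded)
  then show "upper_quantization_coefficient d P D < \<infinity>" by (rule le_less_trans) simp
  show "lower_quantization_coefficient d P D \<le> upper_quantization_coefficient d P D"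
    unfolding lower_quantization_coefficient_def upper_quantization_coefficient_def
    by (rule Liminf_le_Limsup) simp
  define q where "q n = - ln (real_of_ereal (G n)) / ln (real n)" for n
  have ln_top: "filterlim (\<lambda>n. ln (real n)) at_top sequentially"
    by (rule filterlim_compose[OF ln_at_top filterlim_real_sequentially])
  have lim0: "(\<lambda>n. 1 / D - ln c / ln (real n)) \<longlonglongrightarrow> 1 / D" for c
  proof -
    have "(\<lambda>n. ln c / ln (real n)) \<longlonglongrightarrow> 0"
      by (rule tendsto_divide_0[OF tendsto_const filterlim_at_top_imp_at_infinity[OF ln_top]])
    from tendsto_diff[OF tendsto_const this, of "1 / D"] show ?thesis by simp
  qed
  have G_real: "\<forall>\<^sub>F n in sequentially. 0 < real_of_ereal (G n) \<and> G n = ereal (real_of_ereal (G n)) \<and>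
      1 / D - ln b / ln (real n) \<le> q n \<and> q n \<le> 1 / D - ln a / ln (real n)"
    using bounds eventually_gt_at_top[of 1]
  proof eventually_elim
    case (elim n)
    obtain g where g: "G n = ereal g" "a * real n powr (- (1 / D)) \<le> g" "g \<le> b * real n powr (- (1 / D))"
      using elim(1) by (cases "G n") (auto simp: G_def)
    have n: "0 < ln (real n)" "0 < real n powr (- (1 / D))" using elim(2) by auto
    have g0: "0 < g" using g(2) mult_pos_pos[OF ab(1) n(2)] by linarith
    have lnc: "ln (c * real n powr (- (1 / D))) = ln c - 1 / D * ln (real n)" if "0 < c" for c
      using that elim(2) by (simp add: ln_mult_pos ln_powr)
    have "ln (a * real n powr (- (1 / D))) \<le> ln g" using g(2) mult_pos_pos[OF ab(1) n(2)] by (intro ln_mono)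
    then have 1: "- ln g \<le> 1 / D * ln (real n) - ln a" using lnc[OF ab(1)] by linarith
    have "ln g \<le> ln (b * real n powr (- (1 / D)))" using g(3) g0 by (intro ln_mono)
    then have 2: "1 / D * ln (real n) - ln b \<le> - ln g" using lnc[OF ab(2)] by linarith
    have frac: "1 / D - c / ln (real n) = (1 / D * ln (real n) - c) / ln (real n)" for c
      using n(1) by (simp add: diff_divide_distrib)
    have q: "q n = - ln g / ln (real n)" by (simp add: q_def g(1))
    show ?case
      unfolding q frac
    proof (intro conjI divide_right_mono 1 2)
      show "0 < real_of_ereal (G n)" "G n = ereal (real_of_ereal (G n))" using g0 by (simp_all add: g(1))
    qed (use n(1) in simp_all)
  qed
  have "q \<longlonglongrightarrow> 1 / D"
    by (rule tendsto_sandwich[OF _ _ lim0 lim0]) (use G_real in \<open>auto elim: eventually_mono\<close>)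
  then have inv: "(\<lambda>n. inverse (q n)) \<longlonglongrightarrow> D" using tendsto_inverse[of q "1 / D"] D by fastforce
  have qpos: "\<forall>\<^sub>F n in sequentially. 0 < q n"
    by (rule order_tendstoD(1)[OF \<open>q \<longlonglongrightarrow> 1 / D\<close>]) (use D in simp)
  have "\<forall>\<^sub>F n in sequentially. ereal (inverse (q n)) = ereal (ln (real n)) / (- elog (G n))"
    using G_real qpos eventually_gt_at_top[of 1]
  proof eventually_elim
    case (elim n)
    define g where "g = real_of_ereal (G n)"
    have g: "0 < g" "G n = ereal g" using elim(1) by (auto simp: g_def)
    have "ln g \<noteq> 0" using elim(2) by (auto simp: q_def g_def)
    then show ?case using g elim(3) by (simp add: elog_def q_def g_def[symmetric])
  qed
  then have "(\<lambda>n. ereal (ln (real n)) / (- elog (G n))) \<longlonglongrightarrow> ereal D"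
    by (rule tendsto_cong[THEN iffD1]) (rule tendsto_ereal[OF inv])
  then have "limsup (\<lambda>n. ereal (ln (real n)) / (- elog (G n))) = ereal D"
      "liminf (\<lambda>n. ereal (ln (real n)) / (- elog (G n))) = ereal D"
    by (intro lim_imp_Limsup lim_imp_Liminf; simp)+
  then show "has_quantization_dimension d P D"
    by (simp add: has_quantization_dimension_def lower_quantization_dimension_def
        upper_quantization_dimension_def G_def)
qed

section \<open>Quantization of in-homogeneous self-similar measures\<close>

text \<open>Preimages under the \<open>F\<^sub>i\<close> preserve the number of points, so every piece other than \<open>j\<close> is
  again bounded by the infimum for \<open>P\<close>, and these pieces have total weight \<open>1 - w\<^sub>j < 1\<close>.\<close>

lemma (in norm_metric) log_error_inhomogeneous:
  assumes mix: "mixture I w F Q P" and sim: "\<And>i. i \<in> I \<Longrightarrow> similitude (s i) (F i)"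
    and s: "\<And>i. i \<in> I \<Longrightarrow> s i \<le> 1" and j: "j \<in> I" and Q: "\<And>i. i \<in> I - {j} \<Longrightarrow> Q i = P"
    and \<delta>: "0 < \<delta>" "\<delta> \<le> 1" and \<alpha>: "finite \<alpha>" "\<alpha> \<noteq> {}" "card \<alpha> \<le> n"
    and l: "\<And>\<alpha>. finite \<alpha> \<Longrightarrow> \<alpha> \<noteq> {} \<Longrightarrow> card \<alpha> \<le> n \<Longrightarrow> l \<le> log_error \<delta> (Q j) \<alpha>"
  shows "l + (\<Sum>i\<in>I. w i * ln (s i)) / w j \<le> log_error \<delta> P \<alpha>"
proof -
  have I: "finite I" "\<And>i. i \<in> I \<Longrightarrow> 0 < w i" "sum w I = 1" and P: "compactly_carried P"
    using mix by (auto simp: mixture_def)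
  define c where "c = (\<Sum>i\<in>I. w i * ln (s i))"
  define \<A> where "\<A> = {\<alpha>::'a set. finite \<alpha> \<and> \<alpha> \<noteq> {} \<and> card \<alpha> \<le> n}"
  have vim: "F i -` \<beta> \<in> \<A>" if i: "i \<in> I" and \<beta>: "\<beta> \<in> \<A>" for i \<beta>
  proof -
    have bij: "bij (F i)" by (rule similitude_bij[OF sim[OF i]])
    have "F i -` \<beta> \<noteq> {}"
      using \<beta> by (intro similitude_vimage_nonempty[OF sim[OF i]]) (simp add: \<A>_def)
    moreover have "card (F i -` \<beta>) = card \<beta>"
      using bij by (intro card_vimage_inj) (auto simp: bij_def)
    moreover have "finite (F i -` \<beta>)" using \<beta> bij by (intro finite_vimageI) (auto simp: \<A>_def bij_def)
    ultimately show ?thesis using \<beta> by (simp add: \<A>_def)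
  qed
  have "(w j * l + c) / (1 - (1 - w j)) \<le> log_error \<delta> P \<alpha>"
  proof (rule bootstrap_lower_bound[where F = \<A>])
    show "\<alpha> \<in> \<A>" using \<alpha> by (simp add: \<A>_def)
    show "ln \<delta> \<le> log_error \<delta> P \<beta>" if "\<beta> \<in> \<A>" for \<beta>
      using that by (intro log_error_ge[OF P \<delta>(1)]) (simp add: \<A>_def)
  next
    fix k \<beta> assume k: "\<And>\<gamma>. \<gamma> \<in> \<A> \<Longrightarrow> k \<le> log_error \<delta> P \<gamma>" and \<beta>: "\<beta> \<in> \<A>"
    have "w j * l + c + (1 - w j) * k = c + (\<Sum>i\<in>I. w i * (if i = j then l else k))"
    proof -
      have "(\<Sum>i\<in>I. w i * (if i = j then l else k)) = (\<Sum>i\<in>I. w i * k + (if i = j then w i * (l - k) else 0))"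
        by (intro sum.cong refl) (simp add: algebra_simps)
      also have "\<dots> = k + w j * (l - k)"
        using I(1,3) j by (simp add: sum.distrib flip: sum_distrib_right)
      finally show ?thesis by (simp add: algebra_simps)
    qed
    also have "\<dots> = (\<Sum>i\<in>I. w i * (ln (s i) + (if i = j then l else k)))"
      by (simp add: c_def distrib_left sum.distrib)
    also have "\<dots> \<le> (\<Sum>i\<in>I. w i * (ln (s i) + log_error \<delta> (Q i) (F i -` \<beta>)))"
    proof (intro sum_mono mult_left_mono add_left_mono)
      fix i assume i: "i \<in> I"
      show "(if i = j then l else k) \<le> log_error \<delta> (Q i) (F i -` \<beta>)"
        using l[of "F i -` \<beta>"] k[of "F i -` \<beta>"] vim[OF i \<beta>] Q[of i] i by (auto simp: \<A>_def)
    qed (use I(2) in \<open>simp add: less_imp_le\<close>)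
    also have "\<dots> \<le> log_error \<delta> P \<beta>"
      using \<beta> by (intro log_error_mixture[OF mix sim s \<delta>]) (simp_all add: \<A>_def)
    finally show "w j * l + c + (1 - w j) * k \<le> log_error \<delta> P \<beta>" .
  qed (use I(2)[OF j] in simp)
  then show ?thesis using I(2)[OF j] by (simp add: c_def add_divide_distrib)
qed

text \<open>The two cases of the theorem are instances of this: in the first one the system \<open>h\<close> is \<open>f\<close>,
  in the second one it is \<open>g\<close>.\<close>

lemma (in norm_metric) inhomogeneous_quantization:
  fixes \<mu> \<nu> :: "'a measure"
  assumes N: "1 \<le> N" and f: "\<And>i. i \<in> {1..N} \<Longrightarrow> similitude (s i) (f i)" "\<And>i. i \<in> {1..N} \<Longrightarrow> s i < 1"
    and p: "probability_vector {0..N} p" "\<And>i. i \<in> {0..N} \<Longrightarrow> 0 < p i"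
    and C: "compact (topological_support \<nu>)"
    and \<mu>: "inhomogeneous_self_similar_measure N f p \<nu> \<mu>"
    and m: "2 \<le> m" and h: "\<And>i. i \<in> {1..m} \<Longrightarrow> similitude (r i) (h i)" "\<And>i. i \<in> {1..m} \<Longrightarrow> r i < 1"
    and osc: "open_set_condition m h"
    and t: "probability_vector {1..m} t" "\<And>i. i \<in> {1..m} \<Longrightarrow> 0 < t i"
    and \<nu>: "self_similar_measure m h t \<nu>"
    and D: "D = (\<Sum>i=1..m. t i * ln (t i)) / (\<Sum>i=1..m. t i * ln (r i))"
  shows "0 < lower_quantization_coefficient d \<mu> D \<and>
         lower_quantization_coefficient d \<mu> D \<le> upper_quantization_coefficient d \<mu> D \<and>
         upper_quantization_coefficient d \<mu> D < \<infinity> \<and>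
         has_quantization_dimension d \<mu> D"
proof -
  define K where "K = topological_support \<nu>"
  have b\<nu>: "borel_probability \<nu>" using \<nu> by (simp add: self_similar_measure_def)
  have K: "measure \<nu> K = 1" "K \<noteq> {}"
    unfolding K_def using measure_topological_support(2)[OF b\<nu>] by auto
  have mix\<nu>: "mixture {1..m} t h (\<lambda>_. \<nu>) \<nu>"
    using similitude_continuous[OF h(1)] by (intro self_similar_measure_imp_mixture \<nu> C t)
  interpret self_similar_ifs d m h r K t \<nu>
  proof unfold_locales
    show "K = (\<Union>i\<in>{1..m}. h i ` K)" using support_self_similar[OF mix\<nu> K_def] C by (simp add: K_def)
  qed (use m h C K mix\<nu> in \<open>auto simp: K_def\<close>)
  have cc\<nu>: "compactly_carried \<nu>" by (rule compactly_carried_P)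
  have psum: "sum p {0..N} = 1" using p(1) by (simp add: probability_vector_def)
  have cc\<mu>: "compactly_carried \<mu>"
    by (rule inhomogeneous_imp_compactly_carried[OF \<mu> cc\<nu> f p(2) psum])
  define F Q S where "F = f(0 := id)" and "Q = (\<lambda>_::nat. \<mu>)(0 := \<nu>)" and "S = s(0 := 1)"
  have mix\<mu>: "mixture {0..N} p F Q \<mu>"
    unfolding F_def Q_def
    using similitude_continuous[OF f(1)] by (intro inhomogeneous_imp_mixture[OF \<mu> cc\<nu> cc\<mu> _ p(2) psum])
  have simF: "similitude (S i) (F i)" if "i \<in> {0..N}" for i
    using that f(1) similitude_id by (auto simp: F_def S_def)
  have S1: "S i \<le> 1" if "i \<in> {0..N}" for i using that f(2)[of i] by (auto simp: S_def)
  have p1: "p i < 1" if "i \<in> {0..N}" for i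
    using weight_less_1[of "{0..N}" p i "if i = 0 then 1 else 0"] p(2) psum that N by auto
  define e where "e = 1 / D"
  have tln: "(\<Sum>i=1..m. t i * ln (t i)) < 0"
  proof -
    have "(\<Sum>i=1..m. t i * ln (t i)) < (\<Sum>i=1..m. 0)"
      using m t_pos t_less_1 by (intro sum_strict_mono) (auto intro!: mult_pos_neg)
    then show ?thesis by simp
  qed
  have D0: "0 < D" unfolding D using tln mean_ln_ratio_neg
    by (simp add: mean_ln_ratio_def zero_less_divide_iff)
  have bal: "(\<Sum>i=1..m. t i * (ln (r i) - e * ln (t i))) = 0"
  proof -
    have "(\<Sum>i=1..m. t i * (ln (r i) - e * ln (t i))) = mean_ln_ratio - e * (\<Sum>i=1..m. t i * ln (t i))"
      by (simp add: mean_ln_ratio_def right_diff_distrib sum_subtractf sum_distrib_left mult.left_commute)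
    also have "e * (\<Sum>i=1..m. t i * ln (t i)) = mean_ln_ratio"
      using tln mean_ln_ratio_neg by (simp add: e_def D mean_ln_ratio_def)
    finally show ?thesis by simp
  qed
  have e0: "0 \<le> e" using D0 by (simp add: e_def)
  have "\<exists>A K. 0 < A \<and> (\<forall>x\<ge>1. quantizable \<nu> A K e x)"
    using t_less_1 bal by (intro quantizable_self[OF mix\<nu> h(1) _ e0, where J = "{1..m}"]) auto
  then obtain A\<^sub>0 K\<^sub>0 where q\<nu>: "\<forall>x\<ge>1. quantizable \<nu> A\<^sub>0 K\<^sub>0 e x" by blast
  have "\<exists>A K. 0 < A \<and> (\<forall>x\<ge>1. quantizable \<mu> A K e x)"
  proof (rule quantizable_self[OF mix\<mu> simF p1 e0, where J = "{1..N}"])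
    show "\<exists>A K. \<forall>x\<ge>1. quantizable (Q i) A K e x" if "i \<in> {0..N} - {1..N}" for i
    proof -
      have "Q i = \<nu>" using that by (auto simp: Q_def)
      then show ?thesis using q\<nu> by blast
    qed
    show "(\<Sum>i\<in>{0..N}. p i * (ln (S i) - e * ln (p i))) \<le> 0" if "{1..N} = {0..N}"
      using that by (metis atLeastAtMost_iff le0 not_one_le_zero)
  qed (auto simp: Q_def)
  then obtain A U where A: "0 < A" and U: "\<And>x. 1 \<le> x \<Longrightarrow> quantizable \<mu> A U e x" by blast
  obtain L where L: "\<And>\<delta> \<alpha> n. 0 < \<delta> \<Longrightarrow> \<delta> \<le> 1 \<Longrightarrow> finite \<alpha> \<Longrightarrow> \<alpha> \<noteq> {} \<Longrightarrow> card \<alpha> \<le> n \<Longrightarrow>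
      - e * ln (real n) - L \<le> log_error \<delta> \<nu> \<alpha>"
    using log_error_lower_bound[OF osc e0] bal by auto
  define L' where "L' = L - (\<Sum>i\<in>{0..N}. p i * ln (S i)) / p 0"
  have powr_exp: "exp (c - e * ln (real n)) = exp c * real n powr (- (1 / D))" if "0 < n" for c n
    using that by (simp add: powr_def e_def exp_diff exp_minus divide_inverse)
  have upper: "geometric_mean_error d \<mu> n \<le> ereal (exp (U + e * ln A) * real n powr (- (1 / D)))"
    if n: "A \<le> real n" "0 < n" for n
  proof -
    have "quantizable \<mu> A U e (real n / A)" using n A by (intro U) simp
    then obtain \<alpha> \<delta> where \<alpha>: "finite \<alpha>" "\<alpha> \<noteq> {}" "real (card \<alpha>) \<le> A * (real n / A)" and \<delta>: "0 < \<delta>"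
      and int: "(\<integral>y. ln (max \<delta> (dist_to_set d y \<alpha>)) \<partial>\<mu>) \<le> U - e * ln (real n / A)"
      unfolding quantizable_def by blast
    have "card \<alpha> \<le> n" using \<alpha>(3) A by simp
    then have \<alpha>n: "\<alpha> \<in> quantizer_sets n" using \<alpha> by (simp add: quantizer_sets_def Suc_le_eq card_gt_0_iff)
    have "ereal_integral \<mu> (\<lambda>x. elog (ereal (dist_to_set d x \<alpha>))) \<le> ereal (U - e * ln (real n / A))"
      using ereal_integral_le[OF cc\<mu> \<alpha>(2) \<delta>] int by (meson ereal_less_eq(3) order_trans)
    also have "U - e * ln (real n / A) = (U + e * ln A) - e * ln (real n)"
      using n A by (simp add: ln_div algebra_simps)
    finally have "eexp (ereal_integral \<mu> (\<lambda>x. elog (ereal (dist_to_set d x \<alpha>))))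
        \<le> ereal (exp ((U + e * ln A) - e * ln (real n)))"
      using eexp_mono by fastforce
    then have "geometric_mean_error d \<mu> n \<le> ereal (exp ((U + e * ln A) - e * ln (real n)))"
      unfolding geometric_mean_error_def using \<alpha>n by (rule INF_lower2[rotated])
    then show ?thesis by (simp only: powr_exp[OF n(2)])
  qed
  have lower: "ereal (exp (- L') * real n powr (- (1 / D))) \<le> geometric_mean_error d \<mu> n" if n: "0 < n" for n
    unfolding geometric_mean_error_def
  proof (rule INF_greatest)
    fix \<alpha> :: "'a set" assume "\<alpha> \<in> quantizer_sets n"
    then have \<alpha>: "finite \<alpha>" "\<alpha> \<noteq> {}" "card \<alpha> \<le> n" by (auto simp: quantizer_sets_def)
    have "ereal (- L' - e * ln (real n)) \<le> ereal_integral \<mu> (\<lambda>x. elog (ereal (dist_to_set d x \<alpha>)))"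
    proof (rule ereal_integral_ge[OF cc\<mu> \<alpha>(2)])
      fix \<delta> :: real assume \<delta>: "0 < \<delta>" "\<delta> \<le> 1"
      have "(- e * ln (real n) - L) + (\<Sum>i\<in>{0..N}. p i * ln (S i)) / p 0 \<le> log_error \<delta> \<mu> \<alpha>"
      proof (rule log_error_inhomogeneous[OF mix\<mu> simF S1 _ _ \<delta> \<alpha>])
        show "- e * ln (real n) - L \<le> log_error \<delta> (Q 0) \<alpha>"
          if "finite \<alpha>" "\<alpha> \<noteq> {}" "card \<alpha> \<le> n" for \<alpha>
          using L[OF \<delta> that] by (simp add: Q_def)
      qed (auto simp: Q_def)
      then show "- L' - e * ln (real n) \<le> log_error \<delta> \<mu> \<alpha>" by (simp add: L'_def)
    qed
    then have "eexp (ereal (- L' - e * ln (real n))) \<le> eexp (ereal_integral \<mu> (\<lambda>x. elog (ereal (dist_to_set d x \<alpha>))))"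
      by (rule eexp_mono)
    then show "ereal (exp (- L') * real n powr (- (1 / D)))
        \<le> eexp (ereal_integral \<mu> (\<lambda>x. elog (ereal (dist_to_set d x \<alpha>))))"
      by (simp only: eexp_ereal powr_exp[OF n])
  qed
  show ?thesis
  proof (rule quantization_asymptotics[OF D0])
    show "\<forall>\<^sub>F n in sequentially. ereal (exp (- L') * real n powr (- (1 / D))) \<le> geometric_mean_error d \<mu> n \<and>
        geometric_mean_error d \<mu> n \<le> ereal (exp (U + e * ln A) * real n powr (- (1 / D)))"
      using eventually_gt_at_top[of 0] eventually_ge_at_top[of "nat \<lceil>A\<rceil>"]
    proof eventually_elim
      case (elim n)
      then have "A \<le> real n" by linarith
      then show ?case using upper lower elim(1) by blast
    qed
  qed simp_all
qed

theorem theorem1p2: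
  fixes d :: "real ^ 'q \<Rightarrow> real ^ 'q \<Rightarrow> real"
    and N M :: nat
    and f g :: "nat \<Rightarrow> real ^ 'q \<Rightarrow> real ^ 'q"
    and s c p t :: "nat \<Rightarrow> real"
    and E C :: "(real ^ 'q) set"
    and \<mu> \<nu> :: "(real ^ 'q) measure"
    and d\<^sub>0 :: real
  assumes "norm_induced_metric d"
    and "1 \<le> N"
    and "\<forall>i\<in>{1..N}. contractive_similitude d (s i) (f i)"
    and "attractor N f E"
    and "probability_vector {0..N} p"
    and "\<forall>i\<in>{0..N}. 0 < p i"
    and "borel_probability \<nu>"
    and "C = topological_support \<nu>"
    and "compact C"
    and "inhomogeneous_self_similar_measure N f p \<nu> \<mu>"
    and "(case_I N f \<nu> t \<and>
            d\<^sub>0 = (\<Sum>i=1..N. t i * ln (t i)) / (\<Sum>i=1..N. t i * ln (s i))) \<or>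
         (case_II d N f E \<nu> C M g c t \<and>
            d\<^sub>0 = (\<Sum>i=1..M. t i * ln (t i)) / (\<Sum>i=1..M. t i * ln (c i)))"
  shows "0 < lower_quantization_coefficient d \<mu> d\<^sub>0 \<and>
         lower_quantization_coefficient d \<mu> d\<^sub>0 \<le> upper_quantization_coefficient d \<mu> d\<^sub>0 \<and>
         upper_quantization_coefficient d \<mu> d\<^sub>0 < \<infinity> \<and>
         has_quantization_dimension d \<mu> d\<^sub>0"
proof -
  interpret norm_metric d by unfold_locales (rule assms(1))
  have sim: "similitude r h" "r < 1" if "contractive_similitude d r h" for r h
    using that by (auto simp: contractive_similitude_def similitude_def)
  have f: "similitude (s i) (f i)" "s i < 1" if "i \<in> {1..N}" for i
    using sim[OF assms(3)[rule_format, OF that]] .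
  have C: "compact (topological_support \<nu>)" using assms(8,9) by simp
  from assms(11) show ?thesis
  proof (elim disjE conjE)
    assume I: "case_I N f \<nu> t"
      and D: "d\<^sub>0 = (\<Sum>i=1..N. t i * ln (t i)) / (\<Sum>i=1..N. t i * ln (s i))"
    show ?thesis by (rule inhomogeneous_quantization[OF assms(2) _ _ assms(5) _ C assms(10) _ _ _ _ _ _ _ D])
        (use I f assms(6) in \<open>auto simp: case_I_def\<close>)
  next
    assume II: "case_II d N f E \<nu> C M g c t"
      and D: "d\<^sub>0 = (\<Sum>i=1..M. t i * ln (t i)) / (\<Sum>i=1..M. t i * ln (c i))"
    then have g: "similitude (c i) (g i)" "c i < 1" if "i \<in> {1..M}" for i
      using sim[of "c i" "g i"] that by (auto simp: case_II_def)
    show ?thesis by (rule inhomogeneous_quantization[OF assms(2) _ _ assms(5) _ C assms(10) _ _ _ _ _ _ _ D])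
        (use II f g assms(6) in \<open>auto simp: case_II_def\<close>)
  qed
qed

end
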